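(* Let $p(n)$ denote the number of integer partitions of $n$, and for $n \geq 1$ let $u_n = \frac{p(n+1)p(n-1)}{p(n)^2}$. Then for all integers $n \geq 2$, $$4(1-u_n)(1-u_{n+1}) < \left(1 + \frac{\pi}{\sqrt{24}\, n^{3/2}}\right)(1 - u_n u_{n+1})^2.$$
   Context: $p(0)=1$, and $p(n)$ is the number of partitions of the nonnegative integer $n$. *)

theory Defs
  imports Complex_Main "HOL-Library.Multiset"
begin

definition partitions :: "nat \<Rightarrow> nat multiset set" where
  "partitions n = {M. 0 \<notin># M \<and> sum_mset M = n}"

lemma finite_partitions: "finite (partitions n)"
proof (rule finite_subset)
  show "partitions n \<subseteq> mset ` {xs. set xs \<subseteq> {..n} \<and> length xs \<le> n}"
  proof
    fix M assume "M \<in> partitions n"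
    then have nz: "0 \<notin># M" and s: "sum_mset M = n"
      by (auto simp: partitions_def)
    obtain xs where xs: "mset xs = M" by (metis ex_mset)
    have le: "sum_list xs = n"
      using s xs by (metis sum_mset_sum_list)
    have pos: "0 \<notin> set xs"
      using nz xs by (metis set_mset_mset)
    have "length ys \<le> sum_list ys" if "0 \<notin> set ys" for ys :: "nat list"
      using that by (induction ys) auto
    then have "length xs \<le> n" using pos le by blast
    moreover have "set xs \<subseteq> {..n}"
      using le member_le_sum_list by fastforce
    ultimately show "M \<in> mset ` {xs. set xs \<subseteq> {..n} \<and> length xs \<le> n}"
      using xs by blast
  qed
  show "finite (mset ` {xs. set xs \<subseteq> {..n} \<and> length xs \<le> n})"
    by (intro finite_imageI finite_lists_length_le) simp
qed

definition p :: "nat \<Rightarrow> nat" where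
  "p n = card (partitions n)"

lemma p_0: "p 0 = 1"
proof -
  have "partitions 0 = {{#}}"
    by (auto simp: partitions_def) (metis multiset_nonemptyE)
  then show ?thesis by (simp add: p_def)
qed

text \<open>Only meaningful for \<open>n \<ge> 1\<close>, since \<open>n - 1\<close> is truncated subtraction.\<close>

definition u :: "nat \<Rightarrow> real" where
  "u n = real (p (n + 1)) * real (p (n - 1)) / (real (p n))\<^sup>2"

end

theory Submission
  imports Defs "HOL-Complex_Analysis.Complex_Analysis" "HOL-Real_Asymp.Real_Asymp"
    "HOL-Probability.Distributions"
begin

text \<open>
  Write \<open>\<epsilon> n = pi / (sqrt 24 * n powr (3 / 2))\<close>. If \<open>u n\<close> and \<open>u (n + 1)\<close> both lie strictly between
  \<open>1 / (1 + \<epsilon> n)\<close> and \<open>1\<close>, the inequality is elementary, so it suffices to know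
  \<open>1 / (1 + \<epsilon> n) < u n < 1\<close> for \<open>n \<ge> 45\<close> and to compute for smaller \<open>n\<close>.
  Since \<open>1 - u n = \<epsilon> n - 1 / n\<^sup>2 + \<dots>\<close>, this needs \<open>p n\<close> with a relative error well below \<open>1 / n\<^sup>2\<close>,
  which the first term of Rademacher's series provides. That term comes from Cauchy's formula along
  the vertical line through two points of the circle \<open>norm z = r\<close> around the saddle point: the modular
  transformation of the generating function is exact, so on the far part of the line the trivial
  bound for the transformed series is already good enough, and on the near part the leading term
  can be moved to the circle, where it becomes a Gaussian integral. The transformation itself is
  a rearrangement, for real argument, of the double series of \<open>2 * \<tau> / ((m * \<tau>)\<^sup>2 + k\<^sup>2)\<close>, made
  absolutely convergent by subtracting integrals over unit intervals.
\<close>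

section \<open>The generating function of the partition numbers\<close>

text \<open>The threshold 45 is forced: \<open>1 / (1 + u_eps n) < u n\<close> fails at
  \<open>n = 44\<close>, where the second term of Rademacher's series, whose sign alternates with
  the parity of \<open>n\<close>, still disturbs \<open>u n\<close> too much. The line is
  \<open>Re z = r / 2\<close>. If \<open>c\<close> is the coefficient of \<open>z\<close> in the
  exponent, the trivial bound at height 1/2 on a line \<open>Re z = x\<close> has exponent about
  \<open>c * x + pi / (48 * x)\<close>. This is least at \<open>x = r / 2\<close>, with value
  \<open>X / 2\<close>, where \<open>X = pi * sqrt (2 / 3 * (n - 1 / 24))\<close>; the line then
  meets the circle at the angles \<open>pi / 3\<close> and \<open>- pi / 3\<close>. Rademacher's
  second term also grows like \<open>exp (X / 2)\<close>, so up to powers of \<open>X\<close>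
  nothing is lost. The relative error is thus of order \<open>X\<^sup>2 * exp (- X / 2)\<close>. It
  must stay below a small multiple of \<open>1 / n\<^sup>2\<close>, which is secured for
  \<open>X \<ge> 50\<close>; this fixes the limit 385 between computation and asymptotics.\<close>

lemma sums_swap_nonneg:
  fixes f :: "nat \<Rightarrow> nat \<Rightarrow> real"
  assumes nonneg: "\<And>i j. f i j \<ge> 0"
    and rows: "\<And>i. f i sums g i" and total: "g sums S"
    and cols: "\<And>j. (\<lambda>i. f i j) sums h j"
  shows "h sums S"
proof -
  have row: "(f i has_sum g i) UNIV" for i
    using rows nonneg by (intro sums_nonneg_imp_has_sum) auto
  have col: "((\<lambda>i. f i j) has_sum h j) UNIV" for j
    using cols nonneg by (intro sums_nonneg_imp_has_sum) auto
  have "g i \<ge> 0" for i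
    using rows nonneg by (metis sums_unique suminf_nonneg sums_summable)
  then have g: "(g has_sum S) UNIV"
    using total by (intro sums_nonneg_imp_has_sum) auto
  have "(\<lambda>(i, j). f i j) summable_on UNIV \<times> UNIV"
    by (rule summable_on_SigmaI[where g = g])
       (use row g nonneg in \<open>auto simp: summable_on_def\<close>)
  then have total': "((\<lambda>(i, j). f i j) has_sum S) (UNIV \<times> UNIV)"
    by (intro has_sum_SigmaI[where g = g]) (use row g in auto)
  then have "((\<lambda>(j, i). f i j) has_sum S) (UNIV \<times> UNIV)"
    by (subst has_sum_swap) simp
  then have "(h has_sum S) UNIV"
    by (rule has_sum_SigmaD) (use col in auto)
  then show ?thesis
    by (rule has_sum_imp_sums)
qed

lemma sum_le_sums:
  fixes f :: "nat \<Rightarrow> real"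
  assumes "f sums s" and "\<And>n. f n \<ge> 0"
  shows "sum f {..<N} \<le> s"
proof -
  have "sum f {..<N} \<le> suminf f"
    using assms by (intro sum_le_suminf sums_summable[OF assms(1)]) auto
  then show ?thesis
    using sums_unique[OF assms(1)] by (rule ord_le_eq_trans[OF _ sym])
qed

section \<open>Partitions with bounded parts and Euler's product\<close>

definition bounded_partitions :: "nat \<Rightarrow> nat \<Rightarrow> nat multiset set" where
  "bounded_partitions k n = {M \<in> partitions n. set_mset M \<subseteq> {..k}}"

definition bounded_p :: "nat \<Rightarrow> nat \<Rightarrow> nat" where
  "bounded_p k n = card (bounded_partitions k n)"

lemma finite_bounded_partitions: "finite (bounded_partitions k n)"
  unfolding bounded_partitions_def by (rule finite_subset[OF _ finite_partitions]) auto

lemma bounded_p_le_p: "bounded_p k n \<le> p n"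
  unfolding bounded_p_def p_def
  by (rule card_mono[OF finite_partitions]) (auto simp: bounded_partitions_def)

lemma bounded_p_eq_p:
  assumes "n \<le> k"
  shows "bounded_p k n = p n"
proof -
  have "x \<le> k" if "M \<in> partitions n" "x \<in># M" for M x
    using that assms sum_mset.remove[of x M] by (auto simp: partitions_def)
  then have "bounded_partitions k n = partitions n"
    by (auto simp: bounded_partitions_def)
  then show ?thesis
    by (simp add: bounded_p_def p_def)
qed

lemma bounded_p_0: "bounded_p 0 n = (if n = 0 then 1 else 0)"
proof -
  have "0 \<notin># M \<and> set_mset M \<subseteq> {..0} \<longleftrightarrow> M = {#}" for M :: "nat multiset"
    by (cases M) auto
  then have "M \<in> bounded_partitions 0 n \<longleftrightarrow> M = {#} \<and> n = 0" for M
    unfolding bounded_partitions_def partitions_def mem_Collect_eq by (metis sum_mset.empty)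
  then have "bounded_partitions 0 n = (if n = 0 then {{#}} else {})"
    by (intro set_eqI) simp
  then show ?thesis
    by (simp add: bounded_p_def)
qed

text \<open>A partition in which \<open>Suc k\<close> occurs is one copy of \<open>Suc k\<close>
  added to a partition of \<open>n - Suc k\<close>. Both the real product formula and the formal one
  behind the pentagonal recurrence rest on this recursion.\<close>

lemma bounded_p_Suc:
  "bounded_p (Suc k) n = bounded_p k n + (if Suc k \<le> n then bounded_p (Suc k) (n - Suc k) else 0)"
proof -
  let ?A = "{M \<in> bounded_partitions (Suc k) n. Suc k \<in># M}"
  have split: "bounded_partitions (Suc k) n = bounded_partitions k n \<union> ?A"
    by (auto simp: bounded_partitions_def) (metis atMost_iff in_mono le_Suc_eq)
  have disj: "bounded_partitions k n \<inter> ?A = {}"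
    by (auto simp: bounded_partitions_def)
  have A: "?A = (if Suc k \<le> n then add_mset (Suc k) ` bounded_partitions (Suc k) (n - Suc k) else {})"
  proof -
    have "M \<in> add_mset (Suc k) ` bounded_partitions (Suc k) (n - Suc k) \<and> Suc k \<le> n" if M: "M \<in> ?A" for M
    proof -
      obtain M' where M': "M = add_mset (Suc k) M'"
        using M by (metis (no_types, lifting) mem_Collect_eq mset_add)
      with M show ?thesis
        by (auto simp: bounded_partitions_def partitions_def)
    qed
    moreover have "add_mset (Suc k) M \<in> ?A" if "Suc k \<le> n" "M \<in> bounded_partitions (Suc k) (n - Suc k)" for M
      using that by (auto simp: bounded_partitions_def partitions_def)
    ultimately show ?thesis
      by auto
  qed
  have "card ?A = (if Suc k \<le> n then bounded_p (Suc k) (n - Suc k) else 0)"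
    unfolding A bounded_p_def by (auto intro!: card_image simp: inj_on_def)
  moreover have "card (bounded_partitions (Suc k) n) = card (bounded_partitions k n) + card ?A"
    using disj finite_bounded_partitions by (subst split, intro card_Un_disjoint) auto
  ultimately show ?thesis
    by (simp add: bounded_p_def)
qed

lemma bounded_p_sums:
  fixes q :: real
  assumes "0 < q" "q < 1"
  shows "(\<lambda>n. real (bounded_p k n) * q ^ n) sums (\<Prod>j<k. 1 / (1 - q ^ Suc j))"
proof (induction k)
  case 0
  show ?case
    using sums_single[of 0 "\<lambda>n. q ^ n"] by (simp add: bounded_p_0 if_distrib if_distribR cong: if_cong)
next
  case (Suc k)
  define a where "a = (\<lambda>n. real (bounded_p k n) * q ^ n)"
  define b where "b = (\<lambda>n. real (bounded_p (Suc k) n) * q ^ n)"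
  define A where "A = (\<Prod>j<k. 1 / (1 - q ^ Suc j))"
  have a: "a sums A"
    using Suc by (simp add: a_def A_def)
  have pos: "a n \<ge> 0" "b n \<ge> 0" for n
    using assms by (auto simp: a_def b_def)
  have qk: "q ^ Suc k < 1"
    using assms by (metis power_less_one_iff less_imp_le zero_less_Suc)
  have b_small: "b n = a n" if "n < Suc k" for n
    using that by (simp add: b_def a_def bounded_p_Suc)
  have b_shift: "b (n + Suc k) = a (n + Suc k) + q ^ Suc k * b n" for n
    unfolding b_def a_def by (subst bounded_p_Suc) (simp add: algebra_simps power_add)
  have rec: "sum b {..<N + Suc k} = sum a {..<N + Suc k} + q ^ Suc k * sum b {..<N}" for N
  proof -
    have split: "sum f {..<N + K} = sum f {..<K} + (\<Sum>n<N. f (n + K))" for f :: "nat \<Rightarrow> real" and K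
      by (induction N) (auto simp: algebra_simps)
    show ?thesis
      unfolding split[of a "Suc k"] split[of b "Suc k"] b_shift
      using b_small by (simp add: sum.distrib sum_distrib_left)
  qed
  \<comment> \<open>The recursion bounds each partial sum of \<open>b\<close> by \<open>A\<close>
    plus \<open>q ^ Suc k < 1\<close> times itself, so boundedness is available before convergence
    is known.\<close>
  have bound: "sum b {..<N} \<le> A / (1 - q ^ Suc k)" for N
  proof -
    have "sum b {..<N} \<le> sum b {..<N + Suc k}"
      using pos by (intro sum_mono2) auto
    also have "\<dots> \<le> A + q ^ Suc k * sum b {..<N}"
      unfolding rec using sum_le_sums[OF a pos(1)] by (rule add_right_mono)
    finally show ?thesis
      using qk by (simp add: field_simps)
  qed
  have "summable b"
    using pos bound by (intro bounded_imp_summable[of _ "A / (1 - q ^ Suc k)"])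
      (auto simp: lessThan_Suc_atMost[symmetric] simp del: sum.lessThan_Suc)
  then obtain B where B: "b sums B"
    by (auto simp: summable_def)
  have "(\<lambda>N. sum b {..<N + Suc k}) \<longlonglongrightarrow> B"
    using B unfolding sums_def by (rule LIMSEQ_ignore_initial_segment)
  moreover have "(\<lambda>N. sum a {..<N + Suc k} + q ^ Suc k * sum b {..<N}) \<longlonglongrightarrow> A + q ^ Suc k * B"
    using a B unfolding sums_def by (intro tendsto_intros LIMSEQ_ignore_initial_segment)
  ultimately have "B = A + q ^ Suc k * B"
    unfolding rec by (rule LIMSEQ_unique)
  then have "B = A * (1 / (1 - q ^ Suc k))"
    using qk by (simp add: field_simps)
  then show ?case
    using B by (simp add: A_def b_def)
qed

text \<open>Expand every logarithm into its power series and sum over \<open>j\<close> first: the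
  inner series are geometric, and all terms are positive. \<open>L\<close> stays a parameter because
  its closed form in terms of \<open>kappa_defect\<close> comes only later.\<close>

lemma ln_euler_product_sums:
  fixes q L :: real
  assumes q: "0 < q" "q < 1"
    and L: "(\<lambda>m. q ^ Suc m / (real (Suc m) * (1 - q ^ Suc m))) sums L"
  shows "(\<lambda>j. - ln (1 - q ^ Suc j)) sums L"
proof (rule sums_swap_nonneg[OF _ _ L])
  define f where "f = (\<lambda>m j. q ^ (Suc m * Suc j) / real (Suc m))"
  have lt1: "q ^ Suc j < 1" for j
    using q by (metis power_less_one_iff less_imp_le zero_less_Suc)
  show "f m j \<ge> 0" for m j
    using q by (simp add: f_def)
  show "f m sums (q ^ Suc m / (real (Suc m) * (1 - q ^ Suc m)))" for m
  proof -
    have "(\<lambda>j. q ^ Suc m / real (Suc m) * (q ^ Suc m) ^ j) sums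
            (q ^ Suc m / real (Suc m) * (1 / (1 - q ^ Suc m)))"
      using lt1[of m] q by (intro sums_mult geometric_sums) simp
    moreover have "q ^ Suc m / real (Suc m) * (q ^ Suc m) ^ j = f m j" for j
    proof -
      have "q ^ Suc m * (q ^ Suc m) ^ j = q ^ (Suc m * Suc j)"
        by (metis mult_Suc_right power_add power_mult)
      then show ?thesis
        by (simp only: f_def times_divide_eq_left)
    qed
    ultimately show ?thesis
      by (simp only: times_divide_times_eq mult_1_right)
  qed
  show "(\<lambda>m. f m j) sums (- ln (1 - q ^ Suc j))" for j
  proof -
    define x where "x = q ^ Suc j"
    have x: "0 < x" "x < 1"
      using q lt1 by (auto simp: x_def)
    have "(\<lambda>n. x ^ n / of_nat n) sums (- ln (1 - x))"
      using sums_minus[OF ln_series'[of "- x"]] x by simp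
    then have "(\<lambda>m. x ^ Suc m / of_nat (Suc m)) sums (- ln (1 - x))"
      by (subst sums_Suc_iff) simp
    moreover have "x ^ Suc m / of_nat (Suc m) = f m j" for m
      unfolding f_def x_def by (metis mult.commute power_mult)
    ultimately show ?thesis
      by (simp only: x_def)
  qed
qed

text \<open>A squeeze: below degree \<open>N\<close> the coefficients \<open>p\<close> and
  \<open>bounded_p N\<close> agree, so the partial sums stay below the finite products; conversely
  each finite product is a series with coefficients at most \<open>p\<close>.\<close>

lemma p_sums_exp:
  fixes q L :: real
  assumes q: "0 < q" "q < 1"
    and L: "(\<lambda>m. q ^ Suc m / (real (Suc m) * (1 - q ^ Suc m))) sums L"
  shows "(\<lambda>n. real (p n) * q ^ n) sums exp L"
proof -
  define P where "P = (\<lambda>k. \<Prod>j<k. 1 / (1 - q ^ Suc j))"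
  have lt1: "q ^ Suc j < 1" for j
    using q by (metis power_less_one_iff less_imp_le zero_less_Suc)
  have P_exp: "P k = exp (\<Sum>j<k. - ln (1 - q ^ Suc j))" for k
    using lt1 by (simp add: P_def exp_sum exp_minus inverse_eq_divide del: power_Suc)
  have ln_sums: "(\<lambda>j. - ln (1 - q ^ Suc j)) sums L"
    by (rule ln_euler_product_sums[OF q L])
  then have P_lim: "P \<longlonglongrightarrow> exp L"
    unfolding P_exp[abs_def] sums_def by (intro tendsto_exp)
  have P_le: "P k \<le> exp L" for k
    unfolding P_exp using lt1 q
    by (subst exp_le_cancel_iff, intro sum_le_sums[OF ln_sums]) (auto simp del: power_Suc simp: less_imp_le)
  have bounded: "(\<Sum>n<N. real (p n) * q ^ n) \<le> exp L" for N
  proof -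
    have "(\<Sum>n<N. real (p n) * q ^ n) = (\<Sum>n<N. real (bounded_p N n) * q ^ n)"
      by (intro sum.cong) (auto simp: bounded_p_eq_p)
    also have "\<dots> \<le> P N"
      unfolding P_def using q by (intro sum_le_sums bounded_p_sums) auto
    also note P_le
    finally show ?thesis .
  qed
  have summable: "summable (\<lambda>n. real (p n) * q ^ n)"
    using bounded[of "Suc _"] q by (intro bounded_imp_summable[of _ "exp L"]) (auto simp: lessThan_Suc_atMost)
  have "P k \<le> (\<Sum>n. real (p n) * q ^ n)" for k
    unfolding P_def using bounded_p_le_p q
    by (intro sums_le[OF _ bounded_p_sums summable_sums[OF summable]]) (auto intro: mult_right_mono)
  then have "exp L \<le> (\<Sum>n. real (p n) * q ^ n)"
    by (intro LIMSEQ_le_const2[OF P_lim]) auto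
  moreover have "(\<Sum>n. real (p n) * q ^ n) \<le> exp L"
    using bounded by (intro suminf_le_const summable) auto
  ultimately show ?thesis
    using summable by (simp add: sums_iff)
qed

section \<open>The modular transformation\<close>

text \<open>This is \<open>pi * coth (pi * x) - 1 / x\<close>, written so that the denominators
  \<open>exp (2 * pi * m * \<tau>) - 1\<close> of the Lambert series become visible.\<close>

definition kappa :: "real \<Rightarrow> real" where
  "kappa x = pi + 2 * pi / (exp (2 * pi * x) - 1) - 1 / x"

lemma ln_sinh_product_sums:
  fixes x :: real
  assumes "x > 0"
  shows "(\<lambda>k. ln (1 + x\<^sup>2 / (real (Suc k))\<^sup>2)) sums (ln (sinh (pi * x)) - ln (pi * x))"
proof -
  define P where "P = (\<lambda>n. \<Prod>k=1..n. 1 + x\<^sup>2 / (real k)\<^sup>2)"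
  have prod: "(\<Prod>k=1..n. 1 - (\<i> * of_real x)\<^sup>2 / (of_nat k)\<^sup>2) = (of_real (P n) :: complex)" for n
    by (simp add: P_def power_mult_distrib)
  have "(\<lambda>n. of_real pi * (\<i> * of_real x) * of_real (P n)) \<longlonglongrightarrow> sin (of_real pi * (\<i> * of_real x))"
    using sin_product_formula_complex[of "\<i> * of_real x"] unfolding prod .
  then have "(\<lambda>n. Im (of_real pi * (\<i> * of_real x) * of_real (P n))) \<longlonglongrightarrow> Im (sin (of_real pi * (\<i> * of_real x)))"
    by (rule tendsto_Im)
  moreover have "Im (sin (of_real pi * (\<i> * of_real x))) = sinh (pi * x)"
    by (simp add: Im_sin sinh_def)
  ultimately have lim: "(\<lambda>n. pi * x * P n) \<longlonglongrightarrow> sinh (pi * x)"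
    by simp
  have P_pos: "P n > 0" for n
    unfolding P_def by (intro prod_pos) (auto intro: add_pos_nonneg)
  have "(\<lambda>n. ln (pi * x * P n) - ln (pi * x)) \<longlonglongrightarrow> ln (sinh (pi * x)) - ln (pi * x)"
    using assms by (intro tendsto_intros lim) (auto simp: sinh_real_zero_iff)
  moreover have "ln (pi * x * P n) - ln (pi * x) = (\<Sum>k<n. ln (1 + x\<^sup>2 / (real (Suc k))\<^sup>2))" for n
  proof -
    have "P n = (\<Prod>k<n. 1 + x\<^sup>2 / (real (Suc k))\<^sup>2)"
      unfolding P_def by (simp add: prod.atLeast1_atMost_eq)
    moreover have "1 + x\<^sup>2 / (real (Suc k))\<^sup>2 > 0" for k
      by (intro add_pos_nonneg) auto
    ultimately have "ln (P n) = (\<Sum>k<n. ln (1 + x\<^sup>2 / (real (Suc k))\<^sup>2))"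
      by (simp add: ln_prod less_imp_neq[symmetric])
    then show ?thesis
      using assms P_pos[of n] by (simp add: ln_mult)
  qed
  ultimately show ?thesis
    by (simp add: sums_def)
qed

lemma summable_const_over_Suc_squared: "summable (\<lambda>k. c / (real (Suc k))\<^sup>2)"
  using summable_mult[OF sums_summable[OF inverse_squares_sums], of c] by (simp add: add.commute)

text \<open>Logarithmic differentiation, term by term, of the product for \<open>sinh\<close>, which
  in turn is Euler's sine product at an imaginary point.\<close>

lemma kappa_sums:
  fixes x :: real
  assumes "x > 0"
  shows "(\<lambda>k. 2 * x / (x\<^sup>2 + (real (Suc k))\<^sup>2)) sums kappa x"
proof -
  define S where "S = {0<..<x + 1}"
  define f where "f = (\<lambda>k t. ln (1 + t\<^sup>2 / (real (Suc k))\<^sup>2))"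
  define f' where "f' = (\<lambda>k t. 2 * t / (t\<^sup>2 + (real (Suc k))\<^sup>2))"
  have xS: "x \<in> interior S" "x \<in> S"
    using assms by (auto simp: S_def)
  have pos: "1 + t\<^sup>2 / (real (Suc k))\<^sup>2 > 0" for t k
    by (intro add_pos_nonneg) auto
  have "((\<lambda>t. ln (1 + t\<^sup>2 / c)) has_field_derivative 2 * t / (t\<^sup>2 + c)) (at t within S)" if "c > 0" for c t
  proof -
    have "t\<^sup>2 + c > 0" "1 + t\<^sup>2 / c > 0"
      using that by (auto intro: add_nonneg_pos add_pos_nonneg)
    moreover have "c * (1 + t\<^sup>2 / c) = t\<^sup>2 + c"
      using that by (simp add: field_simps)
    ultimately show ?thesis
      using that by (auto intro!: derivative_eq_intros simp: divide_simps)
  qed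
  then have deriv: "(f k has_field_derivative f' k t) (at t within S)" for k t
    unfolding f_def f'_def by simp
  have unif: "uniformly_convergent_on S (\<lambda>n t. \<Sum>k<n. f' k t)"
  proof (rule Weierstrass_m_test')
    fix k t assume "t \<in> S"
    then have t: "0 < t" "t < x + 1"
      by (auto simp: S_def)
    have "0 < (real (Suc k))\<^sup>2" by simp
    then have "2 * t / (t\<^sup>2 + (real (Suc k))\<^sup>2) \<le> 2 * (x + 1) / (real (Suc k))\<^sup>2"
      using t by (intro frac_le) (auto simp del: of_nat_Suc)
    then show "norm (f' k t) \<le> 2 * (x + 1) / (real (Suc k))\<^sup>2"
      using t by (simp add: f'_def del: of_nat_Suc)
  qed (rule summable_const_over_Suc_squared)
  have summable_f: "summable (\<lambda>k. f k x)"
    unfolding f_def using ln_sinh_product_sums[OF assms] by (rule sums_summable)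
  have "convex S" by (simp add: S_def)
  have series_deriv: "((\<lambda>t. \<Sum>k. f k t) has_field_derivative (\<Sum>k. f' k x)) (at x)"
    by (rule has_field_derivative_series'[OF \<open>convex S\<close> deriv unif xS(2) summable_f xS(1)])
  have "((\<lambda>t. ln (sinh (pi * t)) - ln (pi * t)) has_field_derivative kappa x) (at x)"
  proof -
    have "((\<lambda>t. ln (sinh (pi * t)) - ln (pi * t)) has_field_derivative
             pi * cosh (pi * x) / sinh (pi * x) - 1 / x) (at x)"
      using assms by (auto intro!: derivative_eq_intros simp: field_simps)
    moreover have "pi * cosh (pi * x) / sinh (pi * x) - 1 / x = kappa x"
    proof -
      have e: "exp (2 * pi * x) = exp (pi * x) * exp (pi * x)"
        by (simp flip: exp_add add: algebra_simps)
      have "exp (pi * x) > 1"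
        using assms by simp
      moreover from this have "exp (pi * x) * exp (pi * x) > 1"
        using less_1_mult by blast
      ultimately have "cosh (pi * x) / sinh (pi * x) = 1 + 2 / (exp (2 * pi * x) - 1)"
        unfolding e cosh_def sinh_def exp_minus by (simp add: field_simps)
      then show ?thesis
        by (simp add: kappa_def algebra_simps flip: times_divide_eq_right)
    qed
    ultimately show ?thesis by simp
  qed
  moreover have "eventually (\<lambda>t. ln (sinh (pi * t)) - ln (pi * t) = (\<Sum>k. f k t)) (nhds x)"
  proof -
    have "eventually (\<lambda>t. t > 0) (nhds x)"
      using assms eventually_nhds_in_open[of "{0<..}" x] by simp
    then show ?thesis
      by eventually_elim (unfold f_def, rule sums_unique, rule ln_sinh_product_sums)
  qed
  ultimately have "((\<lambda>t. \<Sum>k. f k t) has_field_derivative kappa x) (at x)"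
    by (subst (asm) DERIV_cong_ev[OF refl _ refl]) auto
  then have eq: "(\<Sum>k. f' k x) = kappa x"
    using series_deriv DERIV_unique by blast
  have "summable (\<lambda>k. f' k x)"
    using uniformly_convergent_imp_convergent[OF unif xS(2)] by (simp add: summable_iff_convergent)
  then show ?thesis
    using summable_sums eq unfolding f'_def by metis
qed

section \<open>Arctangent sums and the inversion of \<open>kappa_defect\<close>\<close>

lemma arctan_diff_ge:
  fixes a b :: real
  assumes "0 \<le> a" "a < b"
  shows "(b - a) / (1 + b\<^sup>2) \<le> arctan b - arctan a"
proof -
  obtain z where z: "a < z" "z < b" "arctan b - arctan a = (b - a) * inverse (1 + z\<^sup>2)"
    using MVT2[OF assms(2), of arctan "\<lambda>z. inverse (1 + z\<^sup>2)"] DERIV_arctan by auto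
  have "z\<^sup>2 \<le> b\<^sup>2"
    using z assms by (intro power_mono) auto
  then have "inverse (1 + b\<^sup>2) \<le> inverse (1 + z\<^sup>2)"
    by (intro le_imp_inverse_le) (auto intro: add_pos_nonneg)
  then show ?thesis
    using z assms by (simp add: divide_inverse mult_left_mono)
qed

text \<open>The antiderivative of \<open>kappa s / s\<close> that vanishes at 0, obtained by
  integrating the series for \<open>kappa\<close> term by term.\<close>

definition arctan_sum :: "real \<Rightarrow> real" where
  "arctan_sum s = (\<Sum>m. 2 / real (Suc m) * arctan (s / real (Suc m)))"

lemma arctan_sum_sums:
  assumes "s \<ge> 0"
  shows "(\<lambda>m. 2 / real (Suc m) * arctan (s / real (Suc m))) sums arctan_sum s"
proof -
  have "summable (\<lambda>m. 2 / real (Suc m) * arctan (s / real (Suc m)))"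
  proof (rule summable_comparison_test'[OF summable_const_over_Suc_squared[of "2 * s"]])
    fix m :: nat
    have "arctan (s / real (Suc m)) \<le> s / real (Suc m)" "0 \<le> arctan (s / real (Suc m))"
      using assms by (auto simp: arctan_le_self zero_le_arctan_iff)
    then have "2 / real (Suc m) * arctan (s / real (Suc m)) \<le> 2 / real (Suc m) * (s / real (Suc m))"
      by (intro mult_left_mono) auto
    then show "norm (2 / real (Suc m) * arctan (s / real (Suc m))) \<le> 2 * s / (real (Suc m))\<^sup>2"
      using \<open>0 \<le> arctan (s / real (Suc m))\<close> by (simp add: power2_eq_square abs_mult del: of_nat_Suc)
  qed
  then show ?thesis
    by (simp add: arctan_sum_def summable_sums)
qed

lemma arctan_sum_deriv:
  assumes "s > 0"
  shows "(arctan_sum has_field_derivative kappa s / s) (at s)"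
proof -
  define f where "f = (\<lambda>m t. 2 / real (Suc m) * arctan (t / real (Suc m)))"
  define f' where "f' = (\<lambda>m t. 2 / (t\<^sup>2 + (real (Suc m))\<^sup>2))"
  have "((\<lambda>t. 2 / c * arctan (t / c)) has_field_derivative 2 / (t\<^sup>2 + c\<^sup>2)) (at t within {0<..})" if "c > 0" for c t :: real
  proof -
    have "t\<^sup>2 + c\<^sup>2 > 0" "1 + (t / c)\<^sup>2 = (t\<^sup>2 + c\<^sup>2) / c\<^sup>2"
      using that by (auto simp: add_nonneg_pos field_simps intro: add_pos_nonneg)
    then show ?thesis
      using that by (auto intro!: derivative_eq_intros simp: power2_eq_square)
  qed
  then have deriv: "(f m has_field_derivative f' m t) (at t within {0<..})" for m t
    unfolding f_def f'_def by simp
  have unif: "uniformly_convergent_on {0<..} (\<lambda>n t. \<Sum>m<n. f' m t)"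
  proof (rule Weierstrass_m_test')
    fix m and t :: real assume "t \<in> {0<..}"
    have "0 < (real (Suc m))\<^sup>2" by simp
    then show "norm (f' m t) \<le> 2 / (real (Suc m))\<^sup>2"
      unfolding f'_def real_norm_def abs_divide by (intro frac_le) (simp_all del: of_nat_Suc)
  qed (rule summable_const_over_Suc_squared)
  have "summable (\<lambda>m. f m s)"
    unfolding f_def using arctan_sum_sums[of s, THEN sums_summable] assms by simp
  then have "((\<lambda>t. \<Sum>m. f m t) has_field_derivative (\<Sum>m. f' m s)) (at s)"
    by (rule has_field_derivative_series'[OF convex_real_interval(3) deriv unif, rotated])
      (use assms in \<open>simp_all add: interior_open\<close>)
  moreover have "(\<lambda>m. 1 / s * (2 * s / (s\<^sup>2 + (real (Suc m))\<^sup>2))) sums (1 / s * kappa s)"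
    by (intro sums_mult kappa_sums assms)
  then have "(\<lambda>m. f' m s) sums (kappa s / s)"
    using assms by (simp add: f'_def)
  then have "(\<Sum>m. f' m s) = kappa s / s"
    by (rule sums_unique[symmetric])
  ultimately show ?thesis
    by (simp add: arctan_sum_def[abs_def] f_def)
qed

text \<open>Since \<open>kappa s\<close> tends to \<open>pi\<close>, the derivative of
  \<open>arctan_sum s - pi * ln s\<close> is o(1 / s), so between two points of fixed ratio this
  function changes by o(1). The logarithm in the limit ends up as the factor \<open>csqrt z\<close>
  of the modular transformation.\<close>

lemma arctan_sum_slowly_varying:
  assumes "a > 0"
  shows "(\<lambda>n. arctan_sum (real n * a) - arctan_sum (real n)) \<longlonglongrightarrow> pi * ln a"
proof -
  define g where "g = (\<lambda>s. arctan_sum s - pi * ln s)"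
  \<comment> \<open>The length of the segment between \<open>x\<close> and \<open>x * a\<close>,
    divided by its smallest point; it is independent of \<open>x\<close>.\<close>
  define r where "r = \<bar>a - 1\<bar> / min 1 a"
  have g': "(g has_field_derivative (kappa s - pi) / s) (at s)" if "s > 0" for s
    unfolding g_def using that
    by (auto intro!: derivative_eq_intros arctan_sum_deriv simp: field_simps)
  have kappa_lim: "((\<lambda>s. kappa s - pi) \<longlongrightarrow> 0) at_top"
    unfolding kappa_def by real_asymp
  have "(\<lambda>n. g (real n * a) - g (real n)) \<longlonglongrightarrow> 0"
  proof (rule tendstoI)
    fix e :: real assume "e > 0"
    define e' where "e' = e / (r + 1)"
    have r: "r \<ge> 0" using assms by (simp add: r_def)
    then have "e' > 0" using \<open>e > 0\<close> by (simp add: e'_def)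
    then obtain B where B: "\<And>s. s \<ge> B \<Longrightarrow> \<bar>kappa s - pi\<bar> < e'"
      using tendstoD[OF kappa_lim, of e'] by (auto simp: eventually_at_top_linorder dist_real_def)
    have "eventually (\<lambda>n. real n > max 1 (B / min 1 a)) sequentially"
      by real_asymp
    then show "eventually (\<lambda>n. dist (g (real n * a) - g (real n)) 0 < e) sequentially"
    proof eventually_elim
      case (elim n)
      define x where "x = real n"
      have x: "x > 1" "B / min 1 a < x" using elim by (auto simp: x_def)
      have lower: "s \<ge> x * min 1 a" if "s \<in> closed_segment x (x * a)" for s
      proof -
        have "min x (x * a) \<le> s"
          using that by (auto simp: closed_segment_eq_real_ivl split: if_splits)
        then show ?thesis
          using x assms by (auto simp: min_def split: if_splits)
      qed
      have xa: "x * min 1 a > 0" "x * min 1 a > B"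
        using x assms by (auto simp: field_simps)
      have "\<bar>g (x * a) - g x\<bar> \<le> (e' / (x * min 1 a)) * \<bar>x * a - x\<bar>"
      proof (rule field_differentiable_bound[of "closed_segment x (x * a)" g "\<lambda>s. (kappa s - pi) / s", simplified])
        fix s assume s: "s \<in> closed_segment x (x * a)"
        with lower xa have s0: "s > 0" "s \<ge> x * min 1 a" "s \<ge> B"
          by (fastforce)+
        show "(g has_field_derivative (kappa s - pi) / s) (at s within closed_segment x (x * a))"
          using g'[OF s0(1)] by (rule has_field_derivative_at_within)
        show "\<bar>kappa s - pi\<bar> / \<bar>s\<bar> \<le> e' / (x * min 1 a)"
          using B[OF s0(3)] s0 xa by (intro frac_le) auto
      qed (use ends_in_segment in auto)
      also have "\<dots> = e' * r"
      proof -
        have "\<bar>x * a - x\<bar> = x * \<bar>a - 1\<bar>"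
          using x abs_mult[of x "a - 1"] by (simp only: right_diff_distrib mult_1_right)
        then show ?thesis
          using x by (simp add: r_def)
      qed
      also have "\<dots> < e"
        using r \<open>e > 0\<close> by (simp add: e'_def field_simps)
      finally show ?case
        by (simp add: x_def)
    qed
  qed
  then have "(\<lambda>n. g (real n * a) - g (real n) + pi * ln a) \<longlonglongrightarrow> 0 + pi * ln a"
    by (intro tendsto_intros)
  moreover have "eventually (\<lambda>n. g (real n * a) - g (real n) + pi * ln a =
                    arctan_sum (real n * a) - arctan_sum (real n)) sequentially"
    using eventually_gt_at_top[of 0]
    by eventually_elim (use assms in \<open>simp add: g_def ln_mult algebra_simps\<close>)
  ultimately show ?thesis
    by (simp add: tendsto_cong)
qed

text \<open>The part \<open>1 / (\<tau> * m\<^sup>2)\<close> is split off because it sums to the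
  pole term; what is left is expressed by \<open>kappa\<close>, whose series can be
  rearranged.\<close>

lemma lambert_term_eq_kappa:
  assumes "\<tau> > 0"
  shows "exp (- 2 * pi * \<tau>) ^ Suc m / (real (Suc m) * (1 - exp (- 2 * pi * \<tau>) ^ Suc m)) =
    (1 / \<tau> / (real (Suc m))\<^sup>2 - (pi - kappa (real (Suc m) * \<tau>)) / real (Suc m)) / (2 * pi)"
proof -
  define M where "M = real (Suc m)"
  define y where "y = exp (2 * pi * (M * \<tau>))"
  have M: "M > 0" by (simp add: M_def)
  have y: "y > 1" using M assms by (simp add: y_def)
  have "exp (- 2 * pi * \<tau>) ^ Suc m = 1 / y"
    by (simp only: y_def M_def exp_of_nat_mult[symmetric] exp_minus[symmetric] inverse_eq_divide[symmetric])
      (simp add: algebra_simps)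
  moreover have "1 / y / (M * (1 - 1 / y)) = 1 / (M * (y - 1))"
    using y M by (simp add: field_simps)
  moreover have "(1 / \<tau> / M\<^sup>2 - (pi - (pi + 2 * pi / (y - 1) - 1 / (M * \<tau>))) / M) / (2 * pi) = 1 / (M * (y - 1))"
    using y M assms by (simp add: field_simps power2_eq_square)
  ultimately show ?thesis
    by (simp only: M_def[symmetric] kappa_def y_def[symmetric])
qed

text \<open>Up to the factor \<open>- 1 / (2 * pi)\<close>, this is what remains of the logarithm of
  the generating function at \<open>exp (- 2 * pi * \<tau>)\<close> once
  \<open>pi / (12 * \<tau>)\<close> is removed.\<close>

definition kappa_defect :: "real \<Rightarrow> real" where
  "kappa_defect \<tau> = (\<Sum>m. (pi - kappa (real (Suc m) * \<tau>)) / real (Suc m))"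

lemma kappa_defect_sums:
  assumes "\<tau> > 0"
  shows "(\<lambda>m. (pi - kappa (real (Suc m) * \<tau>)) / real (Suc m)) sums kappa_defect \<tau>"
proof -
  define q where "q = exp (- 2 * pi * \<tau>)"
  have q: "0 < q" "q < 1" using assms by (simp_all add: q_def)
  define l where "l = (\<lambda>m. q ^ Suc m / (real (Suc m) * (1 - q ^ Suc m)))"
  have "summable l"
  proof (rule summable_comparison_test')
    show "summable (\<lambda>m. q ^ m / (1 - q))"
      using q by (intro summable_divide summable_geometric) simp
    fix m :: nat
    have le: "q ^ Suc m \<le> q"
      using q power_decreasing[of 1 "Suc m" q] by simp
    have "1 - q \<le> 1 * (1 - q ^ Suc m)"
      using le by simp
    also have "\<dots> \<le> real (Suc m) * (1 - q ^ Suc m)"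
      by (intro mult_right_mono) (use le q in linarith)+
    finally have denom: "1 - q \<le> real (Suc m) * (1 - q ^ Suc m)" .
    then have "l m \<le> q ^ m / (1 - q)"
      unfolding l_def using q by (intro frac_le) (simp_all add: mult_left_le_one_le)
    moreover have "l m \<ge> 0"
      unfolding l_def by (intro divide_nonneg_nonneg zero_le_power) (use q denom in linarith)+
    ultimately show "norm (l m) \<le> q ^ m / (1 - q)"
      by simp
  qed
  then have "summable (\<lambda>m. 1 / \<tau> / (real (Suc m))\<^sup>2 - 2 * pi * l m)"
    by (intro summable_diff summable_mult summable_const_over_Suc_squared)
  moreover have "1 / \<tau> / (real (Suc m))\<^sup>2 - 2 * pi * l m = (pi - kappa (real (Suc m) * \<tau>)) / real (Suc m)" for m
    unfolding l_def q_def lambert_term_eq_kappa[OF assms] by simp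
  ultimately show ?thesis
    by (simp only: kappa_defect_def summable_sums)
qed

lemma p_exp_sums:
  assumes "\<tau> > 0"
  shows "(\<lambda>n. real (p n) * exp (- 2 * pi * \<tau>) ^ n) sums exp (pi / (12 * \<tau>) - kappa_defect \<tau> / (2 * pi))"
proof -
  have "(\<lambda>m. 1 / \<tau> * (1 / (real (Suc m))\<^sup>2)) sums (1 / \<tau> * (pi\<^sup>2 / 6))"
    using sums_mult[OF inverse_squares_sums, of "1 / \<tau>"] by (simp add: add.commute)
  then have "(\<lambda>m. (1 / \<tau> / (real (Suc m))\<^sup>2 - (pi - kappa (real (Suc m) * \<tau>)) / real (Suc m)) / (2 * pi)) sums
     ((1 / \<tau> * (pi\<^sup>2 / 6) - kappa_defect \<tau>) / (2 * pi))"
    by (intro sums_divide sums_diff kappa_defect_sums assms) simp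
  moreover have "(1 / \<tau> * (pi\<^sup>2 / 6) - kappa_defect \<tau>) / (2 * pi) = pi / (12 * \<tau>) - kappa_defect \<tau> / (2 * pi)"
    using assms by (simp add: field_simps power2_eq_square)
  ultimately show ?thesis
    unfolding lambert_term_eq_kappa[OF assms, symmetric]
    using assms by (intro p_sums_exp) simp_all
qed

text \<open>
  The summand below is nonnegative, and both its row and its column sums are known: summing over
  \<open>k\<close> first telescopes the arctangents, summing over \<open>m\<close> first exchanges \<open>\<tau>\<close> and \<open>1 / \<tau>\<close>
  in the rational part. The arctangents (integrals of the rational part over unit intervals) are
  what makes the double sum converge absolutely.
\<close>

lemma kappa_defect_swap_sums:
  assumes "\<tau> > 0"
  shows "(\<lambda>k. arctan_sum (real (Suc k) / \<tau>) - arctan_sum (real k / \<tau>) - kappa (real (Suc k) / \<tau>) / real (Suc k))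
           sums kappa_defect \<tau>"
proof (rule sums_swap_nonneg[OF _ _ kappa_defect_sums[OF assms]])
  define f where "f = (\<lambda>m k. 2 / real (Suc m) *
      (arctan (real (Suc k) / (real (Suc m) * \<tau>)) - arctan (real k / (real (Suc m) * \<tau>)))
      - 2 * \<tau> / ((real (Suc m) * \<tau>)\<^sup>2 + (real (Suc k))\<^sup>2))"
  show "f m k \<ge> 0" for m k
  proof -
    define c where "c = real (Suc m) * \<tau>"
    have c: "c > 0" using assms by (simp add: c_def)
    define b where "b = real (Suc k) / c"
    have cb: "b\<^sup>2 * c\<^sup>2 = (real (Suc k))\<^sup>2"
      using c by (simp add: b_def power_divide)
    \<comment> \<open>The subtracted rational term is the value of the integrand at the right end of
      the unit interval, where this decreasing function is smallest.\<close>
    have "(1 / c) / (1 + b\<^sup>2) \<le> arctan (real (Suc k) / c) - arctan (real k / c)"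
      using arctan_diff_ge[of "real k / c" b] c by (simp add: b_def diff_divide_distrib[symmetric] divide_strict_right_mono)
    then have "2 / real (Suc m) * ((1 / c) / (1 + b\<^sup>2)) \<le>
        2 / real (Suc m) * (arctan (real (Suc k) / c) - arctan (real k / c))"
      by (intro mult_left_mono) auto
    moreover have "2 / real (Suc m) * ((1 / c) / (1 + b\<^sup>2)) = 2 * \<tau> / (c\<^sup>2 + (real (Suc k))\<^sup>2)"
    proof -
      have "c\<^sup>2 + (real (Suc k))\<^sup>2 = c * (real (Suc m) * \<tau>) * (1 + b\<^sup>2)"
        unfolding cb[symmetric] by (simp add: c_def power2_eq_square algebra_simps)
      then show ?thesis
        using assms c by (simp add: divide_simps del: of_nat_Suc)
    qed
    ultimately show ?thesis
      by (simp add: f_def c_def)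
  qed
  show "f m sums ((pi - kappa (real (Suc m) * \<tau>)) / real (Suc m))" for m
  proof -
    define c where "c = real (Suc m) * \<tau>"
    have c: "c > 0" using assms by (simp add: c_def)
    have "(\<lambda>k. arctan (real k / c)) \<longlonglongrightarrow> pi / 2"
      using c by real_asymp
    from telescope_sums[OF this] have "(\<lambda>k. arctan (real (Suc k) / c) - arctan (real k / c)) sums (pi / 2)"
      by simp
    from sums_mult[OF this, of "2 / real (Suc m)"]
    have "(\<lambda>k. 2 / real (Suc m) * (arctan (real (Suc k) / c) - arctan (real k / c))) sums (pi / real (Suc m))"
      by (simp del: of_nat_Suc)
    from sums_diff[OF this sums_mult[OF kappa_sums[OF c], of "1 / real (Suc m)"]]
    have "(\<lambda>k. 2 / real (Suc m) * (arctan (real (Suc k) / c) - arctan (real k / c))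
        - 1 / real (Suc m) * (2 * c / (c\<^sup>2 + (real (Suc k))\<^sup>2))) sums
        (pi / real (Suc m) - 1 / real (Suc m) * kappa c)" .
    moreover have "1 / real (Suc m) * (2 * c / x) = 2 * \<tau> / x" for x
      by (simp add: c_def)
    ultimately show ?thesis
      unfolding f_def c_def[symmetric] diff_divide_distrib by (simp only: mult_1_left times_divide_eq_left)
  qed
  show "(\<lambda>m. f m k) sums (arctan_sum (real (Suc k) / \<tau>) - arctan_sum (real k / \<tau>) - kappa (real (Suc k) / \<tau>) / real (Suc k))" for k
  proof -
    define s where "s = real (Suc k) / \<tau>"
    have s: "s > 0" using assms by (simp add: s_def)
    have "(\<lambda>m. (2 / real (Suc m) * arctan (s / real (Suc m)) - 2 / real (Suc m) * arctan ((real k / \<tau>) / real (Suc m)))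
       - 1 / real (Suc k) * (2 * s / (s\<^sup>2 + (real (Suc m))\<^sup>2))) sums
       (arctan_sum s - arctan_sum (real k / \<tau>) - 1 / real (Suc k) * kappa s)"
      using assms s by (intro sums_diff sums_mult arctan_sum_sums kappa_sums) auto
    moreover have "1 / real (Suc k) * (2 * s / (s\<^sup>2 + (real (Suc m))\<^sup>2)) = 2 * \<tau> / ((real (Suc m) * \<tau>)\<^sup>2 + (real (Suc k))\<^sup>2)" for m
    proof -
      have "s\<^sup>2 + (real (Suc m))\<^sup>2 = ((real (Suc m) * \<tau>)\<^sup>2 + (real (Suc k))\<^sup>2) / \<tau>\<^sup>2"
        using assms by (simp add: s_def power_divide field_simps del: of_nat_Suc)
      then show ?thesis
        using assms by (simp add: s_def power2_eq_square del: of_nat_Suc)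
    qed
    ultimately show ?thesis
      unfolding f_def s_def by (simp add: right_diff_distrib mult.commute[of \<tau>] del: of_nat_Suc)
  qed
qed

text \<open>Subtracting the series for \<open>kappa_defect (1 / \<tau>)\<close> from the rearranged
  series for \<open>kappa_defect \<tau>\<close> cancels the \<open>kappa\<close> terms and leaves
  the limit of \<open>arctan_sum (n / \<tau>)\<close> minus \<open>pi\<close> times a harmonic
  number. The harmonic part is free of \<open>\<tau>\<close>, so it disappears in the comparison
  with \<open>\<tau> = 1\<close>, where the left side is 0.\<close>

lemma kappa_defect_inversion:
  assumes "\<tau> > 0"
  shows "kappa_defect \<tau> - kappa_defect (1 / \<tau>) = - pi * ln \<tau>"
proof -
  define h where "h = (\<lambda>t n. arctan_sum (real n / t) - (\<Sum>k<n. pi / real (Suc k)))"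
  have lim: "h t \<longlonglongrightarrow> kappa_defect t - kappa_defect (1 / t) + arctan_sum 0" if "t > 0" for t
  proof -
    have "(\<lambda>k. (pi - kappa (real (Suc k) / t)) / real (Suc k)) sums kappa_defect (1 / t)"
      using kappa_defect_sums[of "1 / t"] that by simp
    from sums_diff[OF kappa_defect_swap_sums[OF that] this]
    have "(\<lambda>k. arctan_sum (real (Suc k) / t) - arctan_sum (real k / t) - pi / real (Suc k)) sums
       (kappa_defect t - kappa_defect (1 / t))"
      by (simp add: diff_divide_distrib algebra_simps)
    then have "(\<lambda>n. (\<Sum>k<n. arctan_sum (real (Suc k) / t) - arctan_sum (real k / t) - pi / real (Suc k)) + arctan_sum 0)
       \<longlonglongrightarrow> kappa_defect t - kappa_defect (1 / t) + arctan_sum 0"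
      unfolding sums_def by (intro tendsto_intros)
    moreover have "(\<Sum>k<n. arctan_sum (real (Suc k) / t) - arctan_sum (real k / t) - pi / real (Suc k)) + arctan_sum 0 = h t n" for n
      using sum_lessThan_telescope[of "\<lambda>k. arctan_sum (real k / t)" n]
      by (simp only: sum_subtractf h_def) simp
    ultimately show ?thesis
      by (simp only:)
  qed
  have "(\<lambda>n. h \<tau> n - h 1 n) \<longlonglongrightarrow> kappa_defect \<tau> - kappa_defect (1 / \<tau>)"
    using tendsto_diff[OF lim[OF assms] lim[of 1]] by simp
  moreover have "(\<lambda>n. h \<tau> n - h 1 n) \<longlonglongrightarrow> pi * ln (1 / \<tau>)"
    using arctan_sum_slowly_varying[of "1 / \<tau>"] assms by (simp add: h_def)
  ultimately show ?thesis
    using LIMSEQ_unique assms by (fastforce simp: ln_div)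
qed

text \<open>Every term is nonnegative because \<open>exp y \<ge> 1 + y\<close>. Dropping the whole
  sum is what gives the trivial bound \<open>exp (pi / (12 * Re z))\<close> for the generating
  function.\<close>

lemma kappa_defect_nonneg:
  assumes "\<tau> > 0"
  shows "kappa_defect \<tau> \<ge> 0"
proof -
  have "0 \<le> (pi - kappa (real (Suc m) * \<tau>)) / real (Suc m)" for m
  proof -
    have "kappa x \<le> pi" if "x > 0" for x
      using that exp_ge_add_one_self[of "2 * pi * x"] unfolding kappa_def
      by (simp add: frac_le field_simps)
    then show ?thesis
      using assms by simp
  qed
  then show ?thesis
    using sums_le[OF _ sums_zero kappa_defect_sums[OF assms]] by simp
qed

section \<open>The generating function on the right half-plane\<close>

definition partition_series :: "complex \<Rightarrow> complex" where
  "partition_series z = (\<Sum>n. of_nat (p n) * exp (- 2 * of_real pi * z) ^ n)"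

lemma norm_exp_2pi: "norm (exp (- 2 * of_real pi * z)) = exp (- 2 * pi * Re z)"
  by simp

lemma summable_p_power:
  assumes "norm (w :: complex) < 1"
  shows "summable (\<lambda>n. norm (of_nat (p n) * w ^ n))"
proof (cases "w = 0")
  case True
  show ?thesis
    by (rule summable_comparison_test'[OF summable_zero, of 1]) (use True in \<open>auto simp: power_0_left\<close>)
next
  case False
  define \<tau> where "\<tau> = - ln (norm w) / (2 * pi)"
  have "\<tau> > 0" "exp (- 2 * pi * \<tau>) = norm w"
    using False assms by (auto simp: \<tau>_def field_simps)
  then show ?thesis
    using p_exp_sums[of \<tau>] by (auto simp: norm_mult norm_power sums_iff)
qed

lemma partition_series_sums:
  assumes "Re z > 0"
  shows "(\<lambda>n. of_nat (p n) * exp (- 2 * of_real pi * z) ^ n) sums partition_series z"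
  unfolding partition_series_def
  using assms by (intro summable_sums summable_norm_cancel[OF summable_p_power]) (simp add: norm_exp_2pi)

lemma partition_series_of_real:
  assumes "\<tau> > 0"
  shows "partition_series (of_real \<tau>) = of_real (exp (pi / (12 * \<tau>) - kappa_defect \<tau> / (2 * pi)))"
proof -
  have "(\<lambda>n. of_real (real (p n) * exp (- 2 * pi * \<tau>) ^ n) :: complex) sums
      of_real (exp (pi / (12 * \<tau>) - kappa_defect \<tau> / (2 * pi)))"
    by (rule sums_of_real[OF p_exp_sums[OF assms]])
  moreover have "of_real (real (p n) * exp (- 2 * pi * \<tau>) ^ n) = of_nat (p n) * exp (- 2 * of_real pi * complex_of_real \<tau>) ^ n" for n
    by (simp flip: exp_of_real)
  ultimately show ?thesis
    unfolding partition_series_def by (simp only: sums_iff)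
qed

lemma norm_partition_series_le:
  assumes "Re z > 0"
  shows "norm (partition_series z) \<le> exp (pi / (12 * Re z))"
proof -
  have sums: "(\<lambda>n. norm (of_nat (p n) * exp (- 2 * of_real pi * z) ^ n)) sums exp (pi / (12 * Re z) - kappa_defect (Re z) / (2 * pi))"
    using p_exp_sums[OF assms] by (simp only: norm_mult norm_power norm_exp_2pi norm_of_nat)
  then have "norm (partition_series z) \<le> exp (pi / (12 * Re z) - kappa_defect (Re z) / (2 * pi))"
    unfolding partition_series_def using summable_norm[OF sums_summable[OF sums]] by (simp only: sums_unique[OF sums])
  also have "\<dots> \<le> exp (pi / (12 * Re z))"
    using kappa_defect_nonneg[OF assms] by simp
  finally show ?thesis .
qed

text \<open>Every exponent in the tail is at least 1, so one factor
  \<open>exp (- 2 * pi * (Re z - 1))\<close> can be taken out; the rest is dominated by the series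
  at 1, which is at most \<open>exp (pi / 12)\<close>.\<close>

lemma norm_partition_series_minus_1_le:
  assumes "Re z \<ge> 1"
  shows "norm (partition_series z - 1) \<le> exp (2 * pi + pi / 12) * exp (- 2 * pi * Re z)"
proof -
  define x where "x = Re z"
  have x: "x \<ge> 1" using assms by (simp add: x_def)
  define q where "q = exp (- 2 * of_real pi * z)"
  define r where "r = exp (- 2 * pi * (x - 1))"
  define E where "E = exp (pi / (12 * 1) - kappa_defect 1 / (2 * pi))"
  have r: "0 < r" "r \<le> 1" using x by (auto simp: r_def)
  have q: "norm q = r * exp (- 2 * pi * 1)"
    unfolding q_def norm_exp_2pi r_def x_def[symmetric] by (simp flip: exp_add add: algebra_simps)
  have "(\<lambda>n. of_nat (p n) * q ^ n) sums partition_series z"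
    unfolding q_def using assms by (intro partition_series_sums) auto
  then have "(\<lambda>n. of_nat (p (Suc n)) * q ^ Suc n) sums (partition_series z - 1)"
    by (subst sums_Suc_iff) (simp add: p_0)
  moreover have "(\<lambda>n. real (p n) * exp (- 2 * pi * 1) ^ n) sums E"
    using p_exp_sums[of 1] by (simp add: E_def)
  then have "(\<lambda>n. real (p (Suc n)) * exp (- 2 * pi * 1) ^ Suc n) sums (E - 1)"
    by (subst sums_Suc_iff) (simp add: p_0)
  then have "(\<lambda>n. r * (real (p (Suc n)) * exp (- 2 * pi * 1) ^ Suc n)) sums (r * (E - 1))"
    by (rule sums_mult)
  moreover have "norm (of_nat (p (Suc n)) * q ^ Suc n) \<le> r * (real (p (Suc n)) * exp (- 2 * pi * 1) ^ Suc n)" for n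
  proof -
    have "r ^ Suc n \<le> r"
      using r power_decreasing[of 1 "Suc n" r] by simp
    then have "r ^ Suc n * (real (p (Suc n)) * exp (- 2 * pi * 1) ^ Suc n) \<le> r * (real (p (Suc n)) * exp (- 2 * pi * 1) ^ Suc n)"
      by (intro mult_right_mono) auto
    then show ?thesis
      by (simp only: norm_mult norm_power q norm_of_nat power_mult_distrib mult_ac)
  qed
  ultimately have "norm (partition_series z - 1) \<le> r * (E - 1)"
    by (metis (no_types, lifting) norm_suminf_le sums_iff)
  also have "\<dots> \<le> r * exp (pi / 12)"
    using kappa_defect_nonneg[of 1] r by (intro mult_left_mono) (auto simp: E_def intro: order_trans[of _ "exp (pi / 12 - kappa_defect 1 / (2 * pi))"])
  also have "\<dots> = exp (2 * pi + pi / 12) * exp (- 2 * pi * Re z)"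
    unfolding r_def x_def by (simp flip: exp_add add: algebra_simps)
  finally show ?thesis .
qed

lemma holomorphic_partition_series: "partition_series holomorphic_on {z. Re z > 0}"
proof -
  define g where "g = (\<lambda>w :: complex. \<Sum>n. of_nat (p n) * w ^ n)"
  have "g holomorphic_on ball 0 1"
  proof (rule power_series_holomorphic)
    fix w :: complex assume "w \<in> ball 0 1"
    then show "(\<lambda>n. of_nat (p n) * (w - 0) ^ n) sums g w"
      unfolding g_def by (simp add: summable_sums summable_norm_cancel[OF summable_p_power])
  qed
  moreover have "(\<lambda>z. exp (- 2 * of_real pi * z)) ` {z. Re z > 0} \<subseteq> ball 0 1"
    by (auto simp: norm_exp_2pi)
  ultimately have "(g \<circ> (\<lambda>z. exp (- 2 * of_real pi * z))) holomorphic_on {z. Re z > 0}"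
    by (intro holomorphic_on_compose_gen[of _ _ _ "ball 0 1"]) (auto intro!: holomorphic_intros)
  then show ?thesis
    by (simp add: g_def partition_series_def[abs_def] o_def)
qed

text \<open>The classical modular variable is \<open>\<i> * z\<close>, so the inversion becomes
  \<open>1 / z\<close> and preserves the positive reals. There the formula is
  \<open>kappa_defect_inversion\<close> in exponential form, with \<open>exp (ln \<tau> / 2)\<close>
  as the square root. Both sides are holomorphic and the positive reals accumulate at 1, so it
  extends to the half-plane.\<close>

theorem partition_series_modular:
  assumes "Re z > 0"
  shows "partition_series z =
    csqrt z * exp (of_real pi / (12 * z) - of_real pi * z / 12) * partition_series (1 / z)"
proof -
  define S where "S = {z :: complex. Re z > 0}"
  define R where "R = (\<lambda>z. csqrt z * exp (of_real pi / (12 * z) - of_real pi * z / 12) * partition_series (1 / z))"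
  have nz: "z \<noteq> 0" "z \<notin> \<real>\<^sub>\<le>\<^sub>0" if "z \<in> S" for z
    using that by (auto simp: S_def complex_nonpos_Reals_iff)
  have "(partition_series \<circ> (\<lambda>z. 1 / z)) holomorphic_on S"
    using holomorphic_partition_series nz
    by (intro holomorphic_on_compose_gen[of _ _ _ S] holomorphic_intros)
      (auto simp: S_def Re_divide' intro!: divide_pos_pos)
  then have "R holomorphic_on S"
    unfolding R_def o_def using nz by (intro holomorphic_intros) auto
  then have "(\<lambda>z. partition_series z - R z) holomorphic_on S"
    using holomorphic_partition_series unfolding S_def by (intro holomorphic_intros) auto
  moreover have "partition_series w - R w = 0" if w: "w \<in> of_real ` {0<..}" for w
  proof -
    obtain \<tau> where \<tau>: "w = of_real \<tau>" "\<tau> > 0" using w by auto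
    have "partition_series (of_real (1 / \<tau>)) = of_real (exp (pi / (12 * (1 / \<tau>)) - kappa_defect (1 / \<tau>) / (2 * pi)))"
      using \<tau> by (intro partition_series_of_real) simp
    then have "R w = of_real (sqrt \<tau> * exp (pi / (12 * \<tau>) - pi * \<tau> / 12) * exp (pi / (12 * (1 / \<tau>)) - kappa_defect (1 / \<tau>) / (2 * pi)))"
      using \<tau> by (simp add: R_def csqrt_of_real flip: exp_of_real)
    also have "sqrt \<tau> = exp (ln \<tau> / 2)"
      using exp_ln[of "sqrt \<tau>"] \<tau> by (simp only: ln_sqrt real_sqrt_gt_zero)
    also have "exp (ln \<tau> / 2) * exp (pi / (12 * \<tau>) - pi * \<tau> / 12) * exp (pi / (12 * (1 / \<tau>)) - kappa_defect (1 / \<tau>) / (2 * pi))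
       = exp (pi / (12 * \<tau>) - kappa_defect \<tau> / (2 * pi))"
    proof -
      have "kappa_defect \<tau> = kappa_defect (1 / \<tau>) - pi * ln \<tau>"
        using kappa_defect_inversion[OF \<tau>(2)] by simp
      then have "kappa_defect \<tau> / (2 * pi) = kappa_defect (1 / \<tau>) / (2 * pi) - ln \<tau> / 2"
        by (simp add: diff_divide_distrib)
      then show ?thesis
        unfolding exp_add[symmetric] using \<tau> by simp
    qed
    finally show ?thesis
      using \<tau> partition_series_of_real[OF \<tau>(2)] by simp
  qed
  moreover have "(1 :: complex) islimpt of_real ` {0<..}"
  proof -
    have "(\<lambda>n. of_real (1 + 1 / real (Suc n)) :: complex) \<longlonglongrightarrow> of_real (1 + 0)"
      by (intro tendsto_intros LIMSEQ_inverse_real_of_nat[unfolded inverse_eq_divide])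
    then show ?thesis
      unfolding islimpt_sequential
      by (intro exI[of _ "\<lambda>n. of_real (1 + 1 / real (Suc n)) :: complex"])
        (auto simp: add_pos_nonneg simp del: of_real_add of_nat_Suc)
  qed
  moreover have "open S" "connected S" "of_real ` {0<..} \<subseteq> S" "1 \<in> S" "z \<in> S"
    using assms by (auto simp: S_def open_halfspace_Re_gt convex_connected convex_halfspace_Re_gt)
  ultimately have "partition_series z - R z = 0"
    using analytic_continuation[of "\<lambda>z. partition_series z - R z" S "of_real ` {0<..}" 1 z] by blast
  then show ?thesis
    by (simp add: R_def)
qed

text \<open>
  Cauchy's formula for the coefficient \<open>p n\<close>: the primitive is the termwise one, in which only
  the term with index \<open>n\<close> fails to be periodic.
\<close>

lemma partition_series_primitive:
  obtains \<Psi> where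
    "\<And>z. Re z > 0 \<Longrightarrow> (\<Psi> has_field_derivative partition_series z * exp (2 * of_real pi * of_nat n * z)) (at z)"
    "\<And>z. Re z > 0 \<Longrightarrow> \<Psi> (z + \<i>) - \<Psi> z = \<i> * of_nat (p n)"
proof -
  define c where "c = (\<lambda>k. 2 * of_real pi * (of_nat n - of_nat k) :: complex)"
  define f where "f = (\<lambda>k z. of_nat (p k) * (if k = n then z else exp (c k * z) / c k))"
  define f' where "f' = (\<lambda>k z. of_nat (p k) * exp (c k * z))"
  define \<Psi> where "\<Psi> = (\<lambda>z. \<Sum>k. f k z)"
  have c0: "c k = 0 \<longleftrightarrow> k = n" for k
    by (auto simp: c_def)
  have deriv: "(f k has_field_derivative f' k z) (at z within S)" for k z S
    unfolding f_def f'_def using c0[of k]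
    by (cases "k = n") (auto intro!: derivative_eq_intros)
  have f'_eq: "f' k z = exp (2 * of_real pi * of_nat n * z) * (of_nat (p k) * exp (- 2 * of_real pi * z) ^ k)" for k z
    unfolding f'_def c_def exp_of_nat_mult[symmetric]
    by (simp flip: exp_add add: algebra_simps)
  have norm_f': "norm (f' k z) = exp (2 * pi * n * Re z) * (real (p k) * exp (- 2 * pi * Re z) ^ k)" for k z
    unfolding f'_eq norm_mult norm_power norm_exp_2pi norm_of_nat by simp
  have summable_f': "summable (\<lambda>k. norm (f' k z))" if "Re z > 0" for z
    unfolding norm_f' using p_exp_sums[OF that] by (intro summable_mult) (simp only: sums_iff)
  have summable_f: "summable (\<lambda>k. f k z)" if "Re z > 0" for z
  proof (rule summable_comparison_test')
    show "summable (\<lambda>k. norm (f' k z))" by (rule summable_f'[OF that])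
    \<comment> \<open>Beyond index \<open>n\<close> the norm of \<open>c k\<close> is at least 1, so
      dividing by it does not enlarge the terms.\<close>
    fix k assume "k \<ge> Suc n"
    then have k: "k \<noteq> n" "k > n" by auto
    have "norm (c k) = 2 * pi * (real k - real n)"
    proof -
      have "c k = of_real (2 * pi * (real n - real k))" by (simp add: c_def)
      then show ?thesis using k by (simp only: norm_of_real) (simp add: abs_mult)
    qed
    also have "\<dots> \<ge> 1 * 1"
      using k pi_ge_two by (intro mult_mono) auto
    finally have "norm (exp (c k * z)) / norm (c k) \<le> norm (exp (c k * z)) / 1"
      by (intro divide_left_mono) auto
    then show "norm (f k z) \<le> norm (f' k z)"
      using k mult_left_mono[of "norm (exp (c k * z)) / norm (c k)" "norm (exp (c k * z))" "real (p k)"]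
      by (simp add: f_def f'_def norm_mult norm_divide del: norm_exp_eq_Re)
  qed
  have "(\<Psi> has_field_derivative partition_series z * exp (2 * of_real pi * of_nat n * z)) (at z)" if z: "Re z > 0" for z
  proof -
    \<comment> \<open>The right edge bounds the growing factor
      \<open>exp (2 * pi * n * Re w)\<close>, the left edge bounds
      \<open>exp (- 2 * pi * Re w)\<close> away from 1.\<close>
    define S where "S = {w. Re w > Re z / 2} \<inter> {w. Re w < Re z + 1}"
    have "convex S"
      unfolding S_def by (intro convex_Int convex_halfspace_Re_gt convex_halfspace_Re_lt)
    moreover have "open S"
      unfolding S_def by (intro open_Int open_halfspace_Re_gt open_halfspace_Re_lt)
    moreover have "z \<in> S"
      using z by (simp add: S_def)
    ultimately have S: "convex S" "open S" "z \<in> S" .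
    have unif: "uniformly_convergent_on S (\<lambda>m w. \<Sum>k<m. f' k w)"
    proof (rule Weierstrass_m_test')
      show "summable (\<lambda>k. exp (2 * pi * n * (Re z + 1)) * (real (p k) * exp (- 2 * pi * (Re z / 2)) ^ k))"
        using p_exp_sums[of "Re z / 2"] z by (intro summable_mult) (simp only: sums_iff zero_less_divide_iff, simp)
      fix k w assume "w \<in> S"
      then have w: "Re w > Re z / 2" "Re w < Re z + 1" by (auto simp: S_def)
      then show "norm (f' k w) \<le> exp (2 * pi * n * (Re z + 1)) * (real (p k) * exp (- 2 * pi * (Re z / 2)) ^ k)"
        unfolding norm_f' by (intro mult_mono power_mono) (auto intro!: mult_left_mono)
    qed
    have "((\<lambda>w. \<Sum>k. f k w) has_field_derivative (\<Sum>k. f' k z)) (at z)"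
      by (rule has_field_derivative_series'[OF S(1) deriv unif S(3) summable_f[OF z]])
        (use S in \<open>simp add: interior_open\<close>)
    moreover have "f' k z = of_nat (p k) * exp (- 2 * of_real pi * z) ^ k * exp (2 * of_real pi * of_nat n * z)" for k
      unfolding f'_eq by simp
    then have "(\<lambda>k. f' k z) sums (partition_series z * exp (2 * of_real pi * of_nat n * z))"
      using sums_mult2[OF partition_series_sums[OF z]] by simp
    then have "(\<Sum>k. f' k z) = partition_series z * exp (2 * of_real pi * of_nat n * z)"
      by (rule sums_unique[symmetric])
    ultimately show ?thesis
      by (simp add: \<Psi>_def)
  qed
  moreover have "\<Psi> (z + \<i>) - \<Psi> z = \<i> * of_nat (p n)" if z: "Re z > 0" for z
  proof -
    have period: "exp (c k * (z + \<i>)) = exp (c k * z)" for k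
    proof -
      have "c k * (z + \<i>) = c k * z + of_real (2 * pi * of_int (int n - int k)) * \<i>"
        by (simp add: c_def algebra_simps)
      then show ?thesis
        by (simp only: exp_add exp_eq_1[THEN iffD2] mult_1_right)
          (auto simp: exp_eq_1 exp_add intro!: exI[of _ "int n - int k"])
    qed
    have "f k (z + \<i>) - f k z = (if k = n then \<i> * of_nat (p n) else 0)" for k
      using period[of k] by (auto simp: f_def algebra_simps)
    moreover have "(\<lambda>k. f k (z + \<i>) - f k z) sums (\<Psi> (z + \<i>) - \<Psi> z)"
      unfolding \<Psi>_def using z by (intro sums_diff summable_sums summable_f) auto
    moreover have "(\<lambda>k. if k = n then \<i> * of_nat (p n) else 0) sums (\<i> * of_nat (p n))"
      by (rule sums_single)
    ultimately show ?thesis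
      by (simp add: sums_unique2)
  qed
  ultimately show ?thesis
    by (rule that)
qed

section \<open>The leading term of Rademacher's formula\<close>

lemma gaussian_primitive:
  obtains G :: "real \<Rightarrow> real" where
    "\<And>s. s \<ge> 0 \<Longrightarrow> (G has_real_derivative exp (- s\<^sup>2)) (at s)"
    "G 0 = 0"
    "\<And>a. a > 0 \<Longrightarrow> G a \<le> sqrt pi / 2"
    "\<And>a. a > 0 \<Longrightarrow> sqrt pi / 2 - exp (- a\<^sup>2) / (2 * a) \<le> G a"
proof -
  define f where "f = (\<lambda>t :: real. exp (- t\<^sup>2))"
  \<comment> \<open>Integrating from -1 makes 0 an interior point, so that the derivative at 0 is
    two-sided.\<close>
  define G where "G = (\<lambda>s. integral {-1..s} f - integral {-1..0} f)"
  have cont: "continuous_on A f" for A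
    unfolding f_def by (intro continuous_intros)
  have deriv: "(G has_real_derivative exp (- s\<^sup>2)) (at s)" if "s \<ge> 0" for s
  proof -
    have "((\<lambda>u. integral {-1..u} f) has_real_derivative f s) (at s within {-1..s + 1})"
      using that by (intro integral_has_real_derivative cont) auto
    then have "((\<lambda>u. integral {-1..u} f) has_real_derivative f s) (at s)"
      using that by (subst (asm) at_within_interior) auto
    then show ?thesis
      unfolding G_def f_def by (auto intro!: derivative_eq_intros)
  qed
  have G_eq: "G b = integral {0..b} f" if "b \<ge> 0" for b
  proof -
    have "integral {-1..0} f + integral {0..b} f = integral {-1..b} f"
      using that by (intro Henstock_Kurzweil_Integration.integral_combine integrable_continuous_real cont) auto
    then show ?thesis by (simp add: G_def)
  qed
  have lim: "(G \<longlongrightarrow> sqrt pi / 2) at_top"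
  proof -
    have int: "set_integrable lborel {0..} f"
      using gaussian_moment_0 unfolding set_integrable_def f_def by (rule integrable.intros)
    have "((\<lambda>b. set_lebesgue_integral lborel {0..b} f) \<longlongrightarrow> set_lebesgue_integral lborel {0..} f) at_top"
      by (rule tendsto_set_lebesgue_integral_at_top[OF _ int]) auto
    moreover have "set_lebesgue_integral lborel {0..} f = sqrt pi / 2"
      using gaussian_moment_0 unfolding set_lebesgue_integral_def f_def by (rule has_bochner_integral_integral_eq)
    moreover have "set_lebesgue_integral lborel {0..b} f = G b" if "b \<ge> 0" for b
      unfolding G_eq[OF that]
      by (rule set_borel_integral_eq_integral) (rule set_integrable_subset[OF int], auto)
    then have "eventually (\<lambda>b. set_lebesgue_integral lborel {0..b} f = G b) at_top"
      using eventually_ge_at_top by (rule eventually_mono[rotated])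
    ultimately show ?thesis
      by (simp only: tendsto_cong[of _ G])
  qed
  have upper: "G a \<le> sqrt pi / 2" if "a > 0" for a
  proof (rule tendsto_lowerbound[OF lim])
    show "eventually (\<lambda>b. G a \<le> G b) at_top"
      using eventually_ge_at_top[of a]
    proof eventually_elim
      case (elim b)
      show ?case
        by (rule DERIV_nonneg_imp_nondecreasing[OF elim]) (use that deriv in \<open>meson exp_ge_zero less_imp_le order_trans\<close>)
    qed
  qed simp
  have lower: "sqrt pi / 2 - exp (- a\<^sup>2) / (2 * a) \<le> G a" if "a > 0" for a
  proof -
    \<comment> \<open>For \<open>s \<ge> a\<close> the added term falls at least as fast as
      \<open>G\<close> rises; hence \<open>h\<close> decreases to \<open>sqrt pi / 2\<close>, and
      its value at \<open>a\<close> gives the tail bound.\<close>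
    define h where "h = (\<lambda>s. G s + exp (- s\<^sup>2) / (2 * a))"
    have "((\<lambda>s. exp (- s\<^sup>2) / (2 * a)) \<longlongrightarrow> 0) at_top"
      using that by real_asymp
    then have "(h \<longlongrightarrow> sqrt pi / 2 + 0) at_top"
      unfolding h_def by (intro tendsto_intros lim)
    moreover have "eventually (\<lambda>b. h b \<le> h a) at_top"
      using eventually_ge_at_top[of a]
    proof eventually_elim
      case (elim b)
      show ?case
      proof (rule DERIV_nonpos_imp_nonincreasing[OF elim])
        fix s assume s: "a \<le> s" "s \<le> b"
        have "(h has_real_derivative exp (- s\<^sup>2) + exp (- s\<^sup>2) * (- (2 * s)) / (2 * a)) (at s)"
          unfolding h_def using that s by (auto intro!: derivative_eq_intros deriv)
        moreover have "exp (- s\<^sup>2) + exp (- s\<^sup>2) * (- (2 * s)) / (2 * a) = exp (- s\<^sup>2) * (1 - s / a)"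
          using that by (simp add: field_simps)
        moreover have "exp (- s\<^sup>2) * (1 - s / a) \<le> 0"
          using s that by (intro mult_nonneg_nonpos) auto
        ultimately show "\<exists>y. (h has_real_derivative y) (at s) \<and> y \<le> 0"
          by auto
      qed
    qed
    ultimately have "sqrt pi / 2 + 0 \<le> h a"
      by (rule tendsto_upperbound) simp
    then show ?thesis
      by (simp add: h_def)
  qed
  show ?thesis
    by (rule that[of G]) (use deriv upper lower in \<open>auto simp: G_def\<close>)
qed

text \<open>
  On the circle \<open>norm z = r\<close> through the saddle point \<open>r\<close> the exponent is real, and
  the substitution \<open>s = sin (arg z / 2)\<close> turns the integral into a Gaussian one.
\<close>

lemma saddle_point_integral:
  fixes X r :: real and \<Phi> :: "complex \<Rightarrow> complex" and G :: "real \<Rightarrow> real"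
  assumes X: "X > 0" and r: "r > 0"
    and \<Phi>: "\<And>z. Re z > 0 \<Longrightarrow>
      (\<Phi> has_field_derivative csqrt z * exp (of_real (X * r / 2) / z + of_real (X / (2 * r)) * z)) (at z)"
    and G: "\<And>s. s \<ge> 0 \<Longrightarrow> (G has_real_derivative exp (- s\<^sup>2)) (at s)" "G 0 = 0"
  shows "\<Phi> (of_real r * cis (pi / 3)) - \<Phi> (of_real r * cis (- (pi / 3))) =
    \<i> * of_real (4 * (r * sqrt r) * exp X *
      ((1 - 1 / X) * (G (sqrt (2 * X) / 2) / sqrt (2 * X)) + exp (- X / 2) / (2 * X)))"
proof -
  define I where "I = {0..pi / 3}"
  define C where "C = r * sqrt r"
  \<comment> \<open>Pairing the arguments \<open>\<psi>\<close> and \<open>- \<psi>\<close> turns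
    the phases into \<open>2 * cos (3 * \<psi> / 2)\<close>: \<open>\<psi> / 2\<close> comes from
    the square root and \<open>\<psi>\<close> from the differential.\<close>
  define k where "k = (\<lambda>\<psi>. \<Phi> (of_real r * cis \<psi>) - \<Phi> (of_real r * cis (- \<psi>)))"
  \<comment> \<open>An antiderivative of
    \<open>(1 - 4 * s\<^sup>2) * exp (- 2 * X * s\<^sup>2)\<close>; the polynomial arises from
    \<open>cos (3 * \<psi> / 2) = (1 - 4 * s\<^sup>2) * cos (\<psi> / 2)\<close>. Integrating its
    quadratic part by parts produces the factor \<open>1 - 1 / X\<close>.\<close>
  define B where "B = (\<lambda>s. (1 - 1 / X) * (G (sqrt (2 * X) * s) / sqrt (2 * X)) + 1 / X * (s * exp (- 2 * X * s\<^sup>2)))"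
  define J where "J = (\<lambda>\<psi>. \<i> * of_real (4 * C * exp X * B (sin (\<psi> / 2))) :: complex)"
  have h_deriv: "((\<lambda>\<psi>. \<Phi> (of_real r * cis (\<sigma> * \<psi>))) has_vector_derivative
      of_real \<sigma> * \<i> * of_real (C * exp (X * cos \<psi>)) * cis (\<sigma> * (3 * \<psi> / 2))) (at \<psi> within I)"
    if \<psi>: "\<psi> \<in> I" and \<sigma>: "\<sigma> = 1 \<or> \<sigma> = -1" for \<psi> \<sigma> :: real
  proof -
    have "0 \<le> \<psi>" "\<psi> < pi / 2"
      using \<psi> pi_gt_zero unfolding I_def atLeastAtMost_iff by linarith+
    then have ang: "\<bar>\<sigma> * \<psi>\<bar> < pi / 2" "cos (\<sigma> * \<psi>) = cos \<psi>"
      using \<sigma> by auto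
    then have Re: "Re (of_real r * cis (\<sigma> * \<psi>)) > 0"
      using r cos_gt_zero_pi[of "\<sigma> * \<psi>"] by (auto simp: abs_less_iff)
    have "((\<lambda>\<psi>. of_real r * cis (\<sigma> * \<psi>)) has_vector_derivative of_real r * (of_real \<sigma> * (\<i> * cis (\<sigma> * \<psi>)))) (at \<psi> within I)"
    proof -
      have "((\<lambda>w. of_real r * exp (\<i> * (of_real \<sigma> * w))) has_field_derivative
          of_real r * (of_real \<sigma> * (\<i> * exp (\<i> * (of_real \<sigma> * of_real \<psi>))))) (at (of_real \<psi>))"
        by (auto intro!: derivative_eq_intros)
      from has_vector_derivative_real_field[OF this] show ?thesis
        by (simp add: cis_conv_exp)
    qed
    from field_vector_diff_chain_within[OF this has_field_derivative_at_within[OF \<Phi>[OF Re]]]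
    have "((\<lambda>\<psi>. \<Phi> (of_real r * cis (\<sigma> * \<psi>))) has_vector_derivative
        of_real r * (of_real \<sigma> * (\<i> * cis (\<sigma> * \<psi>))) *
        (csqrt (of_real r * cis (\<sigma> * \<psi>)) * exp (of_real (X * r / 2) / (of_real r * cis (\<sigma> * \<psi>)) + of_real (X / (2 * r)) * (of_real r * cis (\<sigma> * \<psi>)))))
        (at \<psi> within I)"
      by (simp add: o_def)
    moreover have "csqrt (of_real r * cis (\<sigma> * \<psi>)) = of_real (sqrt r) * cis (\<sigma> * \<psi> / 2)"
    proof (rule csqrt_unique)
      show "(of_real (sqrt r) * cis (\<sigma> * \<psi> / 2))\<^sup>2 = of_real r * cis (\<sigma> * \<psi>)"
        using r by (simp add: power_mult_distrib power2_eq_square[of "cis _"] cis_mult mult.commute flip: of_real_power)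
      have "cos (\<sigma> * \<psi> / 2) > 0"
        using ang by (intro cos_gt_zero_pi) auto
      then show "0 < Re (of_real (sqrt r) * cis (\<sigma> * \<psi> / 2)) \<or>
          Re (of_real (sqrt r) * cis (\<sigma> * \<psi> / 2)) = 0 \<and> 0 \<le> Im (of_real (sqrt r) * cis (\<sigma> * \<psi> / 2))"
        using r by simp
    qed
    moreover have "of_real (X * r / 2) / (of_real r * cis (\<sigma> * \<psi>)) + of_real (X / (2 * r)) * (of_real r * cis (\<sigma> * \<psi>)) = of_real (X * cos \<psi>)"
    proof -
      have "of_real (X * r / 2) / (of_real r * cis (\<sigma> * \<psi>)) + of_real (X / (2 * r)) * (of_real r * cis (\<sigma> * \<psi>))
         = of_real (X / 2) * (cis (- (\<sigma> * \<psi>)) + cis (\<sigma> * \<psi>))"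
      proof -
        have "of_real (X * r / 2) / (of_real r * cis (\<sigma> * \<psi>)) = of_real (X / 2) * inverse (cis (\<sigma> * \<psi>))"
          using r by (simp add: field_simps del: cis_inverse)
        moreover have "of_real (X / (2 * r)) * (of_real r * cis (\<sigma> * \<psi>)) = of_real (X / 2) * cis (\<sigma> * \<psi>)"
          using r by simp
        ultimately show ?thesis
          by (simp only: cis_inverse distrib_left)
      qed
      also have "cis (- (\<sigma> * \<psi>)) + cis (\<sigma> * \<psi>) = of_real (2 * cos \<psi>)"
        using ang by (auto simp: complex_eq_iff)
      finally show ?thesis by simp
    qed
    moreover have "of_real r * (of_real \<sigma> * (\<i> * cis (\<sigma> * \<psi>))) *
        (of_real (sqrt r) * cis (\<sigma> * \<psi> / 2) * exp (of_real (X * cos \<psi>))) =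
        of_real \<sigma> * \<i> * of_real (C * exp (X * cos \<psi>)) * cis (\<sigma> * (3 * \<psi> / 2))"
    proof -
      have "cis (\<sigma> * (3 * \<psi> / 2)) = cis (\<sigma> * \<psi>) * cis (\<sigma> * \<psi> / 2)"
        by (simp add: cis_mult algebra_simps)
      then show ?thesis
        unfolding exp_of_real C_def by (simp only: of_real_mult mult_ac)
    qed
    ultimately show ?thesis
      by (simp only:)
  qed
  have k_deriv: "(k has_vector_derivative \<i> * of_real (2 * C * exp (X * cos \<psi>) * cos (3 * \<psi> / 2))) (at \<psi> within I)"
    if "\<psi> \<in> I" for \<psi>
  proof -
    have "(k has_vector_derivative of_real 1 * \<i> * of_real (C * exp (X * cos \<psi>)) * cis (1 * (3 * \<psi> / 2))
        - of_real (- 1) * \<i> * of_real (C * exp (X * cos \<psi>)) * cis ((- 1) * (3 * \<psi> / 2))) (at \<psi> within I)"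
      using has_vector_derivative_diff[OF h_deriv[OF that, of 1] h_deriv[OF that, of "-1"]]
      by (simp add: k_def)
    moreover have "of_real 1 * \<i> * of_real (C * exp (X * cos \<psi>)) * cis (1 * (3 * \<psi> / 2))
        - of_real (- 1) * \<i> * of_real (C * exp (X * cos \<psi>)) * cis ((- 1) * (3 * \<psi> / 2))
        = \<i> * of_real (C * exp (X * cos \<psi>)) * (cis (3 * \<psi> / 2) + cis (- (3 * \<psi> / 2)))"
      by (simp add: algebra_simps)
    moreover have "cis (3 * \<psi> / 2) + cis (- (3 * \<psi> / 2)) = of_real (2 * cos (3 * \<psi> / 2))"
      by (auto simp: complex_eq_iff)
    ultimately show ?thesis
      by (simp add: mult_ac)
  qed
  have J_deriv: "(J has_vector_derivative \<i> * of_real (2 * C * exp (X * cos \<psi>) * cos (3 * \<psi> / 2))) (at \<psi> within I)"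
    if \<psi>: "\<psi> \<in> I" for \<psi>
  proof -
    define s where "s = sin (\<psi> / 2)"
    have s: "s \<ge> 0"
      using \<psi> pi_gt_zero by (auto simp: s_def I_def intro!: sin_ge_zero)
    have "((\<lambda>s. G (sqrt (2 * X) * s)) has_real_derivative exp (- (sqrt (2 * X) * s)\<^sup>2) * sqrt (2 * X)) (at s)"
      by (rule DERIV_chain2[where f = G, OF G(1)]) (use s X in \<open>auto intro!: derivative_eq_intros\<close>)
    then have "((\<lambda>s. G (sqrt (2 * X) * s)) has_real_derivative exp (- 2 * X * s\<^sup>2) * sqrt (2 * X)) (at s)"
      using X by (simp add: power_mult_distrib)
    from DERIV_cdivide[OF this, of "sqrt (2 * X)"]
    have "((\<lambda>s. G (sqrt (2 * X) * s) / sqrt (2 * X)) has_real_derivative exp (- 2 * X * s\<^sup>2)) (at s)"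
      using X by simp
    moreover have "((\<lambda>s. s * exp (- 2 * X * s\<^sup>2)) has_real_derivative (1 - 4 * X * s\<^sup>2) * exp (- 2 * X * s\<^sup>2)) (at s)"
      by (auto intro!: derivative_eq_intros simp: algebra_simps power2_eq_square)
    ultimately have "(B has_real_derivative (1 - 1 / X) * exp (- 2 * X * s\<^sup>2)
        + 1 / X * ((1 - 4 * X * s\<^sup>2) * exp (- 2 * X * s\<^sup>2))) (at s)"
      unfolding B_def by (intro DERIV_add DERIV_cmult)
    moreover have "(1 - 1 / X) * exp (- 2 * X * s\<^sup>2)
        + 1 / X * ((1 - 4 * X * s\<^sup>2) * exp (- 2 * X * s\<^sup>2)) = (1 - 4 * s\<^sup>2) * exp (- 2 * X * s\<^sup>2)"
      using X by (simp add: field_simps)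
    ultimately have B_deriv: "(B has_real_derivative (1 - 4 * s\<^sup>2) * exp (- 2 * X * s\<^sup>2)) (at s)"
      by simp
    have "((\<lambda>\<psi>. sin (\<psi> / 2)) has_real_derivative cos (\<psi> / 2) / 2) (at \<psi> within I)"
      by (auto intro!: derivative_eq_intros)
    from DERIV_chain2[OF B_deriv[unfolded s_def] this]
    have "((\<lambda>\<psi>. B (sin (\<psi> / 2))) has_real_derivative (1 - 4 * s\<^sup>2) * exp (- 2 * X * s\<^sup>2) * (cos (\<psi> / 2) / 2)) (at \<psi> within I)"
      by (simp add: s_def)
    from DERIV_cmult[OF this, of "4 * C * exp X"]
    have "((\<lambda>\<psi>. 4 * C * exp X * B (sin (\<psi> / 2))) has_real_derivative
        4 * C * exp X * ((1 - 4 * s\<^sup>2) * exp (- 2 * X * s\<^sup>2) * (cos (\<psi> / 2) / 2))) (at \<psi> within I)" .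
    moreover have "4 * C * exp X * ((1 - 4 * s\<^sup>2) * exp (- 2 * X * s\<^sup>2) * (cos (\<psi> / 2) / 2)) = 2 * C * exp (X * cos \<psi>) * cos (3 * \<psi> / 2)"
    proof -
      have cos_eq: "cos \<psi> = 1 - 2 * s\<^sup>2"
        using cos_double_sin[of "\<psi> / 2"] by (simp add: s_def)
      have e: "exp X * exp (- 2 * X * s\<^sup>2) = exp (X * cos \<psi>)"
        unfolding exp_add[symmetric] cos_eq by (simp add: algebra_simps)
      have "cos (3 * \<psi> / 2) = cos (3 * (\<psi> / 2))" by simp
      also have "\<dots> = 4 * cos (\<psi> / 2) ^ 3 - 3 * cos (\<psi> / 2)"
        by (rule cos_treble_cos)
      also have "\<dots> = (4 * (cos (\<psi> / 2))\<^sup>2 - 3) * cos (\<psi> / 2)"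
        by (simp add: algebra_simps power2_eq_square power3_eq_cube)
      also have "(cos (\<psi> / 2))\<^sup>2 = 1 - s\<^sup>2"
        by (simp add: cos_squared_eq s_def)
      finally have "cos (3 * \<psi> / 2) = (1 - 4 * s\<^sup>2) * cos (\<psi> / 2)"
        by simp
      moreover have "4 * C * Y * (q * E * (c / 2)) = 2 * C * (Y * E) * (q * c)" for Y E q c
        by simp
      ultimately show ?thesis
        unfolding e[symmetric] by (simp only:)
    qed
    ultimately have "((\<lambda>\<psi>. 4 * C * exp X * B (sin (\<psi> / 2))) has_real_derivative 2 * C * exp (X * cos \<psi>) * cos (3 * \<psi> / 2)) (at \<psi> within I)"
      by (simp only:)
    then show ?thesis
      unfolding J_def by (intro has_vector_derivative_mult_right has_vector_derivative_of_real)
  qed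
  have "((\<lambda>\<psi>. k \<psi> - J \<psi>) has_vector_derivative 0) (at \<psi> within I)" if "\<psi> \<in> I" for \<psi>
    using has_vector_derivative_diff[OF k_deriv[OF that] J_deriv[OF that]] by simp
  then obtain c where c: "\<And>\<psi>. \<psi> \<in> I \<Longrightarrow> k \<psi> - J \<psi> = c"
    using has_vector_derivative_zero_constant[of I "\<lambda>\<psi>. k \<psi> - J \<psi>"] by (auto simp: I_def)
  have "k (pi / 3) - J (pi / 3) = k 0 - J 0"
    using c[of 0] c[of "pi / 3"] by (simp add: I_def)
  also have "\<dots> = 0"
    using G(2) by (simp add: k_def J_def B_def)
  finally have "k (pi / 3) = J (pi / 3)" by simp
  moreover have "B (1 / 2) = (1 - 1 / X) * (G (sqrt (2 * X) / 2) / sqrt (2 * X)) + exp (- X / 2) / (2 * X)"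
    by (simp add: B_def power2_eq_square)
  ultimately show ?thesis
    by (simp add: k_def J_def C_def sin_30)
qed

text \<open>The first term of Rademacher's series without its part of order
  \<open>exp (- X)\<close>, in the variable
  \<open>X = pi * sqrt (2 / 3 * (n - 1 / 24))\<close>.\<close>

definition rademacher_main :: "real \<Rightarrow> real" where
  "rademacher_main X = pi\<^sup>2 / (6 * sqrt 3 * X\<^sup>2) * exp X * (1 - 1 / X)"

text \<open>The two fractions are \<open>Re (1 / z)\<close> and its reciprocal: the first comes from
  the explicit exponential, the second from the trivial bound for the series at
  \<open>1 / z\<close>.\<close>

lemma norm_partition_integrand_le:
  fixes z :: complex
  assumes "Re z > 0"
  shows "norm (csqrt z * exp (of_real pi / (12 * z) + c * z) * partition_series (1 / z)) \<le>
    sqrt (norm z) * exp (pi / 12 * (Re z / (norm z)\<^sup>2 + (norm z)\<^sup>2 / Re z) + Re (c * z))"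
proof -
  have nz: "z \<noteq> 0" using assms by auto
  have inv: "Re (1 / z) = Re z / (norm z)\<^sup>2"
    by (simp add: Re_divide cmod_power2)
  have "norm (exp (of_real pi / (12 * z) + c * z)) = exp (pi / 12 * (Re z / (norm z)\<^sup>2) + Re (c * z))"
  proof -
    have "of_real pi / (12 * z) = (pi / 12) *\<^sub>R (1 / z)" by (simp add: scaleR_conv_of_real)
    then have "Re (of_real pi / (12 * z)) = pi / 12 * (Re z / (norm z)\<^sup>2)"
      by (simp only: scaleR_complex.sel inv)
    then show ?thesis by (simp only: norm_exp_eq_Re plus_complex.sel)
  qed
  moreover have "norm (partition_series (1 / z)) \<le> exp (pi / 12 * ((norm z)\<^sup>2 / Re z))"
    using norm_partition_series_le[of "1 / z"] assms nz unfolding inv by simp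
  ultimately have "norm (csqrt z * exp (of_real pi / (12 * z) + c * z) * partition_series (1 / z)) \<le>
      sqrt (norm z) * exp (pi / 12 * (Re z / (norm z)\<^sup>2) + Re (c * z)) * exp (pi / 12 * ((norm z)\<^sup>2 / Re z))"
    unfolding norm_mult norm_csqrt by (intro mult_mono) auto
  also have "\<dots> = sqrt (norm z) * exp (pi / 12 * (Re z / (norm z)\<^sup>2 + (norm z)\<^sup>2 / Re z) + Re (c * z))"
    by (simp only: mult.assoc exp_add[symmetric]) (simp add: algebra_simps)
  finally show ?thesis .
qed

text \<open>The second hypothesis means \<open>Re (1 / z) \<ge> 1\<close>. Without its constant term
  the series at \<open>1 / z\<close> decays like \<open>exp (- 2 * pi * Re (1 / z))\<close>, which
  outweighs the growth \<open>exp (pi / 12 * Re (1 / z))\<close>; so \<open>1 / z\<close> is absent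
  from the bound.\<close>

lemma norm_partition_integrand_error_le:
  fixes z :: complex
  assumes "Re z > 0" "Re z \<ge> (norm z)\<^sup>2"
  shows "norm (csqrt z * exp (of_real pi / (12 * z) + c * z) * (partition_series (1 / z) - 1)) \<le>
    sqrt (norm z) * exp (2 * pi + pi / 12 + Re (c * z))"
proof -
  have nz: "z \<noteq> 0" using assms by auto
  have inv: "Re (1 / z) = Re z / (norm z)\<^sup>2"
    by (simp add: Re_divide cmod_power2)
  define v where "v = Re z / (norm z)\<^sup>2"
  have v: "v \<ge> 1" using assms nz by (simp add: v_def)
  have "norm (exp (of_real pi / (12 * z) + c * z)) = exp (pi / 12 * v + Re (c * z))"
  proof -
    have "of_real pi / (12 * z) = (pi / 12) *\<^sub>R (1 / z)" by (simp add: scaleR_conv_of_real)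
    then have "Re (of_real pi / (12 * z)) = pi / 12 * v"
      by (simp only: scaleR_complex.sel inv v_def)
    then show ?thesis by (simp only: norm_exp_eq_Re plus_complex.sel)
  qed
  moreover have "norm (partition_series (1 / z) - 1) \<le> exp (2 * pi + pi / 12) * exp (- 2 * pi * v)"
    using norm_partition_series_minus_1_le[of "1 / z"] v unfolding inv v_def by blast
  ultimately have "norm (csqrt z * exp (of_real pi / (12 * z) + c * z) * (partition_series (1 / z) - 1)) \<le>
      sqrt (norm z) * exp (pi / 12 * v + Re (c * z)) * (exp (2 * pi + pi / 12) * exp (- 2 * pi * v))"
    unfolding norm_mult norm_csqrt by (intro mult_mono) auto
  also have "\<dots> = sqrt (norm z) * exp (pi / 12 * v + Re (c * z) + (2 * pi + pi / 12) + (- 2 * pi * v))"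
    by (simp only: mult.assoc exp_add[symmetric]) (simp add: algebra_simps)
  also have "\<dots> \<le> sqrt (norm z) * exp (2 * pi + pi / 12 + Re (c * z))"
  proof -
    have "pi / 12 * v \<le> 2 * pi * v" using v by (intro mult_right_mono) auto
    then show ?thesis by (intro mult_left_mono) auto
  qed
  finally show ?thesis .
qed

text \<open>The far parts of the line cause the error of order \<open>exp (X / 2)\<close>. On the
  near part, replacing the series at \<open>1 / z\<close> by 1 costs only a constant times
  \<open>exp (X / 4)\<close>, and the remaining integrand has the primitive \<open>\<Phi>\<close>,
  evaluated along the circle.\<close>

theorem p_rademacher_bound:
  fixes n :: nat and X :: real
  assumes X: "X \<ge> 40" and Xn: "X\<^sup>2 = 2 * pi\<^sup>2 / 3 * (real n - 1 / 24)"
  shows "\<bar>real (p n) - rademacher_main X\<bar> \<le> 2 * exp (X / 2)"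
proof -
  \<comment> \<open>The saddle point of \<open>pi / (12 * z) + c * z\<close>; below,
    \<open>x\<close> and \<open>y\<close> are the coordinates of the point of the circle at angle
    \<open>pi / 3\<close>.\<close>
  define r where "r = pi / (6 * X)"
  define x where "x = r / 2"
  define y where "y = r * (sqrt 3 / 2)"
  have r: "r > 0" "r \<le> 1 / 60"
    using X pi_less_4 by (auto simp: r_def field_simps)
  have x: "x > 0" using r by (simp add: x_def)
  have y: "y > 0" "y \<le> 1 / 60"
  proof -
    show "y > 0" using r by (simp add: y_def)
    have "sqrt 3 \<le> 2" by (rule real_le_lsqrt) auto
    then have "y \<le> r * 1" unfolding y_def using r by (intro mult_left_mono) auto
    then show "y \<le> 1 / 60" using r by simp
  qed
  have xy: "x\<^sup>2 + y\<^sup>2 = r\<^sup>2"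
    by (simp add: x_def y_def power_mult_distrib power_divide algebra_simps)
  have A: "X * r / 2 = pi / 12"
    using X by (simp add: r_def)
  have B: "X / (2 * r) = 2 * pi * (real n - 1 / 24)"
  proof -
    have "X / (2 * r) = 3 * X\<^sup>2 / pi"
      using X by (simp add: r_def power2_eq_square)
    then show ?thesis
      unfolding Xn by (simp add: power2_eq_square)
  qed
  define c where "c = X / (2 * r)"
  have cx: "c * x = X / 4"
    using r by (simp add: c_def x_def)
  define g0 where "g0 = (\<lambda>z. csqrt z * exp (of_real pi / (12 * z) + of_real c * z))"
  have g: "partition_series z * exp (2 * of_real pi * of_nat n * z) = g0 z * partition_series (1 / z)" if "Re z > 0" for z
  proof -
    have "of_real pi / (12 * z) - of_real pi * z / 12 + 2 * of_real pi * of_nat n * z = of_real pi / (12 * z) + of_real c * z"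
      unfolding c_def B by (simp add: algebra_simps)
    then have "exp (of_real pi / (12 * z) - of_real pi * z / 12) * exp (2 * of_real pi * of_nat n * z) =
        exp (of_real pi / (12 * z) + of_real c * z)"
      by (simp only: exp_add[symmetric])
    then show ?thesis
      unfolding partition_series_modular[OF that] g0_def by (simp add: mult_ac)
  qed
  have halfplane: "convex {z :: complex. Re z > 0}" "open {z :: complex. Re z > 0}"
    by (simp_all add: convex_halfspace_Re_gt open_halfspace_Re_gt)
  have "g0 holomorphic_on {z. Re z > 0}"
    unfolding g0_def by (intro holomorphic_intros) (auto simp: complex_nonpos_Reals_iff)
  then obtain \<Phi> where \<Phi>: "\<And>z. Re z > 0 \<Longrightarrow> (\<Phi> has_field_derivative g0 z) (at z)"
    using holomorphic_convex_primitive'[OF halfplane] at_within_open[OF _ halfplane(2)]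
    by (metis mem_Collect_eq)
  obtain \<Psi> where \<Psi>: "\<And>z. Re z > 0 \<Longrightarrow> (\<Psi> has_field_derivative g0 z * partition_series (1 / z)) (at z)"
    and \<Psi>_period: "\<And>z. Re z > 0 \<Longrightarrow> \<Psi> (z + \<i>) - \<Psi> z = \<i> * of_nat (p n)"
    using partition_series_primitive[of n] g by metis
  obtain G where G: "\<And>s. s \<ge> 0 \<Longrightarrow> (G has_real_derivative exp (- s\<^sup>2)) (at s)" "G 0 = 0"
    "\<And>a. a > 0 \<Longrightarrow> G a \<le> sqrt pi / 2" "\<And>a. a > 0 \<Longrightarrow> sqrt pi / 2 - exp (- a\<^sup>2) / (2 * a) \<le> G a"
    using gaussian_primitive by blast
  define e where "e = (\<lambda>t. Complex x t)"
  have e_seg: "Re w = x \<and> a \<le> Im w \<and> Im w \<le> b" if "w \<in> closed_segment (e a) (e b)" "a \<le> b" for w a b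
  proof -
    have "closed_segment (e a) (e b) = {w. Re w = x \<and> Im w \<in> closed_segment a b}"
      using closed_segment_same_Re[of "e a" "e b"] by (simp add: e_def)
    then show ?thesis
      using that by (simp add: closed_segment_eq_real_ivl)
  qed
  have e_dist: "norm (e b - e a) = \<bar>b - a\<bar>" for a b
    by (simp add: e_def cmod_def)
  have corner: "of_real r * cis (pi / 3) = e y" "of_real r * cis (- (pi / 3)) = e (- y)"
    by (auto simp: e_def complex_eq_iff x_def y_def cos_60 sin_60)

  have outer: "norm (\<Psi> (e b) - \<Psi> (e a)) \<le> exp (X / 2 + pi / 12 * (5 / 2 * r)) / 2"
    if ab: "a \<le> b" "b - a \<le> 1 / 2" and range: "\<And>t. a \<le> t \<Longrightarrow> t \<le> b \<Longrightarrow> y \<le> \<bar>t\<bar> \<and> \<bar>t\<bar> \<le> 1 / 2" for a b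
  proof -
    define K where "K = exp (X / 2 + pi / 12 * (5 / 2 * r))"
    have "norm (\<Psi> (e b) - \<Psi> (e a)) \<le> K * norm (e b - e a)"
    proof (rule field_differentiable_bound[where S = "closed_segment (e a) (e b)" and f' = "\<lambda>z. g0 z * partition_series (1 / z)"])
      fix z assume z: "z \<in> closed_segment (e a) (e b)"
      have Re: "Re z = x" and Im: "y \<le> \<bar>Im z\<bar>" "\<bar>Im z\<bar> \<le> 1 / 2"
        using e_seg[OF z ab(1)] range by auto
      show "(\<Psi> has_field_derivative g0 z * partition_series (1 / z)) (at z within closed_segment (e a) (e b))"
        using \<Psi>[of z] Re x by (auto intro: has_field_derivative_at_within)
      define R where "R = (norm z)\<^sup>2"
      have R_eq: "R = x\<^sup>2 + (Im z)\<^sup>2"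
        by (simp add: R_def cmod_power2 Re)
      have R: "r\<^sup>2 \<le> R" "R \<le> x\<^sup>2 + 1 / 4"
        using power_mono[OF Im(1), of 2] power_mono[OF Im(2), of 2] y unfolding R_eq xy[symmetric]
        by (auto simp: power_divide)
      have x1: "x\<^sup>2 \<le> 1 / 4"
        using power_mono[of x "1 / 2" 2] x r by (simp add: x_def power_divide)
      have "norm z \<le> 1"
        using R x1 by (intro power2_le_imp_le[of "norm z" 1]) (simp_all add: R_def)
      then have sq: "sqrt (norm z) \<le> 1" by simp
      define w where "w = R / x"
      have w: "2 * r \<le> w" "w \<le> 1 / (2 * r) + r / 2"
        using R x r by (auto simp: w_def x_def field_simps power2_eq_square)
      have w0: "w > 0" using w r by linarith
      \<comment> \<open>The ends of the range of \<open>w\<close> belong to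
        \<open>norm z = r\<close> and to height 1/2. Between two positive numbers with product at
        least 1, \<open>w + 1 / w\<close> is at most their sum, and here the sum is
        \<open>1 / (2 * r)\<close> up to a multiple of \<open>r\<close>.\<close>
      define b' where "b' = 1 / (2 * r) + r / 2"
      have "(w - 2 * r) * (w - b') \<le> 0"
        using w by (intro mult_nonneg_nonpos) (auto simp: b'_def)
      then have "w * w + 2 * r * b' \<le> w * (2 * r + b')"
        by (simp add: algebra_simps)
      moreover have "2 * r * b' = 1 + r\<^sup>2"
        using r by (simp add: b'_def algebra_simps power2_eq_square)
      ultimately have "w * w + 1 \<le> w * (2 * r + b')"
        using zero_le_power2[of r] by linarith
      then have "w + 1 / w \<le> 2 * r + b'"
        using w0 by (simp add: field_simps)
      then have "x / R + R / x \<le> 1 / (2 * r) + 5 / 2 * r"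
        by (simp add: w_def b'_def)
      then have "pi / 12 * (x / R + R / x) \<le> pi / 12 * (1 / (2 * r) + 5 / 2 * r)"
        by (intro mult_left_mono) auto
      also have "\<dots> = X / 4 + pi / 12 * (5 / 2 * r)"
        using r X unfolding A[symmetric] by (simp add: field_simps)
      finally have "pi / 12 * (x / R + R / x) \<le> X / 4 + pi / 12 * (5 / 2 * r)" .
      moreover have "Re (of_real c * z) = X / 4"
        using cx by (simp add: Re)
      ultimately have expo: "pi / 12 * (x / R + R / x) + Re (of_real c * z) \<le> X / 2 + pi / 12 * (5 / 2 * r)"
        by linarith
      have "norm (g0 z * partition_series (1 / z)) \<le> sqrt (norm z) * exp (pi / 12 * (x / R + R / x) + Re (of_real c * z))"
        using norm_partition_integrand_le[of z "of_real c"] x Re by (simp add: g0_def R_def)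
      also have "\<dots> \<le> 1 * K"
        unfolding K_def using sq expo by (intro mult_mono) auto
      finally show "norm (g0 z * partition_series (1 / z)) \<le> K" by simp
    qed auto
    also have "\<dots> \<le> K * (1 / 2)"
      using ab by (intro mult_left_mono) (auto simp: e_dist K_def)
    finally show ?thesis by (simp add: K_def)
  qed

  \<comment> \<open>Here \<open>norm z \<le> r\<close>, hence
    \<open>(norm z)\<^sup>2 \<le> r * r \<le> r / 2 = Re z\<close>, and the constant term of the
    series may be split off. The 7 is an upper bound for \<open>2 * pi + pi / 12\<close>.\<close>
  have middle: "norm ((\<Psi> (e y) - \<Phi> (e y)) - (\<Psi> (e (- y)) - \<Phi> (e (- y)))) \<le> exp (X / 4 + 7)"
  proof -
    have "norm ((\<Psi> (e y) - \<Phi> (e y)) - (\<Psi> (e (- y)) - \<Phi> (e (- y)))) \<le> exp (X / 4 + 7) * norm (e y - e (- y))"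
    proof (rule field_differentiable_bound[where S = "closed_segment (e (- y)) (e y)" and f = "\<lambda>z. \<Psi> z - \<Phi> z" and f' = "\<lambda>z. g0 z * (partition_series (1 / z) - 1)"])
      fix z assume z: "z \<in> closed_segment (e (- y)) (e y)"
      have Re: "Re z = x" and Im: "\<bar>Im z\<bar> \<le> y"
        using e_seg[OF z] y by auto
      show "((\<lambda>z. \<Psi> z - \<Phi> z) has_field_derivative g0 z * (partition_series (1 / z) - 1)) (at z within closed_segment (e (- y)) (e y))"
        using DERIV_diff[OF \<Psi>[of z] \<Phi>[of z]] Re x
        by (auto intro: has_field_derivative_at_within simp: algebra_simps)
      have "(norm z)\<^sup>2 \<le> r\<^sup>2"
        unfolding cmod_power2 Re xy[symmetric] using power_mono[OF Im, of 2] by simp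
      then have nz: "norm z \<le> r"
        using r by (simp add: power2_le_iff_abs_le)
      have "(norm z)\<^sup>2 \<le> r * r"
        unfolding power2_eq_square using nz r by (intro mult_mono) auto
      also have "\<dots> \<le> x"
        using r by (simp add: x_def)
      finally have "norm (g0 z * (partition_series (1 / z) - 1)) \<le> sqrt (norm z) * exp (2 * pi + pi / 12 + Re (of_real c * z))"
        unfolding g0_def using x Re by (intro norm_partition_integrand_error_le) auto
      also have "\<dots> \<le> 1 * exp (X / 4 + 7)"
        using nz r cx pi_approx by (intro mult_mono) (auto simp: Re)
      finally show "norm (g0 z * (partition_series (1 / z) - 1)) \<le> exp (X / 4 + 7)" by simp
    qed auto
    also have "\<dots> \<le> exp (X / 4 + 7) * 1"
      using y by (intro mult_left_mono) (auto simp: e_dist)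
    finally show ?thesis by simp
  qed

  define D where "D = (1 - 1 / X) * (G (sqrt (2 * X) / 2) / sqrt (2 * X)) + exp (- X / 2) / (2 * X)"
  have saddle: "\<Phi> (e y) - \<Phi> (e (- y)) = \<i> * of_real (4 * (r * sqrt r) * exp X * D)"
    unfolding corner[symmetric] D_def
  proof (rule saddle_point_integral[OF _ r(1) _ G(1,2)])
    fix z :: complex assume "Re z > 0"
    then show "(\<Phi> has_field_derivative csqrt z * exp (of_real (X * r / 2) / z + of_real (X / (2 * r)) * z)) (at z)"
      unfolding A using \<Phi>[of z] by (simp add: g0_def c_def)
  qed (use X in auto)
  \<comment> \<open>The Gaussian integral completed to infinity. The missing tail is at most
    \<open>exp (- X / 2) / (2 * X)\<close>, which is exactly the boundary term in \<open>D\<close>,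
    so \<open>D\<close> lies above \<open>D0\<close>.\<close>
  define D0 where "D0 = (1 - 1 / X) * (sqrt pi / 2 / sqrt (2 * X))"
  have D: "D0 \<le> D" "D \<le> D0 + exp (- X / 2) / (2 * X)"
  proof -
    define a where "a = sqrt (2 * X) / 2"
    have a: "a > 0" "a\<^sup>2 = X / 2" "sqrt (2 * X) = 2 * a" "4 * a * a = 2 * X"
      using X by (auto simp: a_def power_divide)
    have X1: "0 \<le> 1 - 1 / X" "1 - 1 / X \<le> 1" using X by auto
    show "D \<le> D0 + exp (- X / 2) / (2 * X)"
      unfolding D_def D0_def a_def[symmetric] using G(3)[OF a(1)] X1 X
      by (intro add_right_mono mult_left_mono divide_right_mono) auto
    have "(1 - 1 / X) * (sqrt pi / 2 / sqrt (2 * X) - G a / sqrt (2 * X)) \<le> 1 * (exp (- X / 2) / (2 * X))"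
    proof (intro mult_mono X1)
      have "(sqrt pi / 2 - G a) / sqrt (2 * X) \<le> (exp (- a\<^sup>2) / (2 * a)) / sqrt (2 * X)"
        using G(4)[OF a(1)] X by (intro divide_right_mono) auto
      also have "\<dots> = exp (- X / 2) / (2 * X)"
      proof -
        have "2 * a * sqrt (2 * X) = 2 * X"
          using a(4) unfolding a(3) by simp
        then show ?thesis
          unfolding a(2) divide_divide_eq_left by simp
      qed
      finally show "sqrt pi / 2 / sqrt (2 * X) - G a / sqrt (2 * X) \<le> exp (- X / 2) / (2 * X)"
        by (simp add: diff_divide_distrib)
      show "0 \<le> sqrt pi / 2 / sqrt (2 * X) - G a / sqrt (2 * X)"
        unfolding diff_divide_distrib[symmetric] using G(3)[OF a(1)] X by (intro divide_nonneg_nonneg) auto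
    qed auto
    then show "D0 \<le> D"
      unfolding D_def D0_def a_def[symmetric] by (simp only: right_diff_distrib)
  qed
  have main: "4 * (r * sqrt r) * exp X * D0 = rademacher_main X"
  proof -
    have "4 * (r * sqrt r) * (sqrt pi / 2 / sqrt (2 * X)) = pi\<^sup>2 / (6 * sqrt 3 * X\<^sup>2)"
    proof (rule power2_eq_imp_eq)
      show "(4 * (r * sqrt r) * (sqrt pi / 2 / sqrt (2 * X)))\<^sup>2 = (pi\<^sup>2 / (6 * sqrt 3 * X\<^sup>2))\<^sup>2"
        using r X by (simp add: power_mult_distrib power_divide) (simp add: r_def field_simps power2_eq_square eval_nat_numeral)
    qed (use r X in auto)
    moreover have "a * E * (b * g) = a * g * E * b" for a b g E :: real
      by (simp only: mult_ac)
    ultimately show ?thesis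
      unfolding rademacher_main_def D0_def by (simp only:)
  qed
  have main_err: "\<bar>4 * (r * sqrt r) * exp X * D - rademacher_main X\<bar> \<le> exp (X / 2) / 10"
  proof -
    define C where "C = 4 * (r * sqrt r) * exp X"
    have "sqrt r \<le> 1" using r by simp
    then have "r * sqrt r \<le> 1 / 60 * 1"
      using r by (intro mult_mono) auto
    then have C: "0 \<le> C" "C \<le> exp X / 15"
      using r by (auto simp: C_def)
    have "\<bar>C * D - C * D0\<bar> = C * (D - D0)"
      unfolding right_diff_distrib[symmetric] using C D by (intro abs_of_nonneg mult_nonneg_nonneg) auto
    also have "\<dots> \<le> exp X / 15 * (exp (- X / 2) / (2 * X))"
      using C D X by (intro mult_mono) auto
    also have "\<dots> = exp (X / 2) / (30 * X)"
    proof -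
      have "exp X * exp (- X / 2) = exp (X / 2)"
        unfolding exp_add[symmetric] by simp
      then show ?thesis
        by (simp add: field_simps)
    qed
    also have "\<dots> \<le> exp (X / 2) / 10"
      using X by (intro divide_left_mono) auto
    finally show ?thesis
      unfolding main[symmetric] C_def .
  qed

  have "e (- (1 / 2)) + \<i> = e (1 / 2)" "Re (e (- (1 / 2))) > 0"
    using x by (auto simp: e_def complex_eq_iff)
  then have total: "\<Psi> (e (1 / 2)) - \<Psi> (e (- (1 / 2))) = \<i> * of_nat (p n)"
    using \<Psi>_period by metis
  have "\<i> * of_real (real (p n) - 4 * (r * sqrt r) * exp X * D) =
      (\<Psi> (e (1 / 2)) - \<Psi> (e y)) + (\<Psi> (e (- y)) - \<Psi> (e (- (1 / 2)))) +
      ((\<Psi> (e y) - \<Phi> (e y)) - (\<Psi> (e (- y)) - \<Phi> (e (- y))))"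
    using total saddle by (simp add: algebra_simps)
  also have "norm \<dots> \<le> exp (X / 2 + pi / 12 * (5 / 2 * r)) / 2 + exp (X / 2 + pi / 12 * (5 / 2 * r)) / 2 + exp (X / 4 + 7)"
    using y by (intro norm_triangle_le add_mono middle outer) auto
  finally have "\<bar>real (p n) - 4 * (r * sqrt r) * exp X * D\<bar> \<le> exp (X / 2 + pi / 12 * (5 / 2 * r)) + exp (X / 4 + 7)"
    by (simp add: norm_mult del: of_real_diff of_real_mult)
  also have "\<dots> \<le> exp (X / 2) * (3 / 2) + exp (X / 2) * (1 / 5)"
  proof (intro add_mono)
    have "pi / 12 * (5 / 2 * r) \<le> 4 / 12 * (5 / 2 * (1 / 60))"
      using r pi_less_4 by (intro mult_mono) auto
    then have "exp (pi / 12 * (5 / 2 * r)) \<le> exp (1 / 3)"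
      by simp
    also have "exp (1 / 3) \<le> 1 + 1 / 3 + (1 / 3 :: real)\<^sup>2"
      by (rule exp_bound) auto
    finally have "exp (pi / 12 * (5 / 2 * r)) \<le> 3 / 2"
      by (simp add: power2_eq_square)
    then show "exp (X / 2 + pi / 12 * (5 / 2 * r)) \<le> exp (X / 2) * (3 / 2)"
      unfolding exp_add by (intro mult_left_mono) auto
    \<comment> \<open>From \<open>5 \<le> exp 3\<close> it suffices that
      \<open>X / 4 + 10 \<le> X / 2\<close>; this is the hypothesis
      \<open>X \<ge> 40\<close>.\<close>
    show "exp (X / 4 + 7) \<le> exp (X / 2) * (1 / 5)"
    proof -
      have "(5 :: real) \<le> (1 + 3 / 2)\<^sup>2" by (simp add: power2_eq_square)
      also have "\<dots> \<le> (exp (3 / 2))\<^sup>2"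
        using exp_ge_add_one_self[of "3 / 2"] by (intro power_mono) auto
      also have "\<dots> = exp 3"
        by (simp flip: exp_double)
      finally have "5 * exp (X / 4 + 7) \<le> exp 3 * exp (X / 4 + 7)"
        by (intro mult_right_mono) auto
      also have "\<dots> \<le> exp (X / 2)"
        using X by (simp flip: exp_add)
      finally show ?thesis by simp
    qed
  qed
  finally have "\<bar>real (p n) - 4 * (r * sqrt r) * exp X * D\<bar> \<le> 17 / 10 * exp (X / 2)" by simp
  then show ?thesis
    using main_err exp_gt_zero[of "X / 2"] by linarith
qed

section \<open>Second differences of the leading term\<close>

lemma exp_le_one_plus:
  fixes x :: real
  assumes "0 \<le> x" "x \<le> 1"
  shows "exp (x - x\<^sup>2) \<le> 1 + x"
  using ln_one_plus_pos_lower_bound[OF assms] assms by (subst (asm) ln_ge_iff) auto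

lemma exp_le_one_minus:
  fixes x :: real
  assumes "0 \<le> x" "x \<le> 1 / 2"
  shows "exp (- 2 * x) \<le> 1 - x"
proof -
  have "- x - 2 * x\<^sup>2 \<le> ln (1 - x)"
    using assms by (intro ln_one_minus_pos_lower_bound) auto
  moreover have "x * x \<le> x * (1 / 2)"
    using assms by (intro mult_left_mono) auto
  ultimately have "- 2 * x \<le> ln (1 - x)"
    by (simp add: power2_eq_square)
  then show ?thesis
    using assms by (subst (asm) ln_ge_iff) auto
qed

text \<open>The square of the sum is \<open>2 + 2 * sqrt (1 - h\<^sup>2)\<close>, so a single root
  has to be compared with polynomials. The deviation from 2 is the relative second difference of the
  exponent \<open>X\<close>.\<close>

lemma sqrt_sum_bounds:
  fixes h :: real
  assumes "0 < h" "h \<le> 1 / 2"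
  shows "sqrt (1 + h) + sqrt (1 - h) \<le> 2 - h\<^sup>2 / 4"
    and "2 - h\<^sup>2 / 4 - h ^ 4 / 4 \<le> sqrt (1 + h) + sqrt (1 - h)"
proof -
  define w where "w = sqrt (1 + h) + sqrt (1 - h)"
  define v where "v = h\<^sup>2"
  have v: "0 < v" "v \<le> 1 / 4"
    using assms power_mono[of h "1 / 2" 2] by (auto simp: v_def power_divide)
  have w0: "w \<ge> 0" using assms by (simp add: w_def)
  have "sqrt (1 + h) * sqrt (1 - h) = sqrt (1 - v)"
    by (simp add: v_def real_sqrt_mult[symmetric] algebra_simps power2_eq_square)
  then have w2: "w\<^sup>2 = 2 + 2 * sqrt (1 - v)"
    using assms unfolding w_def power2_sum by simp
  have "sqrt (1 - v) \<le> 1 - v / 2"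
    using v by (intro real_le_lsqrt) (auto simp: power2_eq_square algebra_simps)
  moreover have "(2 - v / 4)\<^sup>2 = 4 - v + (v / 4)\<^sup>2"
    by (simp add: power2_eq_square algebra_simps)
  ultimately have "w\<^sup>2 \<le> (2 - v / 4)\<^sup>2"
    unfolding w2 using zero_le_power2[of "v / 4"] by linarith
  then have "w \<le> 2 - v / 4"
    by (rule power2_le_imp_le) (use v in simp)
  then show "sqrt (1 + h) + sqrt (1 - h) \<le> 2 - h\<^sup>2 / 4"
    by (simp add: w_def v_def)
  have v3: "v * (v * v) \<le> v * v / 4" "v * (v * (v * v)) \<le> v * v / 4" "0 \<le> v * v"
  proof -
    have "v * v * v \<le> v * v * (1 / 4)"
      using v by (intro mult_left_mono) auto
    then show "v * (v * v) \<le> v * v / 4" by (simp add: mult_ac)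
    have "v * v * (v * v) \<le> v * v * (1 / 4 * 1)"
      using v by (intro mult_left_mono mult_mono) auto
    then show "v * (v * (v * v)) \<le> v * v / 4" by (simp add: mult_ac)
  qed simp
  have "1 - v / 2 - v * v / 4 \<le> sqrt (1 - v)"
  proof (rule real_le_rsqrt)
    have "(1 - v / 2 - v * v / 4)\<^sup>2 = 1 - v - v * v / 4 + v * (v * v) / 4 + v * (v * (v * v)) / 16"
      by (simp add: power2_eq_square algebra_simps)
    then show "(1 - v / 2 - v * v / 4)\<^sup>2 \<le> 1 - v"
      using v3 by linarith
  qed
  then have "4 - v - v * v / 2 \<le> w\<^sup>2"
    unfolding w2 by simp
  moreover have "(2 - v / 4 - v * v / 4)\<^sup>2 = 4 - v - v * v + v * v / 16 + v * (v * v) / 8 + v * (v * (v * v)) / 16"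
    by (simp add: power2_eq_square algebra_simps)
  ultimately have "(2 - v / 4 - v * v / 4)\<^sup>2 \<le> w\<^sup>2"
    using v3 by linarith
  then have "2 - v / 4 - v * v / 4 \<le> w"
    using w0 by (rule power2_le_imp_le)
  then show "2 - h\<^sup>2 / 4 - h ^ 4 / 4 \<le> sqrt (1 + h) + sqrt (1 - h)"
    by (simp add: w_def v_def power2_eq_square eval_nat_numeral)
qed

text \<open>With \<open>h = 1 / (n - 1 / 24)\<close> the three arguments belong to
  \<open>n + 1\<close>, \<open>n - 1\<close> and \<open>n\<close>. The ratio splits into
  \<open>exp S\<close> from the exponentials, \<open>1 / (1 - h\<^sup>2)\<close> from the factors
  \<open>1 / X\<^sup>2\<close>, and \<open>Q\<close> from the factors \<open>1 - 1 / X\<close>. The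
  coefficients 2 and 9/10 are rough substitutes for the 1 that the second factor
  contributes.\<close>

lemma rademacher_main_ratio_bounds:
  fixes X h :: real
  assumes X: "X \<ge> 50" and h: "0 < h" "h \<le> 1 / 300"
  defines "R \<equiv> rademacher_main (X * sqrt (1 + h)) * rademacher_main (X * sqrt (1 - h)) / (rademacher_main X)\<^sup>2"
  shows "R \<le> exp (2 * h\<^sup>2 - X * h\<^sup>2 / 4)"
    and "exp (9 / 10 * h\<^sup>2 - X * h\<^sup>2 / 4 - X * h ^ 4 / 4) \<le> R"
proof -
  define s1 where "s1 = sqrt (1 + h)"
  define s2 where "s2 = sqrt (1 - h)"
  define v where "v = h\<^sup>2"
  have v: "0 < v" "v \<le> 1 / 1000"
    using h power_mono[of h "1 / 300" 2] by (auto simp: v_def power_divide)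
  have s: "s1 > 0" "s2 > 0" "s1\<^sup>2 * s2\<^sup>2 = 1 - v"
    using h by (auto simp: s1_def s2_def v_def power2_eq_square algebra_simps)
  have s12: "s1 * s2 = sqrt (1 - v)"
    using s by (metis real_sqrt_unique power_mult_distrib less_imp_le mult_pos_pos)
  define a where "a = 1 / X"
  have a: "0 < a" "a \<le> 1 / 50" using X by (auto simp: a_def)
  define q where "q = 1 / (s1 * s2)"
  have q: "1 \<le> q" "q \<le> 1 + v"
  proof -
    have "sqrt (1 - v) \<le> 1" "0 < sqrt (1 - v)" using v by auto
    then show "1 \<le> q" unfolding q_def s12 by simp
    have "1 \<le> (1 + v)\<^sup>2 * (1 - v)"
    proof -
      have "(1 + v)\<^sup>2 * (1 - v) = 1 + v * (1 - v - v * v)"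
        by (simp add: power2_eq_square algebra_simps)
      moreover have "v * v \<le> 1 * v" using v by (intro mult_right_mono) auto
      then have "0 \<le> v * (1 - v - v * v)" by (intro mult_nonneg_nonneg) (use v in linarith)+
      ultimately show ?thesis by simp
    qed
    then have "1 \<le> sqrt ((1 + v)\<^sup>2 * (1 - v))" by simp
    then have "1 \<le> (1 + v) * sqrt (1 - v)"
      using v by (simp add: real_sqrt_mult)
    then show "q \<le> 1 + v"
      unfolding q_def s12 using \<open>0 < sqrt (1 - v)\<close> by (simp add: divide_le_eq)
  qed
  define S where "S = X * (s1 + s2 - 2)"
  define Q where "Q = (1 - a / s1) * (1 - a / s2) / (1 - a)\<^sup>2"
  have R_eq: "R = exp S / (1 - v) * Q"
  proof -
    have "R = (exp (X * s1) * exp (X * s2) / (exp X)\<^sup>2) * (1 / (s1\<^sup>2 * s2\<^sup>2)) * Q"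
    proof -
      have "(k / (6 * w * (X * s1)\<^sup>2) * e1 * t1) * (k / (6 * w * (X * s2)\<^sup>2) * e2 * t2) / (k / (6 * w * X\<^sup>2) * e0 * t0)\<^sup>2
          = (e1 * e2 / e0\<^sup>2) * (1 / (s1\<^sup>2 * s2\<^sup>2)) * (t1 * t2 / t0\<^sup>2)"
        if "k \<noteq> 0" "w \<noteq> 0" for k w e0 e1 e2 t0 t1 t2 :: real
        using that X s(1,2) by (simp add: power_mult_distrib power_divide divide_simps)
          (simp add: power2_eq_square eval_nat_numeral)
      then show ?thesis
        unfolding R_def s1_def[symmetric] s2_def[symmetric] rademacher_main_def Q_def a_def divide_divide_eq_left[of 1 X]
        by this simp_all
    qed
    moreover have "exp (X * s1) * exp (X * s2) / (exp X)\<^sup>2 = exp S"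
      unfolding S_def power2_eq_square by (simp flip: exp_add exp_diff add: algebra_simps)
    ultimately show ?thesis by (simp add: s(3))
  qed
  have S: "S \<le> - (X * v / 4)" "- (X * v / 4) - X * h ^ 4 / 4 \<le> S"
  proof -
    have "X * (s1 + s2 - 2) \<le> X * (- v / 4)"
      using sqrt_sum_bounds(1)[of h] h X by (intro mult_left_mono) (auto simp: s1_def s2_def v_def)
    then show "S \<le> - (X * v / 4)" by (simp add: S_def)
    have "X * (- v / 4 - h ^ 4 / 4) \<le> X * (s1 + s2 - 2)"
      using sqrt_sum_bounds(2)[of h] h X by (intro mult_left_mono) (auto simp: s1_def s2_def v_def)
    then show "- (X * v / 4) - X * h ^ 4 / 4 \<le> S" by (simp add: S_def algebra_simps)
  qed
  have sum_inv: "a / s1 + a / s2 = a * ((s1 + s2) * q)" "a / s1 * (a / s2) = a\<^sup>2 * q"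
    using s by (auto simp: q_def field_simps power2_eq_square)
  have num: "(1 - a / s1) * (1 - a / s2) = 1 - a * ((s1 + s2) * q) + a\<^sup>2 * q"
    unfolding sum_inv[symmetric] by (simp add: algebra_simps)
  have Q_le: "Q \<le> 1"
  proof -
    \<comment> \<open>The geometric mean of \<open>a / s1\<close> and \<open>a / s2\<close>. By the
      inequality of the means the numerator of \<open>Q\<close> is at most
      \<open>(1 - g)\<^sup>2\<close>, and \<open>a \<le> g\<close>.\<close>
    define g where "g = a * sqrt q"
    have "sqrt q \<ge> 1" using q by simp
    then have "a * 1 \<le> g" unfolding g_def using a by (intro mult_left_mono) auto
    moreover have "sqrt q \<le> 2" using q v by (intro real_le_lsqrt) auto
    then have "g \<le> 1 / 50 * 2" unfolding g_def using a q by (intro mult_mono) auto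
    ultimately have g: "a \<le> g" "g \<le> 1" by auto
    define P1 where "P1 = a / s1"
    define P2 where "P2 = a / s2"
    have P: "P1 > 0" "P2 > 0" using a s by (auto simp: P1_def P2_def)
    have g2: "g\<^sup>2 = P1 * P2"
      unfolding P1_def P2_def sum_inv g_def power_mult_distrib using q by simp
    have "0 \<le> (P1 - P2)\<^sup>2" by simp
    then have "(2 * g)\<^sup>2 \<le> (P1 + P2)\<^sup>2"
      unfolding power_mult_distrib g2 by (simp add: power2_eq_square algebra_simps)
    then have "2 * g \<le> P1 + P2"
      by (rule power2_le_imp_le) (use P in simp)
    moreover have "(1 - P1) * (1 - P2) = 1 - (P1 + P2) + g\<^sup>2" "(1 - g)\<^sup>2 = 1 - 2 * g + g\<^sup>2"
      by (simp_all only: g2 power2_diff) (simp_all add: algebra_simps)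
    ultimately have "(1 - a / s1) * (1 - a / s2) \<le> (1 - g)\<^sup>2"
      unfolding P1_def[symmetric] P2_def[symmetric] by linarith
    also have "\<dots> \<le> (1 - a)\<^sup>2"
      using g by (intro power_mono) auto
    finally show ?thesis
      using a by (simp add: Q_def divide_le_eq)
  qed
  have Q_ge: "exp (- (9 / 100) * v) \<le> Q"
  proof -
    have "(s1 + s2) * q \<le> (2 - v / 4) * (1 + v)"
      using sqrt_sum_bounds(1)[of h] h q v s by (intro mult_mono) (auto simp: s1_def s2_def v_def)
    also have "\<dots> \<le> 2 + 2 * v"
      using v by (simp add: algebra_simps)
    finally have "a * ((s1 + s2) * q) \<le> a * (2 + 2 * v)"
      using a by (intro mult_left_mono) auto
    moreover have "a\<^sup>2 * 1 \<le> a\<^sup>2 * q"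
      using q by (intro mult_left_mono) auto
    ultimately have "(1 - a)\<^sup>2 - 2 * a * v \<le> (1 - a / s1) * (1 - a / s2)"
      unfolding num by (simp add: power2_eq_square algebra_simps)
    then have "((1 - a)\<^sup>2 - 2 * a * v) / (1 - a)\<^sup>2 \<le> Q"
      unfolding Q_def by (intro divide_right_mono) auto
    moreover have "((1 - a)\<^sup>2 - 2 * a * v) / (1 - a)\<^sup>2 = 1 - 2 * a * v / (1 - a)\<^sup>2"
      using a by (simp add: diff_divide_distrib)
    moreover have "2 * a * v / (1 - a)\<^sup>2 \<le> 9 / 200 * v"
    proof -
      have "(49 / 50)\<^sup>2 \<le> (1 - a)\<^sup>2" using a by (intro power_mono) auto
      then have "9 / 200 * v * (49 / 50)\<^sup>2 \<le> 9 / 200 * v * (1 - a)\<^sup>2"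
        using v by (intro mult_left_mono) auto
      moreover have "2 * a * v \<le> 2 * (1 / 50) * v"
        using a v by (intro mult_right_mono mult_left_mono) auto
      ultimately have "2 * a * v \<le> 9 / 200 * v * (1 - a)\<^sup>2"
        using v by (simp add: power2_eq_square)
      then show ?thesis
        using a by (simp add: divide_le_eq)
    qed
    ultimately have "1 - 9 / 200 * v \<le> Q" by linarith
    moreover have "exp (- 2 * (9 / 200 * v)) \<le> 1 - 9 / 200 * v"
      using v by (intro exp_le_one_minus) auto
    ultimately show ?thesis by simp
  qed
  have "exp (- 2 * v) \<le> 1 - v"
    using v by (intro exp_le_one_minus) auto
  then have "1 / (1 - v) \<le> 1 / exp (- 2 * v)"
    using v by (intro divide_left_mono) auto
  then have inv_le: "1 / (1 - v) \<le> exp (2 * v)"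
    by (simp add: exp_minus inverse_eq_divide)
  have "R = exp S * (1 / (1 - v)) * Q" by (simp add: R_eq)
  also have "\<dots> \<le> exp (- (X * v / 4)) * exp (2 * v) * 1"
    using S(1) inv_le Q_le v order_trans[OF exp_ge_zero Q_ge] by (intro mult_mono) auto
  also have "\<dots> = exp (2 * v - X * v / 4)"
    by (simp flip: exp_add)
  finally show "R \<le> exp (2 * h\<^sup>2 - X * h\<^sup>2 / 4)"
    by (simp add: v_def)
  have "exp (v - v\<^sup>2) \<le> 1 + v"
    using v by (intro exp_le_one_plus) auto
  also have "1 + v \<le> 1 / (1 - v)"
    using v by (simp add: field_simps power2_eq_square)
  finally have inv_ge: "exp (v - v\<^sup>2) \<le> 1 / (1 - v)" .
  have "v\<^sup>2 \<le> 1 / 1000 * v"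
    unfolding power2_eq_square using v by (intro mult_right_mono) auto
  then have "exp (9 / 10 * v - X * v / 4 - X * h ^ 4 / 4) \<le> exp ((- (X * v / 4) - X * h ^ 4 / 4) + (v - v\<^sup>2) + (- (9 / 100) * v))"
    using v by simp
  also have "\<dots> = exp (- (X * v / 4) - X * h ^ 4 / 4) * exp (v - v\<^sup>2) * exp (- (9 / 100) * v)"
    by (simp only: exp_add)
  also have "\<dots> \<le> exp S * (1 / (1 - v)) * Q"
    using S(2) inv_ge Q_ge v by (intro mult_mono) auto
  also have "\<dots> = R" by (simp add: R_eq)
  finally show "exp (9 / 10 * h\<^sup>2 - X * h\<^sup>2 / 4 - X * h ^ 4 / 4) \<le> R"
    by (simp add: v_def)
qed

section \<open>Transfer of the error bound to \<open>p\<close> and \<open>u\<close>\<close>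

lemma rademacher_main_relative_error:
  fixes Y :: real
  assumes "Y \<ge> 50"
  shows "rademacher_main Y > 0" and "2 * exp (Y / 2) \<le> 3 / 2 / Y ^ 4 * rademacher_main Y"
proof -
  have sqrt3: "sqrt 3 \<le> 7 / 4"
    by (rule real_le_lsqrt) (simp_all add: power2_eq_square)
  have c: "9 / 10 \<le> pi\<^sup>2 / (6 * sqrt 3) * (1 - 1 / Y)"
  proof -
    have "(314 / 100)\<^sup>2 \<le> pi\<^sup>2" using pi_approx by (intro power_mono) auto
    moreover have "1 / Y \<le> 1 / 50" using assms by (intro divide_left_mono) auto
    ultimately have "(314 / 100)\<^sup>2 / (6 * (7 / 4)) * (49 / 50) \<le> pi\<^sup>2 / (6 * sqrt 3) * (1 - 1 / Y)"
      using sqrt3 by (intro mult_mono frac_le) auto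
    then show ?thesis by (rule order_trans[rotated]) (simp add: power2_eq_square)
  qed
  have eq: "rademacher_main Y = pi\<^sup>2 / (6 * sqrt 3) * (1 - 1 / Y) * (exp Y / Y\<^sup>2)"
    by (simp add: rademacher_main_def)
  have ge: "9 / 10 * (exp Y / Y\<^sup>2) \<le> rademacher_main Y"
    unfolding eq using c by (intro mult_right_mono) auto
  moreover have "9 / 10 * (exp Y / Y\<^sup>2) > 0"
    using assms by simp
  ultimately show "rademacher_main Y > 0"
    by linarith
  \<comment> \<open>The sixth root of the bound on \<open>Y ^ 6\<close> that is needed. It follows
    from the tangent of \<open>exp\<close> at 4, close to \<open>Y / 12\<close> at the critical
    value \<open>Y = 50\<close>.\<close>
  have "Y \<le> 9 / 10 * exp (Y / 12)"
  proof -
    have "1 + 1 / 4 + (1 / 4)\<^sup>2 / 2 \<le> exp (1 / 4 :: real)"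
      by (rule exp_lower_Taylor_quadratic) simp
    then have "(41 / 32) ^ 16 \<le> exp (1 / 4 :: real) ^ 16"
      by (intro power_mono) (auto simp: power2_eq_square)
    then have e4: "52 \<le> exp (4 :: real)"
      by (simp add: exp_of_nat_mult[symmetric] power_divide)
    have "Y / 12 - 3 \<le> exp (Y / 12 - 4)"
      using exp_ge_add_one_self[of "Y / 12 - 4"] by simp
    then have "52 * (Y / 12 - 3) \<le> exp 4 * exp (Y / 12 - 4)"
      using e4 assms by (intro mult_mono) auto
    also have "\<dots> = exp (Y / 12)"
      by (simp flip: exp_add)
    finally show ?thesis using assms by simp
  qed
  then have "Y ^ 6 \<le> (9 / 10 * exp (Y / 12)) ^ 6"
    using assms by (intro power_mono) auto
  also have "\<dots> = (9 / 10) ^ 6 * exp (Y / 2)"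
  proof -
    have "exp (Y / 12) ^ 6 = exp (Y / 2)"
      by (simp add: exp_of_nat_mult[symmetric])
    then show ?thesis
      by (simp only: power_mult_distrib)
  qed
  finally have "Y ^ 6 * exp (Y / 2) \<le> (9 / 10) ^ 6 * exp (Y / 2) * exp (Y / 2)"
    by (intro mult_right_mono) auto
  also have "\<dots> = (9 / 10) ^ 6 * exp Y"
    by (simp flip: exp_add)
  also have "\<dots> \<le> 27 / 40 * exp Y"
    by (intro mult_right_mono) (auto simp: power_divide)
  finally have "2 * exp (Y / 2) * Y ^ 6 \<le> 3 / 2 * (9 / 10) * exp Y"
    by (simp add: mult_ac)
  then have "2 * exp (Y / 2) \<le> 3 / 2 * (9 / 10) * exp Y / Y ^ 6"
    using assms by (simp add: le_divide_eq)
  also have "\<dots> = 3 / 2 / Y ^ 4 * (9 / 10 * (exp Y / Y\<^sup>2))"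
    by (simp add: eval_nat_numeral)
  also have "\<dots> \<le> 3 / 2 / Y ^ 4 * rademacher_main Y"
    using ge assms by (intro mult_left_mono) auto
  finally show "2 * exp (Y / 2) \<le> 3 / 2 / Y ^ 4 * rademacher_main Y" .
qed

lemma p_relative_error:
  fixes Y \<eta> :: real and k :: nat
  assumes Y: "Y \<ge> 50" and Yk: "Y\<^sup>2 = 2 * pi\<^sup>2 / 3 * (real k - 1 / 24)" and \<eta>: "3 / 2 / Y ^ 4 \<le> \<eta>"
  shows "(1 - \<eta>) * rademacher_main Y \<le> real (p k)" and "real (p k) \<le> (1 + \<eta>) * rademacher_main Y"
proof -
  have "\<bar>real (p k) - rademacher_main Y\<bar> \<le> 2 * exp (Y / 2)"
    using Y by (intro p_rademacher_bound Yk) auto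
  also have "\<dots> \<le> 3 / 2 / Y ^ 4 * rademacher_main Y"
    by (rule rademacher_main_relative_error(2)[OF Y])
  also have "\<dots> \<le> \<eta> * rademacher_main Y"
    using \<eta> rademacher_main_relative_error(1)[OF Y] by (intro mult_right_mono) auto
  finally show "(1 - \<eta>) * rademacher_main Y \<le> real (p k)" "real (p k) \<le> (1 + \<eta>) * rademacher_main Y"
    by (simp_all add: abs_le_iff algebra_simps)
qed

lemma u_bounds_large:
  fixes n :: nat
  assumes n: "n \<ge> 385"
  defines "m \<equiv> real n - 1 / 24"
  defines "X \<equiv> pi * sqrt (2 / 3 * m)"
  shows "u n \<le> exp (9 / 4 * (1 / m)\<^sup>2 - X * (1 / m)\<^sup>2 / 4)"
    and "exp (13 / 20 * (1 / m)\<^sup>2 - X * (1 / m)\<^sup>2 / 4 - X * (1 / m) ^ 4 / 4) \<le> u n"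
proof -
  define h where "h = 1 / m"
  \<comment> \<open>A common relative error for the three values of \<open>p\<close>. The four
    factors in \<open>u n\<close> cost at most \<open>exp (6 * \<eta>)\<close>, and 6/25 < 1/4 turns
    the coefficients 2 and 9/10 into 9/4 and 13/20.\<close>
  define \<eta> where "\<eta> = h\<^sup>2 / 25"
  have m: "m \<ge> 384" using n by (simp add: m_def)
  have h: "0 < h" "h \<le> 1 / 384" "m * h = 1"
    using m by (auto simp: h_def divide_simps)
  have h2: "h\<^sup>2 \<le> (1 / 384)\<^sup>2"
    using h by (intro power_mono) auto
  have \<eta>: "0 < \<eta>" "\<eta> \<le> 1 / 1000"
    using h h2 by (auto simp: \<eta>_def power2_eq_square)
  have pi2: "657 / 100 \<le> 2 * pi\<^sup>2 / 3"
  proof -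
    have "(314 / 100)\<^sup>2 \<le> pi\<^sup>2" using pi_approx by (intro power_mono) auto
    then show ?thesis by (simp add: power2_eq_square)
  qed
  have X2: "X\<^sup>2 = 2 * pi\<^sup>2 / 3 * m"
    using m by (simp add: X_def power_mult_distrib)
  have X0: "X \<ge> 0" using m by (simp add: X_def)
  \<comment> \<open>Since \<open>m * h = 1\<close>, the argument \<open>X * sqrt (1 + j * h)\<close>
    is the Rademacher variable of \<open>n + j\<close>, used for \<open>j\<close> = -1, 0, 1. The
    smallest index 384 still gives a value of at least 50.\<close>
  have key: "(1 - \<eta>) * rademacher_main (X * sqrt (1 + j * h)) \<le> real (p k) \<and>
      real (p k) \<le> (1 + \<eta>) * rademacher_main (X * sqrt (1 + j * h)) \<and> X * sqrt (1 + j * h) \<ge> 50"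
    if j: "-1 \<le> j" "real k = real n + j" for j k
  proof -
    define Y where "Y = X * sqrt (1 + j * h)"
    have "- 1 * h \<le> j * h" using j h by (intro mult_right_mono) auto
    then have jh: "1 + j * h \<ge> 1 - h" "1 - h > 0" using h by auto
    have Y2: "Y\<^sup>2 = 2 * pi\<^sup>2 / 3 * (m + j)"
    proof -
      have "Y\<^sup>2 = X\<^sup>2 * (1 + j * h)"
        unfolding Y_def power_mult_distrib using jh by simp
      also have "\<dots> = 2 * pi\<^sup>2 / 3 * (m + j * (m * h))"
        unfolding X2 by (simp add: algebra_simps)
      finally show ?thesis by (simp add: h)
    qed
    have "657 / 100 * (m - 1) \<le> Y\<^sup>2"
      unfolding Y2 using pi2 m j by (intro mult_mono) auto
    then have Y2_ge: "(50 :: real)\<^sup>2 \<le> Y\<^sup>2" "13 / 2 * m \<le> Y\<^sup>2"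
      using m by (auto simp: power2_eq_square)
    have Y: "Y \<ge> 50"
      using Y2_ge(1) X0 jh by (intro power2_le_imp_le[of 50 Y]) (auto simp: Y_def)
    have "(13 / 2 * m)\<^sup>2 \<le> (Y\<^sup>2)\<^sup>2"
      using Y2_ge m by (intro power_mono) auto
    then have "3 / 2 / Y ^ 4 \<le> 3 / 2 / (13 / 2 * m)\<^sup>2"
      using m Y by (intro divide_left_mono) (auto simp: power_mult[symmetric])
    also have "\<dots> \<le> \<eta>"
      unfolding \<eta>_def h_def using m by (simp add: power_mult_distrib power_divide divide_simps)
    finally have e: "3 / 2 / Y ^ 4 \<le> \<eta>" .
    have Yk: "Y\<^sup>2 = 2 * pi\<^sup>2 / 3 * (real k - 1 / 24)"
      unfolding Y2 m_def j(2) by (simp add: algebra_simps)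
    show ?thesis
      using p_relative_error[OF Y Yk e] Y unfolding Y_def[symmetric] by blast
  qed
  define M1 where "M1 = rademacher_main (X * sqrt (1 + h))"
  define M2 where "M2 = rademacher_main (X * sqrt (1 - h))"
  define M0 where "M0 = rademacher_main X"
  define R where "R = M1 * M2 / M0\<^sup>2"
  have k1: "(1 - \<eta>) * M1 \<le> real (p (n + 1)) \<and> real (p (n + 1)) \<le> (1 + \<eta>) * M1 \<and> X * sqrt (1 + h) \<ge> 50"
    using key[of 1 "n + 1"] unfolding M1_def by simp
  have k2: "(1 - \<eta>) * M2 \<le> real (p (n - 1)) \<and> real (p (n - 1)) \<le> (1 + \<eta>) * M2 \<and> X * sqrt (1 - h) \<ge> 50"
    using key[of "-1" "n - 1"] n unfolding M2_def by (simp add: of_nat_diff)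
  have k0: "(1 - \<eta>) * M0 \<le> real (p n) \<and> real (p n) \<le> (1 + \<eta>) * M0 \<and> X \<ge> 50"
    using key[of 0 n] unfolding M0_def by simp
  have b1: "(1 - \<eta>) * M1 \<le> real (p (n + 1))" "real (p (n + 1)) \<le> (1 + \<eta>) * M1" "M1 > 0"
    using k1 rademacher_main_relative_error(1) unfolding M1_def by blast+
  have b2: "(1 - \<eta>) * M2 \<le> real (p (n - 1))" "real (p (n - 1)) \<le> (1 + \<eta>) * M2" "M2 > 0"
    using k2 rademacher_main_relative_error(1) unfolding M2_def by blast+
  have b0: "(1 - \<eta>) * M0 \<le> real (p n)" "real (p n) \<le> (1 + \<eta>) * M0" "M0 > 0" and X50: "X \<ge> 50"
    using k0 rademacher_main_relative_error(1) unfolding M0_def by blast+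
  have R: "R \<le> exp (2 * h\<^sup>2 - X * h\<^sup>2 / 4)" "exp (9 / 10 * h\<^sup>2 - X * h\<^sup>2 / 4 - X * h ^ 4 / 4) \<le> R" "R > 0"
  proof -
    have "h \<le> 1 / 300" using h by simp
    from rademacher_main_ratio_bounds[OF X50 h(1) this]
    show "R \<le> exp (2 * h\<^sup>2 - X * h\<^sup>2 / 4)" "exp (9 / 10 * h\<^sup>2 - X * h\<^sup>2 / 4 - X * h ^ 4 / 4) \<le> R"
      by (simp_all only: R_def M1_def M2_def M0_def)
    show "R > 0"
      unfolding R_def using b0 b1 b2 by simp
  qed
  have e1: "1 + \<eta> \<le> exp \<eta>" by (rule exp_ge_add_one_self)
  have e2: "exp (- 2 * \<eta>) \<le> 1 - \<eta>" using \<eta> by (intro exp_le_one_minus) auto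
  have ratio: "(1 + \<eta>) / (1 - \<eta>) \<le> exp (3 * \<eta>)"
  proof -
    have "(1 + \<eta>) / (1 - \<eta>) \<le> exp \<eta> / exp (- 2 * \<eta>)"
      using e1 e2 \<eta> by (intro frac_le) auto
    also have "\<dots> = exp (3 * \<eta>)" unfolding exp_diff[symmetric] by simp
    finally show ?thesis .
  qed
  have ratio_pos: "0 < (1 + \<eta>) / (1 - \<eta>)" using \<eta> by simp
  have ratio2: "((1 + \<eta>) / (1 - \<eta>))\<^sup>2 \<le> exp (6 * \<eta>)"
  proof -
    have "((1 + \<eta>) / (1 - \<eta>))\<^sup>2 \<le> (exp (3 * \<eta>))\<^sup>2"
      using ratio ratio_pos by (intro power_mono) auto
    also have "\<dots> = exp (6 * \<eta>)" unfolding exp_double[symmetric] by simp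
    finally show ?thesis .
  qed
  have "u n \<le> ((1 + \<eta>) * M1) * ((1 + \<eta>) * M2) / ((1 - \<eta>) * M0)\<^sup>2"
    unfolding u_def using b0 b1 b2 \<eta> by (intro frac_le mult_mono power_mono) auto
  also have "\<dots> = R * ((1 + \<eta>) / (1 - \<eta>))\<^sup>2"
  proof -
    have "(b * M1) * (b * M2) / (c * M0)\<^sup>2 = M1 * M2 / M0\<^sup>2 * (b / c)\<^sup>2" for b c
      by (simp add: power_mult_distrib power_divide power2_eq_square mult_ac)
    then show ?thesis unfolding R_def .
  qed
  also have "\<dots> \<le> exp (2 * h\<^sup>2 - X * h\<^sup>2 / 4) * exp (6 * \<eta>)"
    by (rule mult_mono[OF R(1) ratio2]) simp_all
  also have "\<dots> = exp (2 * h\<^sup>2 - X * h\<^sup>2 / 4 + 6 * \<eta>)" by (rule exp_add[symmetric])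
  also have "\<dots> \<le> exp (9 / 4 * h\<^sup>2 - X * h\<^sup>2 / 4)"
    unfolding exp_le_cancel_iff \<eta>_def using zero_le_power2[of h] by linarith
  finally show "u n \<le> exp (9 / 4 * (1 / m)\<^sup>2 - X * (1 / m)\<^sup>2 / 4)"
    by (simp only: h_def)
  have "exp (13 / 20 * h\<^sup>2 - X * h\<^sup>2 / 4 - X * h ^ 4 / 4) \<le> exp ((9 / 10 * h\<^sup>2 - X * h\<^sup>2 / 4 - X * h ^ 4 / 4) - 6 * \<eta>)"
    unfolding exp_le_cancel_iff \<eta>_def using zero_le_power2[of h] by linarith
  also have "\<dots> = exp (9 / 10 * h\<^sup>2 - X * h\<^sup>2 / 4 - X * h ^ 4 / 4) / exp (6 * \<eta>)"
    by (rule exp_diff)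
  also have "\<dots> \<le> R / ((1 + \<eta>) / (1 - \<eta>))\<^sup>2"
    by (rule frac_le[OF less_imp_le[OF R(3)] R(2) _ ratio2]) (rule zero_less_power[OF ratio_pos])
  also have "\<dots> = ((1 - \<eta>) * M1) * ((1 - \<eta>) * M2) / ((1 + \<eta>) * M0)\<^sup>2"
  proof -
    have "M1 * M2 / M0\<^sup>2 / (b / c)\<^sup>2 = (c * M1) * (c * M2) / (b * M0)\<^sup>2" for b c
      by (simp add: power_mult_distrib power_divide) (simp only: power2_eq_square mult_ac)
    then show ?thesis unfolding R_def .
  qed
  also have "\<dots> \<le> u n"
  proof -
    have "(1 - \<eta>) * M0 > 0" using b0 \<eta> by simp
    then have "real (p n) > 0" using b0(1) by linarith
    then show ?thesis
      unfolding u_def using b0 b1 b2 \<eta> by (intro frac_le mult_mono power_mono) auto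
  qed
  finally show "exp (13 / 20 * (1 / m)\<^sup>2 - X * (1 / m)\<^sup>2 / 4 - X * (1 / m) ^ 4 / 4) \<le> u n"
    by (simp only: h_def)
qed

definition u_eps :: "nat \<Rightarrow> real" where
  "u_eps n = pi / (sqrt 24 * real n powr (3 / 2))"

text \<open>With \<open>n - 1 / 24\<close> in place of \<open>n\<close>, \<open>u_eps n\<close>
  would be exactly the leading decrement \<open>\<sigma> = X * h\<^sup>2 / 4\<close>. So these
  cancel in \<open>u n * (1 + u_eps n)\<close>, and the surplus \<open>13 / 20 * h\<^sup>2\<close>
  has to pay for \<open>e\<^sup>2\<close>, \<open>\<sigma> - e\<close> and
  \<open>X * h ^ 4 / 4\<close>, each at most \<open>h\<^sup>2 / 100\<close>. For
  \<open>u n < 1\<close> it is enough that \<open>X > 9\<close>.\<close>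

lemma u_strict_bounds_large:
  fixes n :: nat
  assumes n: "n \<ge> 385"
  shows "u n < 1" and "1 < u n * (1 + u_eps n)"
proof -
  define m where "m = real n - 1 / 24"
  define X where "X = pi * sqrt (2 / 3 * m)"
  define h where "h = 1 / m"
  define e where "e = u_eps n"
  have m: "m \<ge> 384" using n by (simp add: m_def)
  have h: "0 < h" "h \<le> 1 / 384" "m * h = 1"
    using m by (auto simp: h_def divide_simps)
  have X2: "X\<^sup>2 = 2 * pi\<^sup>2 / 3 * m"
    using m by (simp add: X_def power_mult_distrib)
  have X0: "X > 0" using m by (simp add: X_def)
  define t where "t = X * h"
  have t0: "t > 0" using X0 h by (simp add: t_def)
  have "t\<^sup>2 = 2 * pi\<^sup>2 / 3 * h"
  proof -
    have "t\<^sup>2 = 2 * pi\<^sup>2 / 3 * (m * h) * h"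
      unfolding t_def power_mult_distrib X2 by (simp add: power2_eq_square)
    then show ?thesis by (simp add: h)
  qed
  also have "\<dots> \<le> 2 * (32 / 10)\<^sup>2 / 3 * (1 / 384)"
    using h pi_approx by (intro mult_mono divide_right_mono mult_left_mono power_mono) auto
  also have "\<dots> \<le> (7 / 50)\<^sup>2" by (simp add: power2_eq_square)
  finally have t: "t \<le> 7 / 50"
    by (rule power2_le_imp_le) simp
  have X9: "X > 9"
  proof -
    have "3\<^sup>2 \<le> pi\<^sup>2" using pi_approx by (intro power_mono) auto
    then have "2 * 9 / 3 * 384 \<le> X\<^sup>2"
      unfolding X2 using m by (intro mult_mono divide_right_mono) auto
    then have "10\<^sup>2 \<le> X\<^sup>2" by simp
    then have "10 \<le> X" by (rule power2_le_imp_le) (use X0 in simp)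
    then show ?thesis by simp
  qed
  have ub: "u n \<le> exp (9 / 4 * h\<^sup>2 - X * h\<^sup>2 / 4)"
    and lb: "exp (13 / 20 * h\<^sup>2 - X * h\<^sup>2 / 4 - X * h ^ 4 / 4) \<le> u n"
    using u_bounds_large[OF n] unfolding h_def X_def m_def by blast+
  have "9 / 4 * h\<^sup>2 - X * h\<^sup>2 / 4 < 0"
    using X9 h by simp
  then show "u n < 1"
    using ub by (auto intro: le_less_trans)
  define \<sigma> where "\<sigma> = X * h\<^sup>2 / 4"
  have \<sigma>: "\<sigma> = t * h / 4" "0 < \<sigma>"
    using X0 h by (auto simp: \<sigma>_def t_def power2_eq_square)
  define y where "y = m / real n"
  have n0: "real n > 0" using n by simp
  have y: "0 < y" "y \<le> 1"
    using m n0 by (auto simp: y_def m_def)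
  have e_eq: "e = \<sigma> * y powr (3 / 2)"
  proof -
    have "sqrt 24 = 4 * sqrt (3 / 2)"
      using real_sqrt_mult[of 16 "3 / 2"] by simp
    moreover have "m powr (3 / 2) = m * sqrt m"
      using m powr_add[of m 1 "1 / 2"] by (simp add: powr_half_sqrt)
    moreover have "sqrt (2 / 3 * m) = sqrt m / sqrt (3 / 2)"
      by (simp add: real_sqrt_divide[symmetric])
    moreover have "y powr (3 / 2) = m powr (3 / 2) / real n powr (3 / 2)"
      unfolding y_def by (rule powr_divide)
    ultimately show ?thesis
      using m by (simp add: e_def u_eps_def \<sigma>_def X_def h_def power2_eq_square)
  qed
  have "y powr 2 \<le> y powr (3 / 2)"
    using y by (intro powr_mono') auto
  then have "y\<^sup>2 \<le> y powr (3 / 2)"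
    using y by (simp add: powr_realpow)
  moreover have "1 - h / 12 \<le> y\<^sup>2"
  proof -
    have "y = 1 - 1 / (24 * real n)"
      using n0 by (simp add: y_def m_def field_simps)
    moreover have "1 / real n \<le> h"
      unfolding h_def using m by (intro divide_left_mono) (auto simp: m_def)
    ultimately have "1 - h / 24 \<le> y" by simp
    then have "(1 - h / 24)\<^sup>2 \<le> y\<^sup>2"
      using h by (intro power_mono) auto
    moreover have "(1 - h / 24)\<^sup>2 = 1 - h / 12 + (h / 24)\<^sup>2"
      by (simp add: power2_eq_square algebra_simps)
    ultimately show ?thesis
      using zero_le_power2[of "h / 24"] by linarith
  qed
  ultimately have "\<sigma> * (1 - h / 12) \<le> e"
    unfolding e_eq using \<sigma> by (intro mult_left_mono) auto
  moreover have "y powr (3 / 2) \<le> 1"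
    using y by (intro powr_le1) auto
  then have e_le: "e \<le> \<sigma>" "0 \<le> e"
    unfolding e_eq using \<sigma>(2) mult_left_mono[of "y powr (3 / 2)" 1 \<sigma>] by auto
  ultimately have e: "\<sigma> - \<sigma> * h / 12 \<le> e" "e \<le> \<sigma>" "0 \<le> e"
    by (simp_all add: right_diff_distrib)
  have th: "t * h \<le> 7 / 50 * (1 / 384)"
    using t t0 h by (intro mult_mono) auto
  have "e\<^sup>2 \<le> \<sigma>\<^sup>2" using e by (intro power_mono) auto
  also have "\<sigma>\<^sup>2 = h\<^sup>2 * (t * t / 16)"
    by (simp add: \<sigma>(1) power2_eq_square)
  also have "\<dots> \<le> h\<^sup>2 * (1 / 100)"
    using mult_mono[OF t t] t0 by (intro mult_left_mono) auto
  finally have e2: "e\<^sup>2 \<le> h\<^sup>2 * (1 / 100)" .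
  have "\<sigma> * h / 12 = h\<^sup>2 * (t / 48)"
    by (simp add: \<sigma>(1) power2_eq_square)
  also have "\<dots> \<le> h\<^sup>2 * (1 / 100)"
    using t by (intro mult_left_mono) auto
  finally have e3: "\<sigma> * h / 12 \<le> h\<^sup>2 * (1 / 100)" .
  have "X * h ^ 4 / 4 = h\<^sup>2 * (t * h / 4)"
    by (simp add: t_def power2_eq_square eval_nat_numeral)
  also have "\<dots> \<le> h\<^sup>2 * (1 / 100)"
    by (intro mult_left_mono, use th in linarith, simp)
  finally have e4: "X * h ^ 4 / 4 \<le> h\<^sup>2 * (1 / 100)" .
  have hp: "h\<^sup>2 > 0" using h by simp
  have "0 < (13 / 20 * h\<^sup>2 - \<sigma> - X * h ^ 4 / 4) + (e - e\<^sup>2)"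
    using e(1) e2 e3 e4 hp by linarith
  then have "1 < exp (13 / 20 * h\<^sup>2 - \<sigma> - X * h ^ 4 / 4) * exp (e - e\<^sup>2)"
    by (simp flip: exp_add)
  also have "\<dots> \<le> u n * (1 + e)"
  proof (intro mult_mono)
    have "e \<le> 1" using e th \<sigma> by simp
    then show "exp (e - e\<^sup>2) \<le> 1 + e"
      using e by (intro exp_le_one_plus) auto
    show "0 \<le> u n"
      by (simp add: u_def)
  qed (use lb in \<open>simp_all add: \<sigma>_def\<close>)
  finally show "1 < u n * (1 + u_eps n)"
    by (simp add: e_def)
qed

section \<open>The pentagonal recurrence and the remaining cases\<close>

text \<open>The pentagonal numbers \<open>s * (3 * s - 1) / 2\<close>; the second family
  \<open>s * (3 * s + 1) / 2\<close> appears as \<open>pent s + s\<close>.\<close>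

fun pent :: "nat \<Rightarrow> nat" where
  "pent 0 = 0"
| "pent (Suc s) = pent s + 3 * s + 1"

fun triangular :: "nat \<Rightarrow> nat" where
  "triangular 0 = 0"
| "triangular (Suc s) = triangular s + Suc s"

lemma pent_Suc_eq: "pent (Suc n) = Suc n * Suc n + triangular n"
  by (induction n) simp_all

lemma pent_mono: "s \<le> t \<Longrightarrow> pent s \<le> pent t"
  by (rule lift_Suc_mono_le) simp_all

definition euler_prod :: "nat \<Rightarrow> nat \<Rightarrow> int fps" where
  "euler_prod s n = (\<Prod>j\<in>{s<..n}. 1 - fps_X ^ j)"

lemma euler_prod_Suc_right: "s \<le> n \<Longrightarrow> euler_prod s (Suc n) = euler_prod s n * (1 - fps_X ^ Suc n)"
proof -
  assume "s \<le> n"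
  then have "{s<..Suc n} = insert (Suc n) {s<..n}" by auto
  then show ?thesis by (simp add: euler_prod_def)
qed

lemma euler_prod_Suc_left: "s < n \<Longrightarrow> euler_prod s n = (1 - fps_X ^ Suc s) * euler_prod (Suc s) n"
proof -
  assume "s < n"
  then have "{s<..n} = insert (Suc s) {Suc s<..n}" by auto
  then show ?thesis by (simp add: euler_prod_def)
qed

lemma euler_prod_self [simp]: "euler_prod n n = 1"
  by (simp add: euler_prod_def)

text \<open>Shanks' finite form of Euler's pentagonal number theorem.\<close>

lemma shanks_identity:
  "(\<Sum>s\<le>n. (-1) ^ s * euler_prod s n * fps_X ^ (s * n + triangular s)) =
    1 + (\<Sum>s=1..n. (-1) ^ s * (fps_X ^ pent s + fps_X ^ (pent s + s)))"
proof (induction n)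
  case (Suc n)
  define N where "N = Suc n"
  define t where "t = (\<lambda>n s. (-1) ^ s * euler_prod s n * fps_X ^ (s * n + triangular s) :: int fps)"
  \<comment> \<open>Raising \<open>n\<close> to \<open>N\<close> changes summand \<open>s\<close> by
    \<open>c (s - 1) - c s\<close> (only \<open>- c 0\<close> for \<open>s = 0\<close>). After
    telescoping, \<open>- c n\<close> and the new summand \<open>t N N\<close> are the two new
    pentagonal powers.\<close>
  define c where "c = (\<lambda>s. (-1) ^ s * euler_prod s n * fps_X ^ (Suc s * N + triangular s) :: int fps)"
  define c' where "c' = (\<lambda>s. case s of 0 \<Rightarrow> 0 | Suc r \<Rightarrow> c r)"
  have diff: "t N s = t n s + (c' s - c s)" if "s \<le> n" for s
  proof -
    have c's: "c' s = - ((-1) ^ s * euler_prod s n * (1 - fps_X ^ s) * fps_X ^ (s * n + triangular s))"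
    proof (cases s)
      case 0
      then show ?thesis by (simp add: c'_def)
    next
      case (Suc r)
      then have "euler_prod r n = (1 - fps_X ^ s) * euler_prod s n"
        using that euler_prod_Suc_left[of r n] by simp
      moreover have "Suc r * N + triangular r = s * n + triangular s"
        using Suc by (simp add: N_def)
      ultimately show ?thesis
        using Suc by (simp add: c'_def c_def mult_ac)
    qed
    have "t N s = (-1) ^ s * (euler_prod s n * (1 - fps_X ^ N)) * (fps_X ^ s * fps_X ^ (s * n + triangular s))"
      using euler_prod_Suc_right[OF that] by (simp add: t_def N_def power_add mult_ac)
    moreover have "c s = (-1) ^ s * euler_prod s n * (fps_X ^ N * fps_X ^ s * fps_X ^ (s * n + triangular s))"
      by (simp add: c_def N_def power_add mult_ac)
    ultimately show ?thesis
      unfolding c's t_def by (simp add: algebra_simps)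
  qed
  have telescope: "(\<Sum>s\<le>k. c' s - c s) = - c k" for k
    by (induction k) (simp_all add: c'_def)
  have "(\<Sum>s\<le>N. t N s) = (\<Sum>s\<le>n. t n s + (c' s - c s)) + t N N"
    using diff by (simp add: N_def)
  also have "\<dots> = (\<Sum>s\<le>n. t n s) - c n + t N N"
    by (simp add: sum.distrib telescope)
  also have "t N N = (-1) ^ N * fps_X ^ (pent N + N)"
    using pent_Suc_eq[of n] by (simp add: t_def N_def algebra_simps)
  also have "c n = - ((-1) ^ N * fps_X ^ pent N)"
    using pent_Suc_eq[of n] by (simp add: c_def N_def)
  also have "(\<Sum>s\<le>n. t n s) = 1 + (\<Sum>s=1..n. (-1) ^ s * (fps_X ^ pent s + fps_X ^ (pent s + s)))"
    using Suc unfolding t_def .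
  finally show ?case
    unfolding N_def t_def by (simp add: algebra_simps)
qed (simp add: euler_prod_def)

definition bounded_p_fps :: "nat \<Rightarrow> int fps" where
  "bounded_p_fps k = Abs_fps (\<lambda>n. int (bounded_p k n))"

lemma euler_prod_bounded_p: "euler_prod 0 k * bounded_p_fps k = 1"
proof (induction k)
  case 0
  show ?case
    by (rule fps_ext) (simp add: bounded_p_fps_def bounded_p_0 fps_one_nth)
next
  case (Suc k)
  have "(1 - fps_X ^ Suc k) * bounded_p_fps (Suc k) = bounded_p_fps k"
  proof (rule fps_ext)
    fix n
    show "fps_nth ((1 - fps_X ^ Suc k) * bounded_p_fps (Suc k)) n = fps_nth (bounded_p_fps k) n"
      unfolding left_diff_distrib mult_1_left fps_sub_nth fps_X_power_mult_nth
      by (simp add: bounded_p_fps_def bounded_p_Suc[of k n])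
  qed
  then show ?case
    using Suc by (simp add: euler_prod_Suc_right mult.assoc)
qed

lemma fps_mult_nth_eq_0:
  fixes f g :: "int fps"
  assumes "\<And>i. i \<le> m \<Longrightarrow> fps_nth f i = 0"
  shows "fps_nth (f * g) m = 0"
  using assms by (simp add: fps_mult_nth)

text \<open>Up to degree \<open>m\<close> only the summand \<open>s = 0\<close> on the left of
  Shanks' identity is visible, the others starting beyond degree \<open>n\<close>; likewise
  pentagonal terms with \<open>s > k\<close> start beyond \<open>m\<close>. What is left is
  \<open>euler_prod 0 n\<close>, the inverse of \<open>bounded_p_fps n\<close>.\<close>

lemma pentagonal_mult_bounded_p:
  assumes "1 \<le> m" "m \<le> n" "m < pent (Suc k)" "k \<le> n"
  shows "fps_nth ((1 + (\<Sum>s=1..k. (-1) ^ s * (fps_X ^ pent s + fps_X ^ (pent s + s)))) * bounded_p_fps n) m = 0"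
proof -
  define a where "a = (\<lambda>s. (-1) ^ s * (fps_X ^ pent s + fps_X ^ (pent s + s)) :: int fps)"
  define R where "R = (\<Sum>s\<in>{k<..n}. a s)"
  define Q where "Q = (\<Sum>s=1..n. (-1) ^ s * euler_prod s n * fps_X ^ (s * n + triangular s))"
  have R: "fps_nth R i = 0" if "i \<le> m" for i
  proof -
    have "fps_nth (a s) i = 0" if s: "s \<in> {k<..n}" for s
    proof -
      have "pent (Suc k) \<le> pent s" using s by (intro pent_mono) auto
      then have "i < pent s" using \<open>i \<le> m\<close> assms by simp
      then show ?thesis
        unfolding a_def by (cases "even s") (simp_all add: fps_X_power_nth)
    qed
    then show ?thesis by (simp add: R_def fps_sum_nth)
  qed
  have Q: "fps_nth Q i = 0" if "i \<le> m" for i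
  proof -
    have "fps_nth ((-1) ^ s * euler_prod s n * fps_X ^ (s * n + triangular s)) i = 0" if s: "s \<in> {1..n}" for s
    proof -
      have "1 * n + 1 \<le> s * n + triangular s"
        using s by (intro add_mono mult_right_mono) (cases s; simp)+
      then show ?thesis
        using \<open>i \<le> m\<close> assms by (simp add: fps_X_power_mult_right_nth)
    qed
    then show ?thesis by (simp add: Q_def fps_sum_nth)
  qed
  have "(\<Sum>s\<le>n. (-1) ^ s * euler_prod s n * fps_X ^ (s * n + triangular s)) = euler_prod 0 n + Q"
    unfolding Q_def by (simp add: sum.atMost_shift sum.atLeast1_atMost_eq lessThan_Suc_atMost[symmetric] sum.lessThan_Suc_shift del: sum.lessThan_Suc)
  moreover have "(\<Sum>s=1..n. a s) = (\<Sum>s=1..k. a s) + R"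
  proof -
    have "{1..n} = {1..k} \<union> {k<..n}" using assms by auto
    then show ?thesis
      unfolding R_def by (simp only:) (rule sum.union_disjoint; auto)
  qed
  ultimately have "1 + (\<Sum>s=1..k. a s) = euler_prod 0 n + (Q - R)"
    using shanks_identity[of n] unfolding a_def by (simp add: algebra_simps)
  then have "fps_nth ((1 + (\<Sum>s=1..k. a s)) * bounded_p_fps n) m = fps_nth (1 + (Q - R) * bounded_p_fps n) m"
    by (simp only: distrib_right euler_prod_bounded_p)
  also have "\<dots> = 0"
    using assms R Q by (simp add: fps_mult_nth_eq_0)
  finally show ?thesis by (simp only: a_def)
qed

section \<open>The pentagonal recurrence as a computation on lists\<close>

fun fps_of_list :: "int list \<Rightarrow> int fps" where
  "fps_of_list [] = 0"
| "fps_of_list (a # as) = fps_const a + fps_X * fps_of_list as"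

text \<open>Stopping at the shorter list implements the convention that \<open>p\<close> vanishes at
  negative indices: surplus weights are ignored.\<close>

fun dot :: "int list \<Rightarrow> int list \<Rightarrow> int" where
  "dot (a # as) (b # bs) = a * b + dot as bs"
| "dot [] bs = 0"
| "dot as [] = 0"

lemma fps_of_list_mult_nth: "fps_nth (fps_of_list as * g) k = dot as (map (\<lambda>i. fps_nth g i) (rev [0..<Suc k]))"
proof (induction as arbitrary: k)
  case (Cons a as)
  have "fps_nth (fps_X * fps_of_list as * g) k = (if k = 0 then 0 else fps_nth (fps_of_list as * g) (k - 1))"
    by (simp only: mult.assoc fps_X_mult_nth)
  also have "\<dots> = dot as (map (\<lambda>i. fps_nth g i) (rev [0..<k]))"
    using Cons[of "k - 1"] by (cases as; cases k) simp_all
  finally show ?case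
    by (simp add: distrib_right)
qed simp

text \<open>Weights of the recurrence, starting at offset \<open>pent (Suc t)\<close>. With
  \<open>s = Suc t\<close>, the exponents \<open>pent s\<close>, \<open>pent s + s\<close> and
  \<open>pent (Suc s)\<close> have \<open>s - 1\<close> and then \<open>2 * s\<close> integers
  strictly between them, hence the blocks of zeros.\<close>

fun pent_weights :: "int \<Rightarrow> nat \<Rightarrow> nat \<Rightarrow> int list" where
  "pent_weights c t 0 = []"
| "pent_weights c t (Suc k) = c # replicate t 0 @ c # replicate (2 * Suc t) 0 @ pent_weights (- c) (Suc t) k"

lemma fps_of_list_replicate_append: "fps_of_list (replicate z 0 @ as) = fps_X ^ z * fps_of_list as"
  by (induction z) (simp_all add: mult.assoc)

lemma fps_of_list_pent_weights:
  "fps_X ^ pent (Suc t) * fps_of_list (pent_weights c t k) =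
    fps_const c * (\<Sum>s<k. (-1) ^ s * (fps_X ^ pent (Suc (t + s)) + fps_X ^ (pent (Suc (t + s)) + Suc (t + s))))"
proof (induction k arbitrary: c t)
  case (Suc k)
  define F where "F = (\<lambda>s. fps_X ^ pent (Suc (t + s)) + fps_X ^ (pent (Suc (t + s)) + Suc (t + s)) :: int fps)"
  have "fps_X ^ pent (Suc t) * fps_of_list (pent_weights c t (Suc k)) =
      fps_const c * F 0 + fps_X ^ pent (Suc (Suc t)) * fps_of_list (pent_weights (- c) (Suc t) k)"
    by (simp add: F_def fps_of_list_replicate_append algebra_simps power_add)
      (simp add: numeral_eq_Suc algebra_simps power_add)
  also have "fps_X ^ pent (Suc (Suc t)) * fps_of_list (pent_weights (- c) (Suc t) k) =
      fps_const (- c) * (\<Sum>s<k. (-1) ^ s * F (Suc s))"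
    unfolding Suc.IH F_def by (simp only: add_Suc add_Suc_right)
  also have "fps_const c * F 0 + fps_const (- c) * (\<Sum>s<k. (-1) ^ s * F (Suc s)) =
      fps_const c * (\<Sum>s<Suc k. (-1) ^ s * F s)"
    unfolding sum.lessThan_Suc_shift by (simp add: distrib_left right_diff_distrib sum_negf flip: fps_const_neg)
  finally show ?case
    by (simp only: F_def)
qed simp

lemma p_pentagonal_recurrence:
  assumes "Suc m < pent (Suc k)"
  shows "int (p (Suc m)) = dot (pent_weights 1 0 k) (map (\<lambda>i. int (p i)) (rev [0..<Suc m]))"
proof -
  \<comment> \<open>Large enough that \<open>bounded_p n\<close> equals \<open>p\<close> up to
    \<open>Suc m\<close> and that all \<open>k\<close> pairs of weights lie within Shanks'
    sum.\<close>
  define n where "n = max (Suc m) k"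
  define W where "W = fps_of_list (pent_weights 1 0 k)"
  have "fps_X * W = - (\<Sum>s=1..k. (-1) ^ s * (fps_X ^ pent s + fps_X ^ (pent s + s)))"
    using fps_of_list_pent_weights[of 0 1 k]
    by (simp add: W_def sum.atLeast1_atMost_eq sum_negf)
  then have "1 + (\<Sum>s=1..k. (-1) ^ s * (fps_X ^ pent s + fps_X ^ (pent s + s))) = 1 - fps_X * W"
    by simp
  then have "fps_nth ((1 - fps_X * W) * bounded_p_fps n) (Suc m) = 0"
    using pentagonal_mult_bounded_p[of "Suc m" n k] assms by (simp add: n_def)
  then have "fps_nth (bounded_p_fps n) (Suc m) = fps_nth (W * bounded_p_fps n) m"
    by (simp add: left_diff_distrib mult.assoc)
  then have "int (bounded_p n (Suc m)) = dot (pent_weights 1 0 k) (map (\<lambda>i. int (bounded_p n i)) (rev [0..<Suc m]))"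
    unfolding W_def fps_of_list_mult_nth bounded_p_fps_def fps_nth_Abs_fps .
  moreover have "map (\<lambda>i. int (bounded_p n i)) (rev [0..<Suc m]) = map (\<lambda>i. int (p i)) (rev [0..<Suc m])"
    by (intro map_cong) (auto simp: bounded_p_eq_p n_def)
  ultimately show ?thesis
    by (simp only: bounded_p_eq_p n_def max.cobounded1)
qed

text \<open>The newest value comes first, in the order of the weights, so that one
  \<open>dot\<close> yields the next value.\<close>

fun extend_p :: "int list \<Rightarrow> nat \<Rightarrow> int list \<Rightarrow> int list" where
  "extend_p w 0 ps = ps"
| "extend_p w (Suc j) ps = extend_p w j (dot w ps # ps)"

definition p_list :: "nat \<Rightarrow> nat \<Rightarrow> int list" where
  "p_list k N = rev (extend_p (pent_weights 1 0 k) N [1])"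

lemma p_list_eq:
  assumes "N < pent (Suc k)"
  shows "p_list k N = map (\<lambda>n. int (p n)) [0..<Suc N]"
proof -
  have "m + j < pent (Suc k) \<Longrightarrow> extend_p (pent_weights 1 0 k) j (map (\<lambda>n. int (p n)) (rev [0..<Suc m])) =
      map (\<lambda>n. int (p n)) (rev [0..<Suc (m + j)])" for m j
  proof (induction j arbitrary: m)
    case (Suc j)
    then have "dot (pent_weights 1 0 k) (map (\<lambda>n. int (p n)) (rev [0..<Suc m])) = int (p (Suc m))"
      by (intro p_pentagonal_recurrence[symmetric]) simp
    then show ?case
      using Suc.IH[of "Suc m"] Suc.prems by simp
  qed simp
  from this[of 0 N] show ?thesis
    using assms by (simp add: p_list_def p_0 rev_map)
qed

section \<open>Integer tests for \<open>n < 385\<close>\<close>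

fun check_small :: "int list \<Rightarrow> bool" where
  "check_small (a # b # c # d # xs) \<longleftrightarrow>
    4 * (b * b - a * c) * (c * c - b * d) < (b * c - a * d)\<^sup>2 \<and> check_small (b # c # d # xs)"
| "check_small _ \<longleftrightarrow> True"

text \<open>
  Fixed-point arithmetic: \<open>s\<close> and \<open>r\<close> are the ratios \<open>p n / p (n - 1)\<close> and \<open>p (n + 1) / p n\<close>,
  scaled by \<open>2 ^ 20\<close> and rounded down, and \<open>41123 / 100000\<close> is below \<open>pi\<^sup>2 / 24\<close>.
\<close>

fun check_large :: "int \<Rightarrow> int \<Rightarrow> int list \<Rightarrow> bool" and check_ratio :: "int \<Rightarrow> int \<Rightarrow> int \<Rightarrow> int list \<Rightarrow> bool" where
  "check_large n s (b # c # xs) \<longleftrightarrow> check_ratio n s (1048576 * c div b) (c # xs)"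
| "check_large n s _ \<longleftrightarrow> True"
| "check_ratio n s r xs \<longleftrightarrow> r + 1 \<le> s \<and> (s + 1 - r)\<^sup>2 * n ^ 3 * 100000 < 41123 * r\<^sup>2 \<and> check_large (n + 1) r xs"

lemma check_small_nth:
  "check_small xs \<Longrightarrow> i + 3 < length xs \<Longrightarrow>
    4 * ((xs ! (i + 1))\<^sup>2 - xs ! i * xs ! (i + 2)) * ((xs ! (i + 2))\<^sup>2 - xs ! (i + 1) * xs ! (i + 3)) <
    (xs ! (i + 1) * xs ! (i + 2) - xs ! i * xs ! (i + 3))\<^sup>2"
proof (induction xs arbitrary: i rule: check_small.induct)
  case (1 a b c d xs)
  show ?case
  proof (cases i)
    case 0
    then show ?thesis using 1 by (simp add: power2_eq_square eval_nat_numeral)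
  next
    case (Suc j)
    then show ?thesis using 1(1)[of j] 1(2,3) by simp
  qed
qed auto

lemma check_large_nth:
  assumes "check_large n s xs" "i + 1 < length xs"
  defines "r \<equiv> \<lambda>i. 1048576 * xs ! (i + 1) div xs ! i"
  defines "s' \<equiv> if i = 0 then s else r (i - 1)"
  shows "r i + 1 \<le> s' \<and> (s' + 1 - r i)\<^sup>2 * (n + int i) ^ 3 * 100000 < 41123 * (r i)\<^sup>2"
  using assms(1,2) unfolding r_def s'_def
proof (induction i arbitrary: n s xs)
  case 0
  then obtain b c ys where "xs = b # c # ys"
    by (cases xs rule: remdups_adj.cases) auto
  with 0 show ?case by simp
next
  case (Suc i)
  then obtain b c ys where xs: "xs = b # c # ys"
    by (cases xs rule: remdups_adj.cases) auto
  with Suc.prems have "check_large (n + 1) (1048576 * c div b) (c # ys)" "i + 1 < length (c # ys)"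
    by auto
  from Suc.IH[OF this] show ?case
    by (cases i) (simp_all add: xs algebra_simps)
qed

text \<open>The test is the inequality multiplied by
  \<open>(p n)\<^sup>2 * (p (n + 1))\<^sup>2\<close>, without the factor \<open>1 + u_eps n\<close>,
  hence stronger and purely integral. Since \<open>tl\<close> removes \<open>p 0\<close>, the
  windows of four entries run through \<open>n = 2\<close> to \<open>n = 44\<close>.\<close>

lemma check_small_p: "check_small (take 46 (tl (p_list 6 46)))"
  by code_simp

lemma p_list_6: "p_list 6 46 = map (\<lambda>n. int (p n)) [0..<47]"
proof -
  have "46 < pent (Suc 6)"
    by code_simp
  then show ?thesis
    using p_list_eq[of 46 6] by (simp del: upt_Suc)
qed

lemma p_list_16: "p_list 16 385 = map (\<lambda>n. int (p n)) [0..<386]"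
proof -
  have "385 < pent (Suc 16)"
    by code_simp
  then show ?thesis
    using p_list_eq[of 385 16] by (simp del: upt_Suc)
qed

text \<open>The first two entries, \<open>p 44\<close> and \<open>p 45\<close> in the application,
  only supply the initial previous ratio; the tests themselves begin at
  \<open>n = 45\<close>.\<close>

definition check_p :: "int list \<Rightarrow> bool" where
  "check_p xs \<longleftrightarrow> (case xs of b # c # ys \<Rightarrow> check_large 45 (1048576 * c div b) (c # ys) | _ \<Rightarrow> False)"

lemma check_large_p: "check_p (drop 44 (p_list 16 385))"
  by code_simp

lemma p_pos: "p n > 0"
proof -
  have "replicate_mset n 1 \<in> partitions n"
    by (auto simp: partitions_def sum_mset_replicate_mset)
  then show ?thesis
    using finite_partitions[of n] by (auto simp: p_def card_gt_0_iff)
qed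

text \<open>\<open>u n\<close> is the quotient of the successive ratios \<open>R n\<close> and
  \<open>R (n - 1)\<close>. With \<open>a\<close> and \<open>s\<close> their rounded values,
  \<open>R n < a + 1 \<le> s \<le> R (n - 1)\<close> gives the upper bound. For the lower one,
  \<open>R (n - 1) < s + 1 < a * (1 + u_eps n)\<close>, where the last step is tested after
  squaring, which removes the half-integral power of \<open>n\<close>.\<close>

lemma u_strict_bounds_medium:
  fixes n :: nat
  assumes n: "45 \<le> n" "n < 385"
  shows "u n < 1" and "1 < u n * (1 + u_eps n)"
proof -
  define xs where "xs = drop 44 (p_list 16 385)"
  have len: "length xs = 342"
    by (simp add: xs_def p_list_16 del: upt_Suc)
  have nth: "xs ! i = int (p (44 + i))" if "i < 342" for i
    using that by (simp add: xs_def p_list_16 del: upt_Suc)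
  obtain b c ys where xs: "xs = b # c # ys"
    using len by (cases xs rule: remdups_adj.cases) auto
  define i where "i = n - 45"
  have i: "n = 45 + i" "i + 1 < length (c # ys)"
    using n len by (auto simp: i_def xs)
  define r where "r = (\<lambda>j. 1048576 * int (p (j + 1)) div int (p j))"
  have "check_large 45 (1048576 * c div b) (c # ys)"
    using check_large_p unfolding xs_def[symmetric] xs by (simp add: check_p_def)
  note check = check_large_nth[OF this i(2)]
  have ys: "(c # ys) ! j = int (p (45 + j))" if "j < 341" for j
    using nth[of "Suc j"] that by (simp add: xs add_ac)
  have bc: "b = int (p 44)" "c = int (p 45)"
    using nth[of 0] nth[of 1] by (simp_all add: xs)
  have i340: "i < 340" using n by (simp add: i_def)
  have prev: "(if i = 0 then 1048576 * c div b else 1048576 * (c # ys) ! (i - 1 + 1) div (c # ys) ! (i - 1)) = r (n - 1)"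
  proof (cases "i = 0")
    case True
    then show ?thesis by (simp add: r_def i(1) bc)
  next
    case False
    then obtain j where j: "i = Suc j" by (cases i) auto
    have y: "(c # ys) ! j = int (p (45 + j))" "(c # ys) ! (j + 1) = int (p (45 + (j + 1)))"
      using i340 j by (intro ys, simp)+
    have "i - 1 = j" "n - 1 = 45 + j"
      using i(1) j by auto
    then show ?thesis
      using False by (simp only: r_def if_False y add.assoc)
  qed
  have y: "(c # ys) ! i = int (p (45 + i))" "(c # ys) ! (i + 1) = int (p (45 + (i + 1)))"
    using i340 by (intro ys, simp)+
  have cur: "1048576 * (c # ys) ! (i + 1) div (c # ys) ! i = r n"
    by (simp only: r_def y i(1) add.assoc)
  have check': "r n + 1 \<le> r (n - 1)" "(r (n - 1) + 1 - r n)\<^sup>2 * int n ^ 3 * 100000 < 41123 * (r n)\<^sup>2"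
    using check unfolding prev cur i(1) by simp_all
  define R where "R = (\<lambda>j. 1048576 * (real (p (j + 1)) / real (p j)))"
  have r_bounds: "real_of_int (r j) \<le> R j" "R j < real_of_int (r j) + 1" for j
  proof -
    have eq: "r j = \<lfloor>R j\<rfloor>"
      unfolding r_def R_def using floor_divide_of_int_eq[where ?'a = real, of "1048576 * int (p (j + 1))" "int (p j)"] by simp
    show "real_of_int (r j) \<le> R j" "R j < real_of_int (r j) + 1"
      unfolding eq using floor_correct[of "R j"] by simp_all
  qed
  define a where "a = real_of_int (r n)"
  define s where "s = real_of_int (r (n - 1))"
  have as: "a + 1 \<le> s" "(s + 1 - a)\<^sup>2 * real n ^ 3 * 100000 < 41123 * a\<^sup>2"
  proof -
    show "a + 1 \<le> s"
      using check'(1) unfolding a_def s_def by linarith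
    have "real_of_int ((r (n - 1) + 1 - r n)\<^sup>2 * int n ^ 3 * 100000) < real_of_int (41123 * (r n)\<^sup>2)"
      using check'(2) by (simp only: of_int_less_iff)
    then show "(s + 1 - a)\<^sup>2 * real n ^ 3 * 100000 < 41123 * a\<^sup>2"
      by (simp add: a_def s_def)
  qed
  have u_eq: "u n = R n / R (n - 1)"
    using n p_pos[of n] by (simp add: u_def R_def power2_eq_square)
  have a0: "a \<ge> 0"
    unfolding a_def r_def by (simp add: pos_imp_zdiv_nonneg_iff p_pos)
  have Rn: "a \<le> R n" "R n < a + 1" "s \<le> R (n - 1)" "R (n - 1) < s + 1"
    using r_bounds unfolding a_def s_def by auto
  have "R n < R (n - 1)" "R (n - 1) > 0" using Rn as a0 by linarith+
  then show "u n < 1" by (simp add: u_eq)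
  have a_pos: "a > 0"
  proof (rule ccontr)
    assume "\<not> a > 0"
    then have "a = 0" using a0 by simp
    then show False using as(2) by (simp add: mult_less_0_iff)
  qed
  define e where "e = u_eps n"
  have e: "e > 0" "e\<^sup>2 = pi\<^sup>2 / (24 * real n ^ 3)"
  proof -
    show "e > 0" using n by (simp add: e_def u_eps_def)
    have "(real n powr (3 / 2))\<^sup>2 = real n powr (3 / 2 + 3 / 2)"
      unfolding power2_eq_square powr_add ..
    also have "\<dots> = real n ^ 3"
      using n powr_realpow[of "real n" 3] by simp
    finally show "e\<^sup>2 = pi\<^sup>2 / (24 * real n ^ 3)"
      by (simp add: e_def u_eps_def power_divide power_mult_distrib)
  qed
  have "s + 1 - a < e * a"
  proof (rule power2_less_imp_less)
    have "314159 / 100000 \<le> pi"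
      using pi_approx(1) by simp
    then have "(314159 / 100000)\<^sup>2 \<le> pi\<^sup>2" by (intro power_mono) auto
    then have pi2: "41123 / 100000 \<le> pi\<^sup>2 / 24" by (simp add: power2_eq_square)
    have n3: "real n ^ 3 > 0" using n by simp
    have "(s + 1 - a)\<^sup>2 * real n ^ 3 < 41123 / 100000 * a\<^sup>2"
      using as(2) by simp
    also have "\<dots> \<le> pi\<^sup>2 / 24 * a\<^sup>2"
      using pi2 by (intro mult_right_mono) auto
    finally have "(s + 1 - a)\<^sup>2 < pi\<^sup>2 / 24 * a\<^sup>2 / real n ^ 3"
      using n3 by (simp add: less_divide_eq)
    then show "(s + 1 - a)\<^sup>2 < (e * a)\<^sup>2"
      by (simp add: power_mult_distrib e(2))
    show "0 \<le> e * a" using e a_pos by simp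
  qed
  then have "R (n - 1) < a * (1 + e)"
    using Rn by (simp add: algebra_simps)
  also have "\<dots> \<le> R n * (1 + e)"
    using Rn e by (intro mult_right_mono) auto
  finally show "1 < u n * (1 + u_eps n)"
    using \<open>R (n - 1) > 0\<close> by (simp add: u_eq e_def)
qed

lemma u_small:
  fixes n :: nat
  assumes n: "2 \<le> n" "n < 45"
  shows "4 * (1 - u n) * (1 - u (n + 1)) < (1 - u n * u (n + 1))\<^sup>2"
proof -
  define xs where "xs = take 46 (tl (p_list 6 46))"
  have len: "length xs = 46"
    by (simp add: xs_def p_list_6 del: upt_Suc)
  have nth: "xs ! i = int (p (Suc i))" if "i < 46" for i
    using that by (simp add: xs_def p_list_6 nth_tl del: upt_Suc)
  define i where "i = n - 2"
  have i: "i + 3 < length xs" "n = i + 2" using n by (auto simp: i_def len)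
  define a where "a = real (p (n - 1))"
  define b where "b = real (p n)"
  define c where "c = real (p (n + 1))"
  define d where "d = real (p (n + 2))"
  have pos: "a > 0" "b > 0" "c > 0" "d > 0"
    by (simp_all add: a_def b_def c_def d_def p_pos)
  have "4 * ((int (p n))\<^sup>2 - int (p (n - 1)) * int (p (n + 1))) * ((int (p (n + 1)))\<^sup>2 - int (p n) * int (p (n + 2))) <
      (int (p n) * int (p (n + 1)) - int (p (n - 1)) * int (p (n + 2)))\<^sup>2"
  proof -
    have "xs ! i = int (p (n - 1))" "xs ! (i + 1) = int (p n)" "xs ! (i + 2) = int (p (n + 1))" "xs ! (i + 3) = int (p (n + 2))"
    proof -
      have idx: "n - 1 = Suc i" "n = Suc (i + 1)" "n + 1 = Suc (i + 2)" "n + 2 = Suc (i + 3)"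
        using i(2) by simp_all
      have less: "i < 46" "i + 1 < 46" "i + 2 < 46" "i + 3 < 46"
        using i(1) unfolding len by simp_all
      show "xs ! i = int (p (n - 1))" unfolding idx(1) by (rule nth[OF less(1)])
      show "xs ! (i + 1) = int (p n)" using nth[OF less(2)] unfolding idx(2)[symmetric] .
      show "xs ! (i + 2) = int (p (n + 1))" unfolding idx(3) by (rule nth[OF less(3)])
      show "xs ! (i + 3) = int (p (n + 2))" unfolding idx(4) by (rule nth[OF less(4)])
    qed
    then show ?thesis
      using check_small_nth[OF check_small_p[folded xs_def] i(1)] by (simp only:)
  qed
  then have "real_of_int (4 * ((int (p n))\<^sup>2 - int (p (n - 1)) * int (p (n + 1))) * ((int (p (n + 1)))\<^sup>2 - int (p n) * int (p (n + 2)))) <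
      real_of_int ((int (p n) * int (p (n + 1)) - int (p (n - 1)) * int (p (n + 2)))\<^sup>2)"
    by (simp only: of_int_less_iff)
  then have ineq: "4 * (b\<^sup>2 - a * c) * (c\<^sup>2 - b * d) < (b * c - a * d)\<^sup>2"
    by (simp add: a_def b_def c_def d_def)
  have u: "u n = c * a / b\<^sup>2" "u (n + 1) = d * b / c\<^sup>2"
    by (simp_all add: u_def a_def b_def c_def d_def)
  have bc: "b\<^sup>2 * c\<^sup>2 > 0" using pos by simp
  have "4 * (1 - u n) * (1 - u (n + 1)) = 4 * (b\<^sup>2 - a * c) * (c\<^sup>2 - b * d) / (b\<^sup>2 * c\<^sup>2)"
    using pos unfolding u by (simp add: field_simps)
  also have "\<dots> < (b * c - a * d)\<^sup>2 / (b\<^sup>2 * c\<^sup>2)"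
    using ineq bc by (rule divide_strict_right_mono)
  also have "\<dots> = ((b * c - a * d) / (b * c))\<^sup>2"
    by (simp add: power_divide power_mult_distrib)
  also have "(b * c - a * d) / (b * c) = 1 - u n * u (n + 1)"
    using pos unfolding u by (simp add: field_simps power2_eq_square)
  finally show ?thesis .
qed

section \<open>From the bounds on \<open>u n\<close> to the inequality\<close>

lemma u_strict_bounds:
  assumes "n \<ge> 45"
  shows "u n < 1" and "1 < u n * (1 + u_eps n)"
  by (cases "n < 385"; rule u_strict_bounds_medium u_strict_bounds_large; use assms in simp)+

text \<open>The squared bracket exceeds \<open>4 * x * y - 2 * x * y * (x + y)\<close>, the
  difference being \<open>(x - y)\<^sup>2 + (x * y)\<^sup>2\<close>. The hypotheses say that
  \<open>x\<close> and \<open>y\<close> are below \<open>k = e / (1 + e)\<close>, so the loss is at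
  most the factor \<open>1 - k\<close>, which \<open>1 + e\<close> compensates exactly.\<close>

lemma turan_type_inequality:
  fixes x y e :: real
  assumes "0 < x" "0 < y" "e > 0" "1 < (1 - x) * (1 + e)" "1 < (1 - y) * (1 + e)"
  shows "4 * x * y < (1 + e) * (1 - (1 - x) * (1 - y))\<^sup>2"
proof -
  define k where "k = e / (1 + e)"
  have xk: "x < k" "y < k"
    using assms by (simp_all add: k_def field_simps)
  have k: "(1 + e) * (1 - k) = 1"
    using assms by (simp add: k_def field_simps)
  have "x * y * (x + y) \<le> x * y * (2 * k)"
    using assms xk by (intro mult_left_mono) auto
  moreover have "(1 - (1 - x) * (1 - y))\<^sup>2 = (x - y)\<^sup>2 + 4 * (x * y) - 2 * (x * y * (x + y)) + (x * y)\<^sup>2"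
    by (simp add: power2_eq_square algebra_simps)
  moreover have "(x * y)\<^sup>2 > 0" "(x - y)\<^sup>2 \<ge> 0"
    using assms by simp_all
  ultimately have "4 * (x * y) * (1 - k) < (1 - (1 - x) * (1 - y))\<^sup>2"
    unfolding right_diff_distrib[of "4 * (x * y)"] by linarith
  then have "(1 + e) * (4 * (x * y) * (1 - k)) < (1 + e) * (1 - (1 - x) * (1 - y))\<^sup>2"
    using assms by (intro mult_strict_left_mono) auto
  moreover have "(1 + e) * (4 * (x * y) * (1 - k)) = 4 * x * y * ((1 + e) * (1 - k))"
    by (simp only: mult_ac)
  ultimately show ?thesis
    by (simp only: k mult_1_right)
qed

text \<open>The elementary inequality wants one \<open>e\<close> for both ratios; this weakens the
  bound for \<open>u (n + 1)\<close> from \<open>u_eps (n + 1)\<close> to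
  \<open>u_eps n\<close>.\<close>

lemma u_eps_antimono:
  assumes "n > 0"
  shows "u_eps (n + 1) \<le> u_eps n"
  unfolding u_eps_def using assms
  by (intro divide_left_mono mult_left_mono powr_mono2 mult_pos_pos) auto

theorem theorem1p2:
  fixes n :: nat
  assumes "n \<ge> 2"
  shows "4 * (1 - u n) * (1 - u (n + 1))
    < (1 + pi / (sqrt 24 * real n powr (3 / 2))) * (1 - u n * u (n + 1))\<^sup>2"
proof (cases "n < 45")
  case True
  have "4 * (1 - u n) * (1 - u (n + 1)) < 1 * (1 - u n * u (n + 1))\<^sup>2"
    using u_small[OF assms True] by simp
  also have "\<dots> \<le> (1 + pi / (sqrt 24 * real n powr (3 / 2))) * (1 - u n * u (n + 1))\<^sup>2"
    by (intro mult_right_mono) auto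
  finally show ?thesis .
next
  case False
  have pos: "u_eps n > 0"
    using assms by (simp add: u_eps_def)
  have "1 < u (n + 1) * (1 + u_eps (n + 1))"
    using u_strict_bounds(2)[of "n + 1"] False by simp
  also have "\<dots> \<le> u (n + 1) * (1 + u_eps n)"
    using u_eps_antimono[of n] assms by (intro mult_left_mono) (auto simp: u_def)
  finally have "1 < u (n + 1) * (1 + u_eps n)" .
  then have "4 * (1 - u n) * (1 - u (n + 1)) <
      (1 + u_eps n) * (1 - (1 - (1 - u n)) * (1 - (1 - u (n + 1))))\<^sup>2"
    using u_strict_bounds[of n] u_strict_bounds(1)[of "n + 1"] False pos
    by (intro turan_type_inequality) auto
  then show ?thesis
    by (simp add: u_eps_def)
qed

end
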